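(* Let $\mathfrak d=\sum_{n=1}^\infty d_n\delta_n$, where $\{d_n\}$ is a sequence of complex numbers such that for every $\tau>0$ there is $C_\tau>0$ with $|d_n|\le C_\tau n^\tau$ for all $n\geq 1$. Let $f$ be a locally integrable function on $\mathbb R^+$ belonging to $\mathcal H^{-\infty}$ such that for some $K>0$ and $\epsilon>0$ $$\int_K^\infty a^\epsilon|f(a)|^2\,da<\infty .$$ Then the generalized matrix coefficient $\mu_{\mathfrak d,f}(ab_t)$ is a well-defined locally integrable function on $G$. In addition, for some positive constant $C_{\epsilon,\mathfrak d}$ (depending only on $\epsilon$ and $\mathfrak d$), $$|d_1|^2\int_K^\infty a^\epsilon|f(a)|^2\,da\le\int_K^\infty\int_0^1|\mu_{\mathfrak d,f}(ab_t)|^2\,dt\,a^\epsilon\frac{da}{a}\le C_{\epsilon,\mathfrak d}\int_K^\infty a^\epsilon|f(a)|^2\,da .$$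
   Context: $\mathbb R^+=(0,\infty)$. $G$ is the $ax+b$ group, with elements $ab_t$ ($a\in\mathbb R^+$, $t\in\mathbb R$), product $ab_t\,a'b_{t'}=aa'\,b_{a't+t'}$, and left Haar measure $\frac{da}{a}dt$. $\mu$ is the unitary representation of $G$ on $\mathcal H=L^2(\mathbb R^+)$ given by $\mu(a)f(x)=a^{-1/2}f(a^{-1}x)$, $\mu(b_t)f(x)=e^{-2\pi itx}f(x)$; its contragredient $\mu^*$ on $L^2(\mathbb R^+)$ is $\mu^*(a)f(x)=a^{-1/2}f(a^{-1}x)$, $\mu^*(b_t)f(x)=e^{2\pi itx}f(x)$. $\mathcal H^\infty=\{f\in C^\infty(\mathbb R^+): x^m f^{(n)}\in L^2(\mathbb R^+)\ \forall m\ge n\ge0\}$ is the Fréchet space of smooth vectors of $\mu$, with seminorms $\|x^mf^{(n)}\|_{L^2}$, $m\geq n\geq 0$; the smooth vectors of $\mu^*$ form the same Fréchet space. $\mathcal H^{-\infty}$ is the space of continuous linear functionals on this Fréchet space; since $C_c^\infty(\mathbb R^+)$ is dense, it is regarded as a subspace of the distributions on $\mathbb R^+$, and a locally integrable $f$ lies in $\mathcal H^{-\infty}$ if $\psi\mapsto\int f\psi\,dx$ on $C_c^\infty(\mathbb R^+)$ extends to such a functional. Pairings are bilinear. $\delta_n$ is the Dirac distribution at $n$, so $\langle\mathfrak d,\psi\rangle=\sum_n d_n\psi(n)$. Matrix coefficients: for $f\in\mathcal H^\infty$, $\mu_{\mathfrak d,f}(g)=\langle\mu(g)\mathfrak d,f\rangle=\langle\mathfrak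 d,\mu^*(g^{-1})f\rangle$, so $\mu_{\mathfrak d,f}(ab_t)=\sum_{n\ge1}a^{1/2}d_nf(an)e^{-2\pi itn}$. For general $f\in\mathcal H^{-\infty}$, $\mu_{\mathfrak d,f}$ is the distribution on $G$ given by $\varphi\mapsto\langle\mu(\varphi)\mathfrak d,f\rangle$, $\varphi\in C_c^\infty(G)$, where $\mu(\varphi)\mathfrak d=\int_G\varphi(g)\mu(g)\mathfrak d\,dg\in\mathcal H^\infty$ and $dg=\frac{da}{a}dt$; it "is a locally integrable function $u$" if it equals $\varphi\mapsto\int_G u\varphi\,dg$. *)

theory Defs
  imports "HOL-Analysis.Analysis" "HOL-Algebra.Group"
begin

section \<open>Smooth functions and test functions\<close>

text \<open>Meant for open \<open>S\<close>: \<open>C\<^sup>k\<close> by iterating directional derivatives.\<close>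

primrec Ck_on :: "nat \<Rightarrow> 'a::euclidean_space set \<Rightarrow> ('a \<Rightarrow> 'b::real_normed_vector) \<Rightarrow> bool" where
  "Ck_on 0 S f \<longleftrightarrow> continuous_on S f"
| "Ck_on (Suc k) S f \<longleftrightarrow>
     (\<forall>x\<in>S. f differentiable (at x)) \<and> (\<forall>v. Ck_on k S (\<lambda>x. frechet_derivative f (at x) v))"

definition smooth_on :: "'a::euclidean_space set \<Rightarrow> ('a \<Rightarrow> 'b::real_normed_vector) \<Rightarrow> bool" where
  "smooth_on S f \<longleftrightarrow> (\<forall>k. Ck_on k S f)"

text \<open>Elements of \<open>C\<^sub>c\<^sup>\<infinity>(S)\<close>, for open \<open>S\<close>, are extended by zero to the whole space.\<close>

definition test_functions :: "'a::euclidean_space set \<Rightarrow> ('a \<Rightarrow> complex) set" where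
  "test_functions S =
     {\<phi>. smooth_on S \<phi> \<and> (\<exists>K. compact K \<and> K \<subseteq> S \<and> (\<forall>x. x \<notin> K \<longrightarrow> \<phi> x = 0))}"

definition locally_integrable ::
  "'a::euclidean_space measure \<Rightarrow> 'a set \<Rightarrow> ('a \<Rightarrow> complex) \<Rightarrow> bool" where
  "locally_integrable M S f \<longleftrightarrow> (\<forall>K. compact K \<and> K \<subseteq> S \<longrightarrow> set_integrable M K f)"

definition nth_deriv :: "nat \<Rightarrow> (real \<Rightarrow> complex) \<Rightarrow> real \<Rightarrow> complex" where
  "nth_deriv n f = ((\<lambda>g x. vector_derivative g (at x)) ^^ n) f"

section \<open>The \<open>ax+b\<close> group\<close>

text \<open>The pair \<open>(a, t)\<close> stands for the element \<open>a b\<^sub>t\<close>.\<close>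

definition axb :: "(real \<times> real) monoid" where
  "axb = \<lparr>carrier = {0<..} \<times> UNIV,
          mult = (\<lambda>(a, t) (a', t'). (a * a', a' * t + t')),
          one = (1, 0)\<rparr>"

lemma group_axb: "group axb"
proof (rule groupI)
  fix x assume "x \<in> carrier axb"
  then obtain a t where x: "x = (a, t)" "a > 0" by (auto simp: axb_def)
  show "\<exists>y\<in>carrier axb. y \<otimes>\<^bsub>axb\<^esub> x = \<one>\<^bsub>axb\<^esub>"
    by (rule bexI[of _ "(1 / a, - t / a)"]) (use x in \<open>auto simp: axb_def\<close>)
qed (auto simp: axb_def algebra_simps)

lemma inv_axb:
  assumes "a > 0"
  shows "inv\<^bsub>axb\<^esub> (a, t) = (1 / a, - t / a)"
  by (rule group.inv_equality[OF group_axb]) (use assms in \<open>auto simp: axb_def\<close>)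

text \<open>The left Haar measure \<open>da/a dt\<close>, as a Borel measure on the plane concentrated on the
  half-plane \<open>a > 0\<close>.\<close>

definition haar :: "(real \<times> real) measure" where
  "haar = density lborel (\<lambda>g. indicator (carrier axb) g * ennreal (1 / fst g))"

section \<open>Smooth vectors and their dual\<close>

definition L2_pos :: "(real \<Rightarrow> complex) \<Rightarrow> bool" where
  "L2_pos f \<longleftrightarrow> set_borel_measurable lebesgue {0<..} f \<and>
     set_integrable lebesgue {0<..} (\<lambda>x. (cmod (f x))\<^sup>2)"

definition L2_pos_norm :: "(real \<Rightarrow> complex) \<Rightarrow> real" where
  "L2_pos_norm f = sqrt (LINT x:{0<..}|lebesgue. (cmod (f x))\<^sup>2)"

text \<open>Smooth vectors are functions on \<open>(0,\<infinity>)\<close>; they are extended by zero so that each is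
  represented by exactly one function on the line (which need not be smooth at \<open>0\<close>).\<close>

definition Hinf :: "(real \<Rightarrow> complex) set" where
  "Hinf = {f. smooth_on {0<..} f \<and> (\<forall>x\<le>0. f x = 0) \<and>
     (\<forall>m n. n \<le> m \<longrightarrow> L2_pos (\<lambda>x. of_real (x ^ m) * nth_deriv n f x))}"

definition Hinf_seminorm :: "nat \<Rightarrow> nat \<Rightarrow> (real \<Rightarrow> complex) \<Rightarrow> real" where
  "Hinf_seminorm m n f = L2_pos_norm (\<lambda>x. of_real (x ^ m) * nth_deriv n f x)"

definition Hinf_topology :: "(real \<Rightarrow> complex) topology" where
  "Hinf_topology = topology_generated_by
     {{g \<in> Hinf. Hinf_seminorm m n (\<lambda>x. g x - f x) < r} | f m n r. f \<in> Hinf \<and> n \<le> m \<and> 0 < r}"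

definition Hminf :: "((real \<Rightarrow> complex) \<Rightarrow> complex) set" where
  "Hminf = {F. (\<forall>f\<in>Hinf. \<forall>g\<in>Hinf. F (\<lambda>x. f x + g x) = F f + F g) \<and>
     (\<forall>c. \<forall>f\<in>Hinf. F (\<lambda>x. c * f x) = c * F f) \<and>
     continuous_map Hinf_topology euclidean F}"

text \<open>\<open>F\<close> is the element of the dual determined by the function \<open>f\<close>. Its values on
  \<^const>\<open>Hinf\<close> are unique since \<open>C\<^sub>c\<^sup>\<infinity>(0,\<infinity>)\<close> is dense there.\<close>

definition extends_to :: "(real \<Rightarrow> complex) \<Rightarrow> ((real \<Rightarrow> complex) \<Rightarrow> complex) \<Rightarrow> bool" where
  "extends_to f F \<longleftrightarrow> F \<in> Hminf \<and>
     (\<forall>\<psi>\<in>test_functions {0<..}. F \<psi> = (LINT x:{0<..}|lebesgue. f x * \<psi> x))"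

definition in_Hminf :: "(real \<Rightarrow> complex) \<Rightarrow> bool" where
  "in_Hminf f \<longleftrightarrow> locally_integrable lebesgue {0<..} f \<and> (\<exists>F. extends_to f F)"

section \<open>The representation and its generalized matrix coefficients\<close>

definition dilation :: "real \<Rightarrow> (real \<Rightarrow> complex) \<Rightarrow> real \<Rightarrow> complex" where
  "dilation a f = (\<lambda>x. of_real (a powr (- 1 / 2)) * f (inverse a * x))"

definition modulation :: "real \<Rightarrow> (real \<Rightarrow> complex) \<Rightarrow> real \<Rightarrow> complex" where
  "modulation t f = (\<lambda>x. exp (2 * of_real pi * \<i> * of_real t * of_real x) * f x)"

text \<open>The contragredient \<open>\<mu>\<^sup>*(a b\<^sub>t) = \<mu>\<^sup>*(a) \<mu>\<^sup>*(b\<^sub>t)\<close>.\<close>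

definition mu_star :: "real \<times> real \<Rightarrow> (real \<Rightarrow> complex) \<Rightarrow> real \<Rightarrow> complex" where
  "mu_star g f = dilation (fst g) (modulation (snd g) f)"

text \<open>The action of \<open>\<mu>\<close> on the dual of the smooth vectors of \<open>\<mu>\<^sup>*\<close>.\<close>

definition mu_dual ::
  "real \<times> real \<Rightarrow> ((real \<Rightarrow> complex) \<Rightarrow> complex) \<Rightarrow> (real \<Rightarrow> complex) \<Rightarrow> complex" where
  "mu_dual g D = (\<lambda>\<psi>. D (mu_star (inv\<^bsub>axb\<^esub> g) \<psi>))"

text \<open>\<open>h = \<mu>(\<phi>)D = \<integral> \<phi>(g) \<mu>(g)D dg\<close>, as a weak integral in the dual which is a smooth vector.\<close>

definition is_mu_smeared ::
  "(real \<times> real \<Rightarrow> complex) \<Rightarrow> ((real \<Rightarrow> complex) \<Rightarrow> complex) \<Rightarrow> (real \<Rightarrow> complex) \<Rightarrow> bool" where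
  "is_mu_smeared \<phi> D h \<longleftrightarrow> h \<in> Hinf \<and>
     (\<forall>\<psi>\<in>Hinf. has_bochner_integral haar (\<lambda>g. \<phi> g * mu_dual g D \<psi>)
        (LINT x:{0<..}|lebesgue. h x * \<psi> x))"

text \<open>\<open>c = \<langle>\<mu>(\<phi>)D, f\<rangle>\<close>.\<close>

definition is_matrix_coeff_value ::
  "((real \<Rightarrow> complex) \<Rightarrow> complex) \<Rightarrow> (real \<Rightarrow> complex) \<Rightarrow> (real \<times> real \<Rightarrow> complex) \<Rightarrow> complex \<Rightarrow> bool"
  where
  "is_matrix_coeff_value D f \<phi> c \<longleftrightarrow>
     (\<exists>h F. is_mu_smeared \<phi> D h \<and> extends_to f F \<and> c = F h)"

definition matrix_coeff_well_defined ::
  "((real \<Rightarrow> complex) \<Rightarrow> complex) \<Rightarrow> (real \<Rightarrow> complex) \<Rightarrow> bool" where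
  "matrix_coeff_well_defined D f \<longleftrightarrow> D \<in> Hminf \<and>
     (\<forall>\<phi>\<in>test_functions (carrier axb). \<exists>!c. is_matrix_coeff_value D f \<phi> c)"

definition matrix_coeff ::
  "((real \<Rightarrow> complex) \<Rightarrow> complex) \<Rightarrow> (real \<Rightarrow> complex) \<Rightarrow> (real \<times> real \<Rightarrow> complex) \<Rightarrow> complex" where
  "matrix_coeff D f \<phi> = (THE c. is_matrix_coeff_value D f \<phi> c)"

definition matrix_coeff_is_function ::
  "((real \<Rightarrow> complex) \<Rightarrow> complex) \<Rightarrow> (real \<Rightarrow> complex) \<Rightarrow> (real \<times> real \<Rightarrow> complex) \<Rightarrow> bool" where
  "matrix_coeff_is_function D f u \<longleftrightarrow> locally_integrable haar (carrier axb) u \<and>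
     (\<forall>\<phi>\<in>test_functions (carrier axb). matrix_coeff D f \<phi> = (LINT g|haar. u g * \<phi> g))"

text \<open>The functional \<open>\<Sum>\<^sub>n\<^sub>\<ge>\<^sub>1 d\<^sub>n \<delta>\<^sub>n\<close>; the value \<open>d 0\<close> is not used.\<close>

definition dirac_comb :: "(nat \<Rightarrow> complex) \<Rightarrow> (real \<Rightarrow> complex) \<Rightarrow> complex" where
  "dirac_comb d = (\<lambda>\<psi>. \<Sum>n. d (Suc n) * \<psi> (real (Suc n)))"

end

theory Submission
  imports Defs
begin

text \<open>
  The matrix coefficient ought to be the series
  \<open>u(a, t) = \<Sum> d\<^sub>n a\<^sup>1\<^sup>/\<^sup>2 f(an) e\<^sup>-\<^sup>2\<^sup>\<pi>\<^sup>i\<^sup>n\<^sup>t\<close>, and for fixed \<open>a\<close> this is a Fourier series in \<open>t\<close>.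
  Parseval's identity makes \<open>\<integral>|u(a, t)|\<^sup>2 dt\<close> equal to \<open>a \<Sum> |d\<^sub>n|\<^sup>2 |f(an)|\<^sup>2\<close>. Integrated over \<open>a > K\<close>
  against \<open>a\<^sup>\<epsilon> da/a\<close>, the summand \<open>n = 1\<close> is the lower bound of the theorem, and the substitution
  \<open>x = an\<close> bounds the \<open>n\<close>-th summand by \<open>|d\<^sub>n|\<^sup>2 n\<^sup>-\<^sup>1\<^sup>-\<^sup>\<epsilon>\<close> times the integral of \<open>x\<^sup>\<epsilon> |f(x)|\<^sup>2\<close>. So
  the constant is \<open>\<Sum> |d\<^sub>n|\<^sup>2 n\<^sup>-\<^sup>1\<^sup>-\<^sup>\<epsilon>\<close>, which is finite because \<open>d\<close> grows more slowly than any power.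

  Two things have to be justified: that the series defines a locally integrable function, and that
  this function is the matrix coefficient in the distributional sense.

  For the first, the same substitution leaves room for a weight: \<open>\<Sum> n\<^sup>s |d\<^sub>n|\<^sup>2 |f(an)|\<^sup>2\<close> is integrable
  in \<open>a\<close> over compact sets for some \<open>s > 0\<close>, up to the finitely many terms with \<open>an \<le> K\<close>, where \<open>f\<close> is
  only known to be locally integrable. Hence the dyadic blocks
  \<open>2\<^sup>k \<le> n < 2\<^sup>k\<^sup>+\<^sup>1\<close> of the series decay geometrically in \<open>L\<^sup>2\<close> of a box, so in \<open>L\<^sup>1\<close>
  (\<open>block_L1_on_box\<close>). Their sum \<open>coefficient\<close> converges absolutely almost everywhere and in
  \<open>L\<^sup>1\<close> of every box, and so do almost all of its sections in \<open>t\<close>.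

  For the second, \<open>\<mu>(\<phi>)d\<close> is computed: integrating over \<open>t\<close> first, the contribution of
  \<open>d\<^sub>n \<delta>\<^sub>n\<close> is \<open>h\<^sub>n(x) = (d\<^sub>n / n) \<Psi>\<^sub>n(x / n)\<close>, where \<open>\<Psi>\<^sub>n(a)\<close> is the \<open>n\<close>-th Fourier coefficient of
  \<open>t \<mapsto> a\<^sup>-\<^sup>1\<^sup>/\<^sup>2 \<phi>(a, t)\<close>. Integration by parts gives rapid decay in \<open>n\<close>
  (\<open>fourier_decay\<close>), and therefore the series \<open>\<Sum> h\<^sub>n\<close> converges in the Frechet space of smooth vectors
  (\<open>partial_tendsto\<close>). Its partial sums are test functions on the half-line, on which every
  extension of \<open>f\<close> is integration against \<open>f\<close>. By continuity the extension takes the value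
  \<open>lim \<integral> f (h\<^sub>1 + \<dots> + h\<^sub>N)\<close> at \<open>\<mu>(\<phi>)d\<close>, and by Fubini's theorem the integrals are those of \<open>\<phi>\<close>
  against the partial sums of \<open>u\<close>.
\<close>

section \<open>Iterated derivatives\<close>

definition deriv_chain :: "real set \<Rightarrow> (nat \<Rightarrow> real \<Rightarrow> complex) \<Rightarrow> bool" where
  "deriv_chain S G \<longleftrightarrow> (\<forall>j. \<forall>x\<in>S. (G j has_vector_derivative G (Suc j) x) (at x))"

lemma Ck_on_cong:
  assumes "open S" "\<And>x. x \<in> S \<Longrightarrow> f x = g x" "Ck_on k S f"
  shows "Ck_on k S g"
  using assms(2,3)
proof (induction k arbitrary: f g)
  case 0
  then show ?case by (auto intro: continuous_on_eq)
next
  case (Suc k)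
  have D: "f differentiable (at x)" if "x \<in> S" for x using Suc.prems that by auto
  have "g differentiable (at x)" if "x \<in> S" for x
    using D[OF that] Suc.prems(1) assms(1) that
    unfolding differentiable_def by (metis has_derivative_transform_within_open)
  moreover have "Ck_on k S (\<lambda>x. frechet_derivative g (at x) v)" for v
  proof (rule Suc.IH)
    show "Ck_on k S (\<lambda>x. frechet_derivative f (at x) v)" using Suc.prems by auto
    show "frechet_derivative f (at x) v = frechet_derivative g (at x) v" if "x \<in> S" for x
      using frechet_derivative_transform_within_open[OF D[OF that] assms(1) that Suc.prems(1)] by simp
  qed
  ultimately show ?case by simp
qed

lemma Ck_on_SucD: "Ck_on (Suc k) S f \<Longrightarrow> Ck_on k S f"
proof (induction k arbitrary: f)
  case 0
  then show ?case
    by (auto intro!: differentiable_imp_continuous_on simp: differentiable_on_def differentiable_at_withinI)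
next
  case (Suc k)
  then show ?case by (metis Ck_on.simps(2))
qed

lemma Ck_on_add:
  assumes "open S" "Ck_on k S f" "Ck_on k S g"
  shows "Ck_on k S (\<lambda>x. f x + g x)"
  using assms(2,3)
proof (induction k arbitrary: f g)
  case 0
  then show ?case by (auto intro: continuous_intros)
next
  case (Suc k)
  have "Ck_on k S (\<lambda>x. frechet_derivative (\<lambda>x. f x + g x) (at x) v)" for v
  proof (rule Ck_on_cong[OF assms(1)])
    show "Ck_on k S (\<lambda>x. frechet_derivative f (at x) v + frechet_derivative g (at x) v)"
      using Suc by auto
    show "frechet_derivative f (at x) v + frechet_derivative g (at x) v
          = frechet_derivative (\<lambda>x. f x + g x) (at x) v" if "x \<in> S" for x
      using frechet_derivative_at[OF has_derivative_add, of f "frechet_derivative f (at x)" x g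
          "frechet_derivative g (at x)"] that Suc.prems
      by (auto simp: frechet_derivative_works fun_eq_iff)
  qed
  then show ?case using Suc.prems by auto
qed

text \<open>A function is smooth as soon as a whole sequence of successive derivatives is exhibited. The
  functions on the half-line built below come with such a sequence, from which their iterated
  derivatives are read off.\<close>

lemma Ck_on_chain:
  assumes "open S" "deriv_chain S G"
  shows "Ck_on k S (\<lambda>x. c *\<^sub>R G j x)"
proof (induction k arbitrary: c j)
  case 0
  have "isCont (G j) x" if "x \<in> S" for x
    using assms that has_vector_derivative_continuous unfolding deriv_chain_def by blast
  then show ?case by (auto intro!: continuous_intros continuous_at_imp_continuous_on)
next
  case (Suc k)
  have D: "((\<lambda>x. c *\<^sub>R G j x) has_derivative (\<lambda>v. (v * c) *\<^sub>R G (Suc j) x)) (at x)" if "x \<in> S" for x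
  proof -
    have "(G j has_derivative (\<lambda>v. v *\<^sub>R G (Suc j) x)) (at x)"
      using assms that unfolding deriv_chain_def has_vector_derivative_def by auto
    from has_derivative_scaleR_right[OF this, of c] show ?thesis by (simp add: mult.commute)
  qed
  have "Ck_on k S (\<lambda>x. frechet_derivative (\<lambda>x. c *\<^sub>R G j x) (at x) v)" for v
    by (rule Ck_on_cong[OF assms(1) _ Suc.IH[of "v * c" "Suc j"]])
       (simp add: frechet_derivative_at[OF D, symmetric])
  then show ?case using D by (auto simp: differentiable_def)
qed

lemma smooth_on_chain:
  assumes "open S" "deriv_chain S G" shows "smooth_on S (G 0)"
  using Ck_on_chain[OF assms, of _ 1 0] by (simp add: smooth_on_def)

lemma nth_deriv_chain:
  assumes "open S" "deriv_chain S G" "x \<in> S"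
  shows "nth_deriv j (G 0) x = G j x"
  using assms(3)
proof (induction j arbitrary: x)
  case 0
  then show ?case by (simp add: nth_deriv_def)
next
  case (Suc j)
  have "(nth_deriv j (G 0) has_vector_derivative G (Suc j) x) (at x)"
  proof (rule has_vector_derivative_transform_within_open[OF _ assms(1) Suc.prems])
    show "(G j has_vector_derivative G (Suc j) x) (at x)"
      using assms(2) Suc.prems unfolding deriv_chain_def by blast
  qed (simp add: Suc.IH)
  then show ?case by (simp add: nth_deriv_def vector_derivative_at)
qed

lemma deriv_chain_of_smooth:
  assumes "open S" "smooth_on S f"
  shows "deriv_chain S (\<lambda>j. nth_deriv j f)"
proof -
  have "Ck_on (Suc j) S f \<Longrightarrow> x \<in> S \<Longrightarrow> nth_deriv j f differentiable (at x)" for j x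
  proof (induction j arbitrary: f)
    case 0
    then show ?case by (auto simp: nth_deriv_def)
  next
    case (Suc j)
    have eq: "nth_deriv (Suc j) f = nth_deriv j (\<lambda>x. vector_derivative f (at x))"
      by (simp add: nth_deriv_def funpow_Suc_right del: funpow.simps)
    have "Ck_on (Suc j) S (\<lambda>x. frechet_derivative f (at x) 1)"
      using Suc.prems(1) by (metis Ck_on.simps(2))
    then have "Ck_on (Suc j) S (\<lambda>x. vector_derivative f (at x))"
      by (rule Ck_on_cong[OF assms(1), rotated])
         (use Suc.prems(1) in \<open>simp add: frechet_derivative_eq_vector_derivative\<close>)
    then show ?case using Suc eq by simp
  qed
  then show ?thesis
    using assms(2) unfolding deriv_chain_def smooth_on_def
    by (auto simp: nth_deriv_def vector_derivative_works)
qed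

lemma deriv_chain_continuous_on:
  "deriv_chain S G \<Longrightarrow> continuous_on S (G j)"
  using has_vector_derivative_continuous unfolding deriv_chain_def
  by (blast intro: continuous_at_imp_continuous_on)

section \<open>Test functions on the group and their Fourier coefficients\<close>

lemma Ck_on_extend_zero:
  fixes \<phi> :: "'a::euclidean_space \<Rightarrow> 'b::real_normed_vector"
  assumes "open S" "closed K" "K \<subseteq> S" "\<And>x. x \<notin> K \<Longrightarrow> \<phi> x = 0" "Ck_on k S \<phi>"
  shows "Ck_on k UNIV \<phi>"
  using assms(4,5)
proof (induction k arbitrary: \<phi>)
  case 0
  have "continuous_on (- K) \<phi>" using 0 by (intro continuous_on_eq[OF continuous_on_const[of _ 0]]) auto
  then have "continuous_on (S \<union> - K) \<phi>"
    using 0 assms(1,2) by (intro continuous_on_open_Un) auto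
  moreover have "S \<union> - K = UNIV" using assms(3) by auto
  ultimately show ?case by simp
next
  case (Suc k)
  have z: "(\<phi> has_derivative (\<lambda>_. 0)) (at x)" if "x \<notin> K" for x
  proof (rule has_derivative_transform_within_open[of "\<lambda>_. 0" "\<lambda>_. 0" x UNIV "- K"])
    show "0 = \<phi> y" if "y \<in> - K" for y using Suc.prems(1)[of y] that by simp
  qed (use that assms(2) in auto)
  have "\<phi> differentiable (at x)" for x
  proof (cases "x \<in> K")
    case True
    then show ?thesis using Suc.prems(2) assms(3) by auto
  next
    case False
    then show ?thesis using z unfolding differentiable_def by blast
  qed
  moreover have "Ck_on k UNIV (\<lambda>x. frechet_derivative \<phi> (at x) v)" for v
  proof (rule Suc.IH)
    show "frechet_derivative \<phi> (at x) v = 0" if "x \<notin> K" for x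
      using frechet_derivative_at[OF z[OF that]] by metis
    show "Ck_on k S (\<lambda>x. frechet_derivative \<phi> (at x) v)" using Suc.prems(2) by simp
  qed
  ultimately show ?case by simp
qed

text \<open>The unit margin in \<open>t\<close> makes the function vanish at \<open>t = \<plusminus>T\<close>, so
  that integration by parts over \<open>{-T..T}\<close> has no boundary
  terms, while the support condition remains closed and is inherited by derivatives.\<close>

definition box_test :: "real \<Rightarrow> real \<Rightarrow> real \<Rightarrow> (real \<times> real \<Rightarrow> complex) \<Rightarrow> bool" where
  "box_test \<alpha> \<beta> T \<phi> \<longleftrightarrow> smooth_on UNIV \<phi> \<and>
     (\<forall>a t. \<phi> (a, t) \<noteq> 0 \<longrightarrow> \<alpha> \<le> a \<and> a \<le> \<beta> \<and> \<bar>t\<bar> \<le> T - 1)"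

lemma carrier_axb: "carrier axb = {0<..} \<times> UNIV"
  by (simp add: axb_def)

lemma open_carrier_axb: "open (carrier axb)"
  by (auto simp: carrier_axb intro: open_Times)

lemma compact_carrier_axb_box:
  assumes "compact K" "K \<subseteq> carrier axb"
  obtains \<alpha> \<beta> and N :: nat where "0 < \<alpha>" "\<alpha> < \<beta>" "0 < N"
    "\<And>a t. (a, t) \<in> K \<Longrightarrow> \<alpha> \<le> a \<and> a \<le> \<beta> \<and> \<bar>t\<bar> < real N"
proof (cases "K = {}")
  case True
  then show ?thesis using that[of 1 2 1] by auto
next
  case False
  have c: "compact (fst ` K)" "fst ` K \<noteq> {}"
    using assms False by (auto intro!: compact_continuous_image continuous_intros)
  obtain \<alpha> where \<alpha>: "\<alpha> \<in> fst ` K" "\<forall>x\<in>fst ` K. \<alpha> \<le> x" using compact_attains_inf[OF c] by blast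
  obtain b where b: "\<forall>x\<in>K. norm x \<le> b" using compact_imp_bounded[OF assms(1)] bounded_iff by blast
  obtain N :: nat where N: "b < real N" using reals_Archimedean2 by blast
  have B: "\<bar>a\<bar> \<le> b \<and> \<bar>t\<bar> \<le> b" if "(a, t) \<in> K" for a t
    using b that norm_fst_le[of a t] norm_snd_le[of t a] by fastforce
  show ?thesis
  proof (rule that[of \<alpha> "max b \<alpha> + 1" "Suc N"])
    show "0 < \<alpha>" using \<alpha> assms(2) by (auto simp: carrier_axb)
    show "\<alpha> \<le> a \<and> a \<le> max b \<alpha> + 1 \<and> \<bar>t\<bar> < real (Suc N)" if "(a, t) \<in> K" for a t
      using B[OF that] \<alpha>(2) that N by force
  qed auto
qed

lemma test_function_imp_box_test:
  assumes "\<phi> \<in> test_functions (carrier axb)"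
  obtains \<alpha> \<beta> and N :: nat where "0 < \<alpha>" "\<alpha> < \<beta>" "0 < N" "box_test \<alpha> \<beta> (real N) \<phi>"
proof -
  obtain K where K: "smooth_on (carrier axb) \<phi>" "compact K" "K \<subseteq> carrier axb" "\<And>x. x \<notin> K \<Longrightarrow> \<phi> x = 0"
    using assms unfolding test_functions_def by auto
  obtain \<alpha> \<beta> and N :: nat where *: "0 < \<alpha>" "\<alpha> < \<beta>" "0 < N"
    "\<And>a t. (a, t) \<in> K \<Longrightarrow> \<alpha> \<le> a \<and> a \<le> \<beta> \<and> \<bar>t\<bar> < real N"
    using compact_carrier_axb_box[OF K(2,3)] by metis
  have "smooth_on UNIV \<phi>"
    using K(1) unfolding smooth_on_def
    by (auto intro: Ck_on_extend_zero[OF open_carrier_axb compact_imp_closed[OF K(2)] K(3,4)])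
  then have "box_test \<alpha> \<beta> (real (Suc N)) \<phi>" using * K(4) unfolding box_test_def
    by (fastforce dest: less_imp_le)
  then show ?thesis using that[of \<alpha> \<beta> "Suc N"] * by blast
qed

lemma box_test_differentiable:
  "box_test \<alpha> \<beta> T \<phi> \<Longrightarrow> (\<phi> has_derivative frechet_derivative \<phi> (at x)) (at x)"
  unfolding box_test_def smooth_on_def frechet_derivative_works[symmetric]
  by (metis Ck_on.simps(2) UNIV_I)

lemma box_test_continuous: "box_test \<alpha> \<beta> T \<phi> \<Longrightarrow> continuous_on A \<phi>"
  unfolding box_test_def smooth_on_def by (metis Ck_on.simps(1) continuous_on_subset subset_UNIV)

lemma box_test_deriv:
  assumes "box_test \<alpha> \<beta> T \<phi>"
  shows "box_test \<alpha> \<beta> T (\<lambda>x. frechet_derivative \<phi> (at x) v)"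
proof -
  let ?K = "{\<alpha>..\<beta>} \<times> {1 - T..T - 1}"
  have "smooth_on UNIV (\<lambda>x. frechet_derivative \<phi> (at x) v)"
    using assms unfolding box_test_def smooth_on_def by (metis Ck_on.simps(2))
  moreover have "frechet_derivative \<phi> (at (a, t)) v = 0" if "\<not> (\<alpha> \<le> a \<and> a \<le> \<beta> \<and> \<bar>t\<bar> \<le> T - 1)" for a t
  proof -
    have "(\<phi> has_derivative (\<lambda>_. 0)) (at (a, t))"
    proof (rule has_derivative_transform_within_open[of "\<lambda>_. 0" "\<lambda>_. 0" "(a, t)" UNIV "- ?K"])
      show "open (- ?K)" by (intro open_Compl closed_Times) auto
      show "(a, t) \<in> - ?K" using that by (auto simp: abs_le_iff)
      show "0 = \<phi> x" if "x \<in> - ?K" for x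
        using assms that by (cases x) (force simp: box_test_def)
    qed simp
    then show ?thesis using frechet_derivative_at by metis
  qed
  ultimately show ?thesis unfolding box_test_def by blast
qed

text \<open>The exponent and the constant are left free because differentiation changes both.\<close>

lemma Ck_on_powr_mult:
  assumes "Ck_on k (carrier axb) \<phi>"
  shows "Ck_on k (carrier axb) (\<lambda>g. complex_of_real (c * fst g powr s) * \<phi> g)"
  using assms
proof (induction k arbitrary: \<phi> c s)
  case 0
  then show ?case by (auto simp: carrier_axb intro!: continuous_intros)
next
  case (Suc k)
  let ?D = "\<lambda>x v. complex_of_real (c * s * fst v * fst x powr (s - 1)) * \<phi> x
              + complex_of_real (c * fst x powr s) * frechet_derivative \<phi> (at x) v"
  have D: "((\<lambda>g. complex_of_real (c * fst g powr s) * \<phi> g) has_derivative ?D x) (at x)"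
    if "x \<in> carrier axb" for x
  proof -
    have x: "fst x > 0" using that by (auto simp: carrier_axb)
    have 1: "((\<lambda>g. fst g powr s) has_derivative (\<lambda>v. fst v * (s * fst x powr (s - 1)))) (at x)"
      by (rule DERIV_compose_FDERIV[where f="\<lambda>z. z powr s" and g=fst, OF has_real_derivative_powr[OF x]]) (auto intro!: derivative_intros)
    have 2: "((\<lambda>g. complex_of_real (c * fst g powr s)) has_derivative
              (\<lambda>v. complex_of_real (c * (fst v * (s * fst x powr (s - 1)))))) (at x)"
      using 1 by (intro has_derivative_of_real has_derivative_mult_right)
    have 3: "(\<phi> has_derivative frechet_derivative \<phi> (at x)) (at x)"
      using Suc.prems that by (simp add: frechet_derivative_works)
    show ?thesis
      by (rule has_derivative_eq_rhs[OF has_derivative_mult[OF 2 3]]) (auto simp: algebra_simps)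
  qed
  have "Ck_on k (carrier axb)
     (\<lambda>x. frechet_derivative (\<lambda>g. complex_of_real (c * fst g powr s) * \<phi> g) (at x) v)" for v
  proof (rule Ck_on_cong[OF open_carrier_axb])
    show "Ck_on k (carrier axb) (\<lambda>x. ?D x v)"
    proof (intro Ck_on_add[OF open_carrier_axb] Suc.IH)
      show "Ck_on k (carrier axb) \<phi>" by (rule Ck_on_SucD[OF Suc.prems])
      show "Ck_on k (carrier axb) (\<lambda>x. frechet_derivative \<phi> (at x) v)"
        using Suc.prems by (metis Ck_on.simps(2))
    qed
    show "?D x v = frechet_derivative (\<lambda>g. complex_of_real (c * fst g powr s) * \<phi> g) (at x) v"
      if "x \<in> carrier axb" for x
      by (rule fun_cong[OF frechet_derivative_at[OF D[OF that]]])
  qed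
  moreover have "(\<lambda>g. complex_of_real (c * fst g powr s) * \<phi> g) differentiable (at x)"
    if "x \<in> carrier axb" for x
    by (rule differentiableI[OF D[OF that]])
  ultimately show ?case unfolding Ck_on.simps by blast
qed

lemma box_test_powr_mult:
  assumes "box_test \<alpha> \<beta> T \<phi>" "0 < \<alpha>"
  shows "box_test \<alpha> \<beta> T (\<lambda>g. complex_of_real (fst g powr s) * \<phi> g)"
proof -
  let ?K = "{\<alpha>..\<beta>} \<times> {-T..T}"
  have "Ck_on k UNIV (\<lambda>g. complex_of_real (1 * fst g powr s) * \<phi> g)" for k
  proof (rule Ck_on_extend_zero[OF open_carrier_axb])
    show "closed ?K" by (intro closed_Times) auto
    show "?K \<subseteq> carrier axb" using assms by (auto simp: carrier_axb)
    show "complex_of_real (1 * fst x powr s) * \<phi> x = 0" if "x \<notin> ?K" for x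
    proof -
      have "\<phi> (fst x, snd x) = 0"
      proof (rule ccontr)
        assume "\<phi> (fst x, snd x) \<noteq> 0"
        then have "\<alpha> \<le> fst x \<and> fst x \<le> \<beta> \<and> \<bar>snd x\<bar> \<le> T - 1"
          using assms(1) unfolding box_test_def by blast
        then show False using that by (auto simp: mem_Times_iff abs_le_iff)
      qed
      then show ?thesis by simp
    qed
    have "Ck_on k UNIV \<phi>" using assms(1) by (auto simp: box_test_def smooth_on_def)
    moreover have "Ck_on j UNIV \<psi> \<Longrightarrow> Ck_on j (carrier axb) \<psi>" for j and \<psi> :: "real \<times> real \<Rightarrow> complex"
      by (induction j arbitrary: \<psi>) (auto intro: continuous_on_subset)
    ultimately show "Ck_on k (carrier axb) (\<lambda>g. complex_of_real (1 * fst g powr s) * \<phi> g)"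
      by (intro Ck_on_powr_mult)
  qed
  then show ?thesis using assms(1) by (auto simp: box_test_def smooth_on_def)
qed

lemma box_test_bounded:
  assumes "box_test \<alpha> \<beta> T \<phi>"
  obtains B where "B > 0" "\<And>x. cmod (\<phi> x) \<le> B"
proof -
  have "compact (\<phi> ` ({\<alpha>..\<beta>} \<times> {-T..T}))"
    using box_test_continuous[OF assms] by (intro compact_continuous_image compact_Times) auto
  then obtain B where B: "\<And>y. y \<in> \<phi> ` ({\<alpha>..\<beta>} \<times> {-T..T}) \<Longrightarrow> cmod y \<le> B" "B > 0"
    using compact_imp_bounded bounded_pos by metis
  have "cmod (\<phi> (a, t)) \<le> B" for a t
  proof (cases "\<phi> (a, t) = 0")
    case False
    then have "(a, t) \<in> {\<alpha>..\<beta>} \<times> {-T..T}" using assms by (force simp: box_test_def)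
    then show ?thesis using B by blast
  qed (use B in auto)
  then show ?thesis using that B by force
qed

definition tchar :: "nat \<Rightarrow> real \<Rightarrow> complex" where
  "tchar n t = cis (- (2 * pi * real n * t))"

definition fourier :: "real \<Rightarrow> (real \<times> real \<Rightarrow> complex) \<Rightarrow> nat \<Rightarrow> real \<Rightarrow> complex" where
  "fourier T \<phi> n a = integral {-T..T} (\<lambda>t. \<phi> (a, t) * tchar n t)"

lemma norm_tchar [simp]: "cmod (tchar n t) = 1"
  by (simp add: tchar_def)

lemma continuous_on_tchar [continuous_intros]:
  "continuous_on A f \<Longrightarrow> continuous_on A (\<lambda>x. tchar n (f x))"
  unfolding tchar_def by (intro continuous_intros)

lemma tchar_has_vector_derivative:
  "(tchar n has_vector_derivative (- (2 * pi * real n)) *\<^sub>R (\<i> * tchar n t)) (at t within A)"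
  unfolding tchar_def[abs_def] has_vector_derivative_def
  by (auto intro!: derivative_eq_intros)

lemma box_test_section_derivative:
  assumes "box_test \<alpha> \<beta> T \<phi>"
  shows "((\<lambda>a. \<phi> (a, t)) has_vector_derivative frechet_derivative \<phi> (at (a, t)) (1, 0)) (at a within A)"
    and "((\<lambda>t. \<phi> (a, t)) has_vector_derivative frechet_derivative \<phi> (at (a, t)) (0, 1)) (at t within B)"
proof -
  let ?D = "frechet_derivative \<phi> (at (a, t))"
  note D = box_test_differentiable[OF assms, of "(a, t)"]
  have lin: "?D (v *\<^sub>R w) = v *\<^sub>R ?D w" for v w
    using linear_cmul[OF has_derivative_linear[OF D]] by blast
  have "((\<lambda>a. \<phi> (a, t)) has_derivative (\<lambda>v. ?D (v, 0))) (at a within A)"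
    by (rule has_derivative_compose[of "\<lambda>a. (a, t)", OF _ D]) (auto intro!: derivative_eq_intros)
  moreover have "(\<lambda>v. ?D (v, 0)) = (\<lambda>v. v *\<^sub>R ?D (1, 0))"
  proof
    fix v show "?D (v, 0) = v *\<^sub>R ?D (1, 0)" using lin[of v "(1, 0)"] by simp
  qed
  ultimately show "((\<lambda>a. \<phi> (a, t)) has_vector_derivative ?D (1, 0)) (at a within A)"
    by (simp only: has_vector_derivative_def)
  have "((\<lambda>t. \<phi> (a, t)) has_derivative (\<lambda>v. ?D (0, v))) (at t within B)"
    by (rule has_derivative_compose[of "\<lambda>t. (a, t)", OF _ D]) (auto intro!: derivative_eq_intros)
  moreover have "(\<lambda>v. ?D (0, v)) = (\<lambda>v. v *\<^sub>R ?D (0, 1))"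
  proof
    fix v show "?D (0, v) = v *\<^sub>R ?D (0, 1)" using lin[of v "(0, 1)"] by simp
  qed
  ultimately show "((\<lambda>t. \<phi> (a, t)) has_vector_derivative ?D (0, 1)) (at t within B)"
    by (simp only: has_vector_derivative_def)
qed

lemma box_test_continuous_tchar:
  assumes "box_test \<alpha> \<beta> T \<phi>"
  shows "continuous_on A (\<lambda>t. \<phi> (a, t) * tchar n t)"
proof -
  have "continuous_on A (\<phi> \<circ> (\<lambda>t. (a, t)))"
    by (intro continuous_on_compose box_test_continuous[OF assms] continuous_intros)
  then show ?thesis by (auto simp: o_def intro!: continuous_intros)
qed

lemma fourier_has_vector_derivative:
  assumes "box_test \<alpha> \<beta> T \<phi>"
  shows "(fourier T \<phi> n has_vector_derivative
           fourier T (\<lambda>x. frechet_derivative \<phi> (at x) (1, 0)) n a) (at a)"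
proof -
  let ?\<psi> = "\<lambda>x. frechet_derivative \<phi> (at x) (1, 0)"
  have "((\<lambda>a. integral (cbox (-T) T) (\<lambda>t. \<phi> (a, t) * tchar n t)) has_vector_derivative
      integral (cbox (-T) T) (\<lambda>t. ?\<psi> (a, t) * tchar n t)) (at a within UNIV)"
  proof (rule leibniz_rule_vector_derivative)
    show "((\<lambda>a. \<phi> (a, t) * tchar n t) has_vector_derivative ?\<psi> (a, t) * tchar n t) (at a within UNIV)"
      for a t
      by (intro has_vector_derivative_mult_left box_test_section_derivative[OF assms])
    show "(\<lambda>t. \<phi> (a, t) * tchar n t) integrable_on cbox (-T) T" for a
      unfolding box_real by (intro integrable_continuous_real box_test_continuous_tchar[OF assms])
    have "continuous_on (UNIV \<times> cbox (-T) T) (\<lambda>x. ?\<psi> x * tchar n (snd x))"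
      by (intro continuous_intros box_test_continuous[OF box_test_deriv[OF assms]])
    then show "continuous_on (UNIV \<times> cbox (-T) T) (\<lambda>(a, t). ?\<psi> (a, t) * tchar n t)"
      by (simp add: case_prod_unfold)
  qed auto
  then show ?thesis by (simp add: fourier_def[abs_def])
qed

lemma fourier_by_parts:
  assumes "box_test \<alpha> \<beta> T \<phi>" "0 < T"
  shows "fourier T (\<lambda>x. frechet_derivative \<phi> (at x) (0, 1)) n a = 2 * pi * n * \<i> * fourier T \<phi> n a"
proof -
  let ?\<psi> = "\<lambda>x. frechet_derivative \<phi> (at x) (0, 1)"
  have 1: "((\<lambda>t. \<phi> (a, t) * ((- (2 * pi * real n)) *\<^sub>R (\<i> * tchar n t)) + ?\<psi> (a, t) * tchar n t)
      has_integral (\<phi> (a, T) * tchar n T - \<phi> (a, - T) * tchar n (- T))) {-T..T}"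
    using assms(2)
    by (intro fundamental_theorem_of_calculus has_vector_derivative_mult
          tchar_has_vector_derivative box_test_section_derivative[OF assms(1)]) auto
  have z: "\<phi> (a, T) = 0" "\<phi> (a, - T) = 0" using assms unfolding box_test_def by force+
  have 2: "((\<lambda>t. \<phi> (a, t) * tchar n t) has_integral fourier T \<phi> n a) {-T..T}"
    unfolding fourier_def
    by (intro integrable_integral integrable_continuous_real box_test_continuous_tchar[OF assms(1)])
  have "((\<lambda>t. ?\<psi> (a, t) * tchar n t) has_integral (0 + (2 * pi * n * \<i>) * fourier T \<phi> n a)) {-T..T}"
    using has_integral_add[OF 1 has_integral_mult_right[OF 2, of "2 * pi * n * \<i>"]]
    unfolding z by (simp add: scaleR_conv_of_real algebra_simps)
  then show ?thesis unfolding fourier_def by (simp add: integral_unique)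
qed

lemma fourier_bounded:
  assumes "box_test \<alpha> \<beta> T \<phi>" "0 < T"
  obtains B where "B > 0" "\<And>n a. cmod (fourier T \<phi> n a) \<le> B"
proof -
  obtain B where B: "B > 0" "\<And>x. cmod (\<phi> x) \<le> B" using box_test_bounded[OF assms(1)] by metis
  have "cmod (fourier T \<phi> n a) \<le> B * (T - - T)" for n a
    unfolding fourier_def using assms B
    by (intro integral_bound box_test_continuous_tchar[OF assms(1)]) (auto simp: norm_mult)
  then show ?thesis using that[of "B * (T - - T)"] B assms(2) by simp
qed

text \<open>Each integration by parts in \<open>t\<close> gains a factor \<open>1 / n\<close>; the decay is uniform in \<open>a\<close>. This is
  what turns the functional \<open>\<Sum> d\<^sub>n \<delta>\<^sub>n\<close> into a smooth vector when it is smeared.\<close>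

lemma fourier_decay:
  assumes "box_test \<alpha> \<beta> T \<phi>" "0 < T"
  shows "\<exists>B>0. \<forall>n a. real n ^ M * cmod (fourier T \<phi> n a) \<le> B"
  using assms(1)
proof (induction M arbitrary: \<phi>)
  case 0
  then show ?case using fourier_bounded[OF 0 assms(2)] by (metis mult_1 power_0)
next
  case (Suc M)
  from Suc.IH[OF box_test_deriv[OF Suc.prems, of "(0, 1)"]]
  obtain B where B: "B > 0"
    "\<And>n a. real n ^ M * cmod (2 * pi * n * \<i> * fourier T \<phi> n a) \<le> B"
    unfolding fourier_by_parts[OF Suc.prems assms(2)] by auto
  have "real n ^ Suc M * cmod (fourier T \<phi> n a) \<le> B" for n a
  proof -
    have "real n ^ Suc M * cmod (fourier T \<phi> n a) * 1
        \<le> real n ^ Suc M * cmod (fourier T \<phi> n a) * (2 * pi)"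
      using pi_ge_two by (intro mult_left_mono) auto
    also have "\<dots> = real n ^ M * cmod (2 * pi * n * \<i> * fourier T \<phi> n a)"
      by (simp add: norm_mult)
    finally show ?thesis using B(2)[of n a] by simp
  qed
  then show ?case using B(1) by blast
qed

lemma fourier_eq_0:
  assumes "box_test \<alpha> \<beta> T \<phi>" "\<not> (\<alpha> \<le> a \<and> a \<le> \<beta>)"
  shows "fourier T \<phi> n a = 0"
proof -
  have "\<phi> (a, t) = 0" for t using assms by (auto simp: box_test_def)
  then show ?thesis by (simp add: fourier_def)
qed

section \<open>The Frechet space of smooth vectors\<close>

lemma L2_pos_cong:
  assumes "\<And>x. x > 0 \<Longrightarrow> f x = g x"
  shows "L2_pos f = L2_pos g" "L2_pos_norm f = L2_pos_norm g"
proof -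
  have 1: "(\<lambda>x. indicator {0<..} x *\<^sub>R f x) = (\<lambda>x. indicator {0<..} x *\<^sub>R g x)"
    using assms by (auto simp: fun_eq_iff indicator_def)
  have 2: "(\<lambda>x. indicator {0<..} x *\<^sub>R (cmod (f x))\<^sup>2) = (\<lambda>x. indicator {0<..} x *\<^sub>R (cmod (g x))\<^sup>2)"
    using assms by (auto simp: fun_eq_iff indicator_def)
  show "L2_pos f = L2_pos g" "L2_pos_norm f = L2_pos_norm g"
    unfolding L2_pos_def L2_pos_norm_def set_borel_measurable_def set_integrable_def
      set_lebesgue_integral_def 1 2 by (rule refl)+
qed

lemma continuous_on_pos_measurable:
  fixes w :: "real \<Rightarrow> 'b::{second_countable_topology,real_normed_vector}"
  assumes "continuous_on {0<..} w"
  shows "set_borel_measurable lborel {0<..} w" "set_borel_measurable lebesgue {0<..} w"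
proof -
  show "set_borel_measurable lborel {0<..} w"
    using borel_measurable_continuous_on_indicator[OF _ assms] by (simp add: set_borel_measurable_def)
  then show "set_borel_measurable lebesgue {0<..} w"
    by (simp add: set_borel_measurable_def measurable_completion)
qed

lemma L2_pos_norm_nonneg [simp]: "L2_pos_norm f \<ge> 0"
  unfolding L2_pos_norm_def set_lebesgue_integral_def by (auto intro!: Bochner_Integration.integral_nonneg)

lemma L2_pos_norm_square: "(L2_pos_norm f)\<^sup>2 = (LINT x:{0<..}|lebesgue. (cmod (f x))\<^sup>2)"
  unfolding L2_pos_norm_def set_lebesgue_integral_def
  by (intro real_sqrt_pow2 Bochner_Integration.integral_nonneg) auto

text \<open>Minkowski's inequality arises by optimising the weights \<open>A\<close> and \<open>B\<close>.\<close>

lemma weighted_square_ineq: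
  fixes A B :: real and x y :: complex
  assumes "A > 0" "B > 0"
  shows "(cmod (x + y))\<^sup>2 \<le> (1 + B / A) * (cmod x)\<^sup>2 + (1 + A / B) * (cmod y)\<^sup>2"
proof -
  have "(cmod (x + y))\<^sup>2 \<le> (cmod x + cmod y)\<^sup>2"
    by (intro power_mono norm_triangle_ineq) auto
  moreover have "2 * (cmod x * cmod y) \<le> B / A * (cmod x)\<^sup>2 + A / B * (cmod y)\<^sup>2"
  proof -
    have "0 \<le> (B * cmod x - A * cmod y)\<^sup>2 / (A * B)" using assms by simp
    also have "\<dots> = B / A * (cmod x)\<^sup>2 + A / B * (cmod y)\<^sup>2 - 2 * (cmod x * cmod y)"
      using assms by (simp add: field_simps power2_eq_square)
    finally show ?thesis by simp
  qed
  ultimately show ?thesis by (simp add: power2_sum algebra_simps)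
qed

lemma L2_pos_add:
  assumes "L2_pos f" "L2_pos g"
  shows "L2_pos (\<lambda>x. f x + g x)" "L2_pos_norm (\<lambda>x. f x + g x) \<le> L2_pos_norm f + L2_pos_norm g"
proof -
  let ?M = "lebesgue :: real measure"
  have int: "set_integrable ?M {0<..} (\<lambda>x. (cmod (f x))\<^sup>2)" "set_integrable ?M {0<..} (\<lambda>x. (cmod (g x))\<^sup>2)"
    using assms by (auto simp: L2_pos_def)
  have meas: "set_borel_measurable ?M {0<..} (\<lambda>x. f x + g x)"
    using assms by (auto simp: L2_pos_def set_borel_measurable_def scaleR_right_distrib)
  have meas2: "set_borel_measurable ?M {0<..} (\<lambda>x. (cmod (f x + g x))\<^sup>2)"
  proof -
    have "(\<lambda>x. (cmod (indicator {0<..} x *\<^sub>R (f x + g x)))\<^sup>2) \<in> borel_measurable ?M"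
      using meas unfolding set_borel_measurable_def by measurable
    also have "(\<lambda>x. (cmod (indicator {0<..} x *\<^sub>R (f x + g x)))\<^sup>2)
       = (\<lambda>x. indicator {0<..} x *\<^sub>R (cmod (f x + g x))\<^sup>2)"
      by (auto simp: fun_eq_iff indicator_def)
    finally show ?thesis by (simp add: set_borel_measurable_def)
  qed
  have dom: "set_integrable ?M {0<..} (\<lambda>x. (1 + B / A) * (cmod (f x))\<^sup>2 + (1 + A / B) * (cmod (g x))\<^sup>2)" for A B
    using int by (intro set_integral_add(1) set_integrable_mult_right) auto
  have sq: "set_integrable ?M {0<..} (\<lambda>x. (cmod (f x + g x))\<^sup>2)"
    using set_integrable_bound[OF dom[of 1 1] meas2]
      weighted_square_ineq[of 1 1] by (auto intro!: AE_I2)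
  show "L2_pos (\<lambda>x. f x + g x)" using meas sq by (simp add: L2_pos_def)
  show "L2_pos_norm (\<lambda>x. f x + g x) \<le> L2_pos_norm f + L2_pos_norm g"
  proof (rule field_le_epsilon)
    fix e :: real assume "e > 0"
    \<comment> \<open>The weights of the optimal splitting, moved off zero.\<close>
    define A where "A = L2_pos_norm f + e / 2"
    define B where "B = L2_pos_norm g + e / 2"
    have AB: "A > 0" "B > 0" using \<open>e > 0\<close> by (auto simp: A_def B_def intro: add_nonneg_pos)
    have "(L2_pos_norm (\<lambda>x. f x + g x))\<^sup>2
       \<le> (LINT x:{0<..}|?M. (1 + B / A) * (cmod (f x))\<^sup>2 + (1 + A / B) * (cmod (g x))\<^sup>2)"
      unfolding L2_pos_norm_square
      by (rule set_integral_mono[OF sq dom[of B A]]) (rule weighted_square_ineq[OF AB])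
    also have "\<dots> = (1 + B / A) * (L2_pos_norm f)\<^sup>2 + (1 + A / B) * (L2_pos_norm g)\<^sup>2"
      unfolding L2_pos_norm_square using int
      by (subst set_integral_add(2)) (auto intro: set_integrable_mult_right)
    also have "\<dots> \<le> (1 + B / A) * A\<^sup>2 + (1 + A / B) * B\<^sup>2"
      using AB \<open>e > 0\<close> by (intro add_mono mult_left_mono power_mono) (auto simp: A_def B_def)
    also have "\<dots> = (A + B)\<^sup>2" using AB by (simp add: field_simps power2_eq_square)
    finally have "L2_pos_norm (\<lambda>x. f x + g x) \<le> A + B"
      by (rule power2_le_imp_le) (use AB in simp)
    then show "L2_pos_norm (\<lambda>x. f x + g x) \<le> L2_pos_norm f + L2_pos_norm g + e"
      by (simp add: A_def B_def)
  qed
qed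

lemma L2_pos_cmult:
  assumes "L2_pos f" shows "L2_pos (\<lambda>x. c * f x)"
proof -
  have "(\<lambda>x. c * (indicator {0<..} x *\<^sub>R f x)) \<in> borel_measurable lebesgue"
    using assms by (intro borel_measurable_times borel_measurable_const) (simp add: L2_pos_def set_borel_measurable_def)
  then show ?thesis using assms
    by (auto simp: L2_pos_def set_borel_measurable_def norm_mult power_mult_distrib)
qed

lemma L2_pos_cnj:
  assumes "L2_pos f" shows "L2_pos (\<lambda>x. cnj (f x))"
proof -
  have "(\<lambda>x. cnj (indicator {0<..} x *\<^sub>R f x)) \<in> borel_measurable lebesgue"
    using assms unfolding L2_pos_def set_borel_measurable_def
    by (intro measurable_compose[OF _ borel_measurable_continuous_onI[OF continuous_on_cnj[OF continuous_on_id]]]) auto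
  then show ?thesis using assms
    by (auto simp: L2_pos_def set_borel_measurable_def)
qed

lemma Hinf_chain: "f \<in> Hinf \<Longrightarrow> deriv_chain {0<..} (\<lambda>j. nth_deriv j f)"
  by (intro deriv_chain_of_smooth) (auto simp: Hinf_def)

lemma nth_deriv_0 [simp]: "nth_deriv 0 f = f"
  by (simp add: nth_deriv_def)

lemma HinfI:
  assumes "deriv_chain {0<..} G" "G 0 = f" "\<And>x. x \<le> 0 \<Longrightarrow> f x = 0"
    "\<And>m n. n \<le> m \<Longrightarrow> L2_pos (\<lambda>x. of_real (x ^ m) * G n x)"
  shows "f \<in> Hinf"
proof -
  have "L2_pos (\<lambda>x. of_real (x ^ m) * nth_deriv n f x)" if "n \<le> m" for m n
    using L2_pos_cong(1)[of "\<lambda>x. of_real (x ^ m) * nth_deriv n f x" "\<lambda>x. of_real (x ^ m) * G n x"]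
      assms(4)[OF that] nth_deriv_chain[OF _ assms(1), of _ n] assms(2) by auto
  then show ?thesis using smooth_on_chain[OF _ assms(1)] assms(2,3) by (auto simp: Hinf_def)
qed

lemma Hinf_L2: "f \<in> Hinf \<Longrightarrow> n \<le> m \<Longrightarrow> L2_pos (\<lambda>x. of_real (x ^ m) * nth_deriv n f x)"
  by (auto simp: Hinf_def)

lemma Hinf_combine:
  assumes "f \<in> Hinf" "g \<in> Hinf"
  shows "(\<lambda>x. f x + c * g x) \<in> Hinf"
    and "x > 0 \<Longrightarrow> nth_deriv n (\<lambda>x. f x + c * g x) x = nth_deriv n f x + c * nth_deriv n g x"
proof -
  let ?G = "\<lambda>j x. nth_deriv j f x + c * nth_deriv j g x"
  have ch: "deriv_chain {0<..} ?G"
    unfolding deriv_chain_def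
  proof (intro allI ballI has_vector_derivative_add has_vector_derivative_mult_right)
    fix j and x :: real assume "x \<in> {0<..}"
    then show "(nth_deriv j f has_vector_derivative nth_deriv (Suc j) f x) (at x)"
      "(nth_deriv j g has_vector_derivative nth_deriv (Suc j) g x) (at x)"
      using Hinf_chain[OF assms(1)] Hinf_chain[OF assms(2)] unfolding deriv_chain_def by blast+
  qed
  show "(\<lambda>x. f x + c * g x) \<in> Hinf"
  proof (rule HinfI[OF ch])
    show "L2_pos (\<lambda>x. of_real (x ^ m) * ?G n x)" if "n \<le> m" for m n
      using L2_pos_add(1)[OF Hinf_L2[OF assms(1) that] L2_pos_cmult[OF Hinf_L2[OF assms(2) that], of c]]
      by (simp add: algebra_simps)
  qed (use assms in \<open>auto simp: Hinf_def\<close>)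
  show "nth_deriv n (\<lambda>x. f x + c * g x) x = ?G n x" if "x > 0"
    using nth_deriv_chain[OF _ ch, of x n] that by simp
qed

lemma Hinf_diff: "f \<in> Hinf \<Longrightarrow> g \<in> Hinf \<Longrightarrow> (\<lambda>x. f x - g x) \<in> Hinf"
  using Hinf_combine(1)[of f g "-1"] by simp

lemma Hinf_cnj:
  assumes "f \<in> Hinf" shows "(\<lambda>x. cnj (f x)) \<in> Hinf"
proof (rule HinfI)
  show "deriv_chain {0<..} (\<lambda>j x. cnj (nth_deriv j f x))"
    unfolding deriv_chain_def
  proof (intro allI ballI has_vector_derivative_cnj)
    fix j and x :: real assume "x \<in> {0<..}"
    then show "(nth_deriv j f has_vector_derivative nth_deriv (Suc j) f x) (at x)"
      using Hinf_chain[OF assms] unfolding deriv_chain_def by blast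
  qed
  show "L2_pos (\<lambda>x. of_real (x ^ m) * cnj (nth_deriv n f x))" if "n \<le> m" for m n
    using L2_pos_cnj[OF Hinf_L2[OF assms that]] by simp
qed (use assms in \<open>auto simp: Hinf_def\<close>)

lemma Hinf_seminorm_nonneg [simp]: "Hinf_seminorm m n f \<ge> 0"
  by (simp add: Hinf_seminorm_def)

lemma Hinf_seminorm_add:
  assumes "f \<in> Hinf" "g \<in> Hinf" "n \<le> m"
  shows "Hinf_seminorm m n (\<lambda>x. f x + g x) \<le> Hinf_seminorm m n f + Hinf_seminorm m n g"
proof -
  have "Hinf_seminorm m n (\<lambda>x. f x + g x)
      = L2_pos_norm (\<lambda>x. of_real (x ^ m) * nth_deriv n f x + of_real (x ^ m) * nth_deriv n g x)"
    unfolding Hinf_seminorm_def using Hinf_combine(2)[OF assms(1,2), of _ n 1]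
    by (intro L2_pos_cong(2)) (simp add: algebra_simps)
  also have "\<dots> \<le> Hinf_seminorm m n f + Hinf_seminorm m n g"
    unfolding Hinf_seminorm_def using assms by (intro L2_pos_add(2) Hinf_L2)
  finally show ?thesis .
qed

lemma Hinf_seminorm_zero [simp]: "Hinf_seminorm m n (\<lambda>x. 0) = 0"
proof -
  have "deriv_chain {0<..} (\<lambda>_ _. 0)" by (simp add: deriv_chain_def)
  then have "Hinf_seminorm m n (\<lambda>x. 0) = L2_pos_norm (\<lambda>x. 0)"
    unfolding Hinf_seminorm_def using nth_deriv_chain[of "{0<..}" "\<lambda>_ _. 0"]
    by (intro L2_pos_cong(2)) simp
  then show ?thesis by (simp add: L2_pos_norm_def set_lebesgue_integral_def)
qed

lemma topspace_Hinf: "topspace Hinf_topology = Hinf"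
proof
  show "topspace Hinf_topology \<subseteq> Hinf" by (auto simp: Hinf_topology_def)
  show "Hinf \<subseteq> topspace Hinf_topology"
  proof
    fix f assume f: "f \<in> Hinf"
    then have "f \<in> {g \<in> Hinf. Hinf_seminorm 0 0 (\<lambda>x. g x - f x) < 1}"
      by simp
    moreover have "\<exists>f' m n r. {g \<in> Hinf. Hinf_seminorm 0 0 (\<lambda>x. g x - f x) < 1}
        = {g \<in> Hinf. Hinf_seminorm m n (\<lambda>x. g x - f' x) < r} \<and> f' \<in> Hinf \<and> n \<le> m \<and> (0::real) < r"
      using f by (intro exI[of _ f] exI[of _ "0::nat"] exI[of _ "1::real"]) auto
    ultimately show "f \<in> topspace Hinf_topology"
      unfolding Hinf_topology_def topology_generated_by_topspace by blast
  qed
qed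

lemma openin_Hinf_ball:
  assumes "f \<in> Hinf" "n \<le> m" "0 < r"
  shows "openin Hinf_topology {g \<in> Hinf. Hinf_seminorm m n (\<lambda>x. g x - f x) < r}"
  unfolding Hinf_topology_def using assms by (intro topology_generated_by_Basis) blast

text \<open>The subbasic open sets are balls around arbitrary centres, so the triangle inequality for the
  seminorms moves the centre to the limit.\<close>

lemma limitin_Hinf:
  assumes "\<And>k. h k \<in> Hinf" "l \<in> Hinf"
    and lim: "\<And>m n. n \<le> m \<Longrightarrow> (\<lambda>k. Hinf_seminorm m n (\<lambda>x. h k x - l x)) \<longlonglongrightarrow> 0"
  shows "limitin Hinf_topology h l sequentially"
  unfolding limitin_def topspace_Hinf
proof (intro conjI allI impI)
  fix U assume "openin Hinf_topology U \<and> l \<in> U"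
  then have "generate_topology_on {{g \<in> Hinf. Hinf_seminorm m n (\<lambda>x. g x - f x) < r} | f m n r.
     f \<in> Hinf \<and> n \<le> m \<and> 0 < r} U" "l \<in> U"
    unfolding Hinf_topology_def by (auto dest: openin_topology_generated_by)
  then show "\<forall>\<^sub>F k in sequentially. h k \<in> U"
  proof (induction rule: generate_topology_on.induct)
    case (Int a b)
    then show ?case by (auto intro: eventually_conj)
  next
    case (UN K)
    then obtain V where V: "V \<in> K" "l \<in> V" by auto
    then have "\<forall>\<^sub>F k in sequentially. h k \<in> V" using UN by blast
    then show ?case using V(1) by (auto elim!: eventually_mono)
  next
    case (Basis s)
    then obtain f m n and r :: real where s: "s = {g \<in> Hinf. Hinf_seminorm m n (\<lambda>x. g x - f x) < r}"
      "f \<in> Hinf" "n \<le> m" by auto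
    then have lt: "Hinf_seminorm m n (\<lambda>x. l x - f x) < r" using Basis by auto
    have "\<forall>\<^sub>F k in sequentially. Hinf_seminorm m n (\<lambda>x. h k x - l x) < r - Hinf_seminorm m n (\<lambda>x. l x - f x)"
      using order_tendstoD(2)[OF lim[OF s(3)], of "r - Hinf_seminorm m n (\<lambda>x. l x - f x)"] lt by simp
    then show ?case
    proof (eventually_elim)
      case (elim k)
      have "Hinf_seminorm m n (\<lambda>x. (h k x - l x) + (l x - f x))
         \<le> Hinf_seminorm m n (\<lambda>x. h k x - l x) + Hinf_seminorm m n (\<lambda>x. l x - f x)"
        using assms s by (intro Hinf_seminorm_add Hinf_diff) auto
      then show ?case using elim assms(1) s by simp
    qed
  qed auto
qed (use assms in auto)

lemma Hminf_tendsto: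
  assumes "F \<in> Hminf" "\<And>k. h k \<in> Hinf" "l \<in> Hinf"
    "\<And>m n. n \<le> m \<Longrightarrow> (\<lambda>k. Hinf_seminorm m n (\<lambda>x. h k x - l x)) \<longlonglongrightarrow> 0"
  shows "(\<lambda>k. F (h k)) \<longlonglongrightarrow> F l"
proof -
  have "continuous_map Hinf_topology euclidean F" using assms(1) by (simp add: Hminf_def)
  from continuous_map_limit[OF this limitin_Hinf[of h l, OF assms(2-4)]]
  show ?thesis by (simp add: o_def)
qed

lemma integral_le_pos_integral:
  fixes w :: "real \<Rightarrow> real"
  assumes "continuous_on {0<..} w" "\<And>x. x > 0 \<Longrightarrow> w x \<ge> 0" "set_integrable lebesgue {0<..} w" "0 < x"
  shows "integral {x..y} w \<le> (LINT y:{0<..}|lebesgue. w y)"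
proof -
  have c: "continuous_on {x..y} w" using assms(1,4) by (auto intro: continuous_on_subset)
  have 1: "set_integrable lebesgue {x..y} w"
    by (rule set_integrable_subset[OF assms(3)]) (use assms(4) in auto)
  have m: "(\<lambda>z. indicator {x..y} z *\<^sub>R w z) \<in> borel_measurable lborel"
    using borel_measurable_continuous_on_indicator[OF _ c] by simp
  have "set_integrable lborel {x..y} w"
    using 1 m by (simp add: set_integrable_def integrable_completion)
  then have "integral {x..y} w = (LINT z:{x..y}|lborel. w z)"
    by (simp add: set_borel_integral_eq_integral)
  also have "\<dots> = (LINT z:{x..y}|lebesgue. w z)"
    unfolding set_lebesgue_integral_def using m by (simp add: integral_completion)
  also have "\<dots> \<le> (LINT y:{0<..}|lebesgue. w y)"
    unfolding set_lebesgue_integral_def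
    using 1 assms(2-4) unfolding set_integrable_def
    by (intro integral_mono) (auto simp: indicator_def)
  finally show ?thesis .
qed

text \<open>On an interval of length one the variance of \<open>|g|\<close> is nonnegative, which bounds the square of
  its mean by its mean square.\<close>

lemma unit_interval_integral_le_L2:
  fixes g :: "real \<Rightarrow> complex"
  assumes "continuous_on {0<..} g" "L2_pos g" "0 < x"
  shows "integral {x..x + 1} (\<lambda>y. cmod (g y)) \<le> L2_pos_norm g"
proof -
  let ?w = "\<lambda>y. cmod (g y)"
  have cg: "continuous_on {x..x+1} g" using assms(3) by (intro continuous_on_subset[OF assms(1)]) auto
  then have c: "continuous_on {x..x+1} ?w" by (rule continuous_on_norm)
  define I where "I = integral {x..x+1} ?w"
  have "0 \<le> integral {x..x+1} (\<lambda>y. (?w y - I)\<^sup>2)"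
    by (intro Henstock_Kurzweil_Integration.integral_nonneg integrable_continuous_real continuous_intros cg) auto
  also have "(\<lambda>y. (?w y - I)\<^sup>2) = (\<lambda>y. ((?w y)\<^sup>2 - (2 * I) * ?w y) + I\<^sup>2)"
    by (auto simp: fun_eq_iff power2_eq_square algebra_simps)
  also have "integral {x..x+1} \<dots> = integral {x..x+1} (\<lambda>y. (?w y)\<^sup>2) - 2 * I * I + I\<^sup>2"
    unfolding I_def
    by (simp add: Henstock_Kurzweil_Integration.integral_add Henstock_Kurzweil_Integration.integral_diff
        integrable_continuous_real continuous_intros cg)
  finally have "I\<^sup>2 \<le> integral {x..x+1} (\<lambda>y. (?w y)\<^sup>2)" by (simp add: power2_eq_square)
  also have "\<dots> \<le> (L2_pos_norm g)\<^sup>2"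
    unfolding L2_pos_norm_square using assms
    by (intro integral_le_pos_integral continuous_intros) (auto simp: L2_pos_def)
  finally show ?thesis unfolding I_def by (rule power2_le_imp_le) simp
qed

text \<open>A Sobolev inequality: \<open>f(x)\<close> differs from each \<open>f(y)\<close> with \<open>y \<in> {x..x+1}\<close> by at most the integral
  of \<open>|f'|\<close> over this interval; averaging over \<open>y\<close> leaves two unit interval integrals, in which
  \<open>x\<^sup>m \<le> y\<^sup>m\<close>. Point evaluations are thereby continuous, with norms that decay faster than any
  power of \<open>x\<close>.\<close>

lemma Hinf_pointwise_bound:
  assumes f: "f \<in> Hinf" and m: "1 \<le> m" and x: "0 < x"
  shows "x ^ m * cmod (f x) \<le> Hinf_seminorm m 0 f + Hinf_seminorm m 1 f"
proof -
  let ?f' = "nth_deriv 1 f"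
  note ch = Hinf_chain[OF f]
  have cf: "continuous_on {0<..} f" and cf': "continuous_on {0<..} ?f'"
    using deriv_chain_continuous_on[OF ch, of 0] deriv_chain_continuous_on[OF ch, of 1] by auto
  have c: "continuous_on {x..x+1} f" "continuous_on {x..x+1} ?f'"
    using x by (intro continuous_on_subset[OF cf] continuous_on_subset[OF cf']; auto)+
  have D: "(f has_vector_derivative ?f' y) (at y)" if "y > 0" for y
    using ch that unfolding deriv_chain_def by (metis One_nat_def greaterThan_iff nth_deriv_0)
  define J where "J = integral {x..x+1} (\<lambda>y. cmod (?f' y))"
  have *: "cmod (f x) \<le> cmod (f y) + J" if y: "y \<in> {x..x+1}" for y
  proof -
    have "(?f' has_integral (f y - f x)) {x..y}"
      using y x by (intro fundamental_theorem_of_calculus has_vector_derivative_at_within[OF D]) auto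
    then have "cmod (f y - f x) = cmod (integral {x..y} ?f')" by (simp add: integral_unique)
    also have "\<dots> \<le> integral {x..y} (\<lambda>y. cmod (?f' y))"
      using y c by (intro Henstock_Kurzweil_Integration.integral_norm_bound_integral integrable_continuous_real)
        (auto intro!: continuous_intros intro: continuous_on_subset)
    also have "\<dots> \<le> J"
      unfolding J_def using y c
      by (intro integral_subset_le integrable_continuous_real)
        (auto intro!: continuous_intros intro: continuous_on_subset)
    finally show ?thesis using norm_triangle_ineq2[of "f x" "f y"] by (simp add: norm_minus_commute)
  qed
  have "integral {x..x+1} (\<lambda>_. cmod (f x)) \<le> integral {x..x+1} (\<lambda>y. cmod (f y) + J)"
    using c * by (intro integral_le integrable_continuous_real continuous_intros) auto
  then have 1: "cmod (f x) \<le> integral {x..x+1} (\<lambda>y. cmod (f y)) + J"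
    using c by (simp add: Henstock_Kurzweil_Integration.integral_add integrable_continuous_real continuous_intros)
  have 2: "x ^ m * integral {x..x+1} (\<lambda>y. cmod (g y)) \<le> L2_pos_norm (\<lambda>y. of_real (y ^ m) * g y)"
    if g: "continuous_on {0<..} g" "L2_pos (\<lambda>y. of_real (y ^ m) * g y)" for g
  proof -
    have cg: "continuous_on {x..x+1} g" using x by (intro continuous_on_subset[OF g(1)]) auto
    have "x ^ m * integral {x..x+1} (\<lambda>y. cmod (g y)) = integral {x..x+1} (\<lambda>y. x ^ m * cmod (g y))"
      by simp
    also have "\<dots> \<le> integral {x..x+1} (\<lambda>y. cmod (of_real (y ^ m) * g y))"
    proof (intro integral_le integrable_continuous_real continuous_intros cg)
      fix y assume "y \<in> {x..x+1}"
      then have "x ^ m \<le> \<bar>y\<bar> ^ m" using x by (intro power_mono) auto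
      then show "x ^ m * cmod (g y) \<le> cmod (of_real (y ^ m) * g y)"
        by (auto simp: norm_mult norm_power intro!: mult_right_mono)
    qed
    also have "\<dots> \<le> L2_pos_norm (\<lambda>y. of_real (y ^ m) * g y)"
      using g x by (intro unit_interval_integral_le_L2 continuous_intros) auto
    finally show ?thesis .
  qed
  have "x ^ m * cmod (f x) \<le> x ^ m * (integral {x..x+1} (\<lambda>y. cmod (f y)) + J)"
    using 1 x by (intro mult_left_mono) auto
  also have "\<dots> \<le> Hinf_seminorm m 0 f + Hinf_seminorm m 1 f"
    unfolding J_def distrib_left Hinf_seminorm_def
    using 2[OF cf] 2[OF cf'] Hinf_L2[OF f, of 0 m] Hinf_L2[OF f m] by (intro add_mono) auto
  finally show ?thesis .
qed

lemma Hinf_decay: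
  assumes "f \<in> Hinf" "1 \<le> m"
  obtains B where "B > 0" "\<And>x. x > 0 \<Longrightarrow> cmod (f x) \<le> B / x ^ m"
proof -
  let ?B = "Hinf_seminorm m 0 f + Hinf_seminorm m 1 f + 1"
  have "cmod (f x) \<le> ?B / x ^ m" if "x > 0" for x
    using Hinf_pointwise_bound[OF assms that] that by (simp add: field_simps)
  then show ?thesis by (intro that[of ?B]) (auto intro: add_nonneg_pos)
qed

lemma dirac_comb_summand_bound:
  assumes "f \<in> Hinf"
  shows "cmod (d (Suc n) * f (real (Suc n)))
    \<le> cmod (d (Suc n)) / real (Suc n) ^ 2 * (Hinf_seminorm 2 0 f + Hinf_seminorm 2 1 f)"
proof -
  have "cmod (d (Suc n) * f (real (Suc n)))
      = cmod (d (Suc n)) / real (Suc n) ^ 2 * (real (Suc n) ^ 2 * cmod (f (real (Suc n))))"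
    by (simp add: norm_mult)
  also have "\<dots> \<le> cmod (d (Suc n)) / real (Suc n) ^ 2 * (Hinf_seminorm 2 0 f + Hinf_seminorm 2 1 f)"
    using Hinf_pointwise_bound[OF assms, of 2 "real (Suc n)"] by (intro mult_left_mono) auto
  finally show ?thesis .
qed

lemma dirac_comb_in_Hminf:
  assumes d: "summable (\<lambda>n. cmod (d (Suc n)) / real (Suc n) ^ 2)"
  shows "dirac_comb d \<in> Hminf"
proof -
  define A where "A = (\<Sum>n. cmod (d (Suc n)) / real (Suc n) ^ 2)"
  let ?q = "\<lambda>f. Hinf_seminorm 2 0 f + Hinf_seminorm 2 1 f"
  have A0: "A \<ge> 0" unfolding A_def using d by (intro suminf_nonneg) auto
  have sm: "summable (\<lambda>n. cmod (d (Suc n) * f (real (Suc n))))" if "f \<in> Hinf" for f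
    using dirac_comb_summand_bound[OF that]
    by (intro summable_comparison_test'[OF summable_mult2[OF d]]) auto
  have lin: "dirac_comb d (\<lambda>x. f x + c * g x) = dirac_comb d f + c * dirac_comb d g"
    if "f \<in> Hinf" "g \<in> Hinf" for f g c
    using suminf_add[OF summable_norm_cancel[OF sm[OF that(1)]]
        summable_mult[OF summable_norm_cancel[OF sm[OF that(2)]], of c]]
      suminf_mult[OF summable_norm_cancel[OF sm[OF that(2)]], of c]
    by (simp add: dirac_comb_def algebra_simps)
  have bnd: "cmod (dirac_comb d f) \<le> A * ?q f" if "f \<in> Hinf" for f
  proof -
    have "cmod (dirac_comb d f) \<le> (\<Sum>n. cmod (d (Suc n) * f (real (Suc n))))"
      unfolding dirac_comb_def using sm[OF that] by (rule summable_norm)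
    also have "\<dots> \<le> (\<Sum>n. cmod (d (Suc n)) / real (Suc n) ^ 2 * ?q f)"
      using dirac_comb_summand_bound[OF that] by (intro suminf_le sm[OF that] summable_mult2[OF d])
    also have "\<dots> = A * ?q f" unfolding A_def by (rule suminf_mult2[OF d, symmetric])
    finally show ?thesis .
  qed
  have z: "dirac_comb d (\<lambda>x. 0) = 0" by (simp add: dirac_comb_def)
  have zero: "(\<lambda>x. 0) \<in> Hinf" if "f \<in> Hinf" for f using Hinf_diff[OF that that] by simp
  have diff: "cmod (dirac_comb d g - dirac_comb d f) \<le> A * ?q (\<lambda>x. g x - f x)"
    if "f \<in> Hinf" "g \<in> Hinf" for f g
    using bnd[OF Hinf_diff[OF that(2,1)]] lin[OF that(2,1), of "-1"] by simp
  have "continuous_map Hinf_topology euclidean (dirac_comb d)"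
    unfolding continuous_map_def topspace_Hinf
  proof (intro conjI allI impI)
    fix U assume "openin euclidean (U :: complex set)"
    then have U: "open U" by simp
    show "openin Hinf_topology {x \<in> Hinf. dirac_comb d x \<in> U}"
    proof (subst openin_subopen, intro ballI)
      fix f assume f: "f \<in> {x \<in> Hinf. dirac_comb d x \<in> U}"
      then obtain e where e: "e > 0" "\<And>y. dist y (dirac_comb d f) < e \<Longrightarrow> y \<in> U"
        using U unfolding open_dist by blast
      define r where "r = e / (A + 1) / 2"
      have r: "r > 0" using e A0 by (auto simp: r_def)
      let ?T = "{g \<in> Hinf. Hinf_seminorm 2 0 (\<lambda>x. g x - f x) < r} \<inter>
                {g \<in> Hinf. Hinf_seminorm 2 1 (\<lambda>x. g x - f x) < r}"
      have "openin Hinf_topology ?T"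
        using f r by (intro openin_Int openin_Hinf_ball) auto
      moreover have "f \<in> ?T" using f r by auto
      moreover have "?T \<subseteq> {x \<in> Hinf. dirac_comb d x \<in> U}"
      proof
        fix g assume g: "g \<in> ?T"
        have "cmod (dirac_comb d g - dirac_comb d f) \<le> A * ?q (\<lambda>x. g x - f x)"
          using f g by (intro diff) auto
        also have "\<dots> \<le> A * (r + r)" using g A0 by (intro mult_left_mono add_mono) auto
        also have "\<dots> < (A + 1) * (r + r)" using r by (intro mult_strict_right_mono) auto
        also have "\<dots> = e" by (simp only: r_def field_sum_of_halves) (use A0 in simp)
        finally show "g \<in> {x \<in> Hinf. dirac_comb d x \<in> U}" using e g by (auto simp: dist_norm)
      qed
      ultimately show "\<exists>T. openin Hinf_topology T \<and> f \<in> T \<and> T \<subseteq> {x \<in> Hinf. dirac_comb d x \<in> U}"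
        by blast
    qed
  qed auto
  moreover have "dirac_comb d (\<lambda>x. f x + g x) = dirac_comb d f + dirac_comb d g"
    if "f \<in> Hinf" "g \<in> Hinf" for f g using lin[OF that, of 1] by simp
  moreover have "dirac_comb d (\<lambda>x. c * f x) = c * dirac_comb d f" if "f \<in> Hinf" for f c
    using lin[OF zero[OF that] that, of c] z by simp
  ultimately show ?thesis unfolding Hminf_def by blast
qed

lemma L2_pos_mult_integrable:
  assumes "L2_pos f" "L2_pos g"
  shows "set_integrable lebesgue {0<..} (\<lambda>x. f x * g x)"
proof -
  have m: "set_borel_measurable lebesgue {0<..} (\<lambda>x. f x * g x)"
  proof -
    have "(\<lambda>x. (indicator {0<..} x *\<^sub>R f x) * (indicator {0<..} x *\<^sub>R g x)) \<in> borel_measurable lebesgue"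
      using assms by (intro borel_measurable_times) (auto simp: L2_pos_def set_borel_measurable_def)
    also have "(\<lambda>x. (indicator {0<..} x *\<^sub>R f x) * (indicator {0<..} x *\<^sub>R g x))
        = (\<lambda>x. indicator {0<..} x *\<^sub>R (f x * g x))" by (auto simp: fun_eq_iff indicator_def)
    finally show ?thesis by (simp add: set_borel_measurable_def)
  qed
  have "cmod (x * y) \<le> (cmod x)\<^sup>2 + (cmod y)\<^sup>2" for x y
    using sum_squares_bound[of "cmod x" "cmod y"] mult_nonneg_nonneg[of "cmod x" "cmod y"]
    by (auto simp: norm_mult intro: order_trans[of _ "2 * cmod x * cmod y"])
  moreover have "set_integrable lebesgue {0<..} (\<lambda>x. (cmod (f x))\<^sup>2 + (cmod (g x))\<^sup>2)"
    using assms by (intro set_integral_add(1)) (auto simp: L2_pos_def)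
  ultimately show ?thesis
    by (intro set_integrable_bound[OF _ m]) auto
qed

text \<open>Conjugation preserves \<^const>\<open>Hinf\<close>, so the complex conjugate of \<open>h - h'\<close> may serve as test
  vector; the hypothesis then says that \<open>h - h'\<close> has \<open>L\<^sup>2\<close> norm zero.\<close>

lemma Hinf_eqI:
  assumes h: "h \<in> Hinf" "h' \<in> Hinf"
    and eq: "\<And>\<psi>. \<psi> \<in> Hinf \<Longrightarrow> (LINT x:{0<..}|lebesgue. h x * \<psi> x) = (LINT x:{0<..}|lebesgue. h' x * \<psi> x)"
  shows "h = h'"
proof
  fix x
  define k where "k = (\<lambda>x. h x - h' x)"
  have k: "k \<in> Hinf" unfolding k_def by (rule Hinf_diff[OF h])
  have L2: "L2_pos f" if "f \<in> Hinf" for f using Hinf_L2[OF that, of 0 0] by simp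
  have ck: "continuous_on {0<..} k" using deriv_chain_continuous_on[OF Hinf_chain[OF k], of 0] by simp
  have ic: "set_integrable lebesgue {0<..} (\<lambda>x. f x * cnj (k x))" if "f \<in> Hinf" for f
    using that k by (intro L2_pos_mult_integrable L2 Hinf_cnj)
  have "0 = (LINT x:{0<..}|lebesgue. h x * cnj (k x) - h' x * cnj (k x))"
    using eq[OF Hinf_cnj[OF k]] set_integral_diff(2)[OF ic[OF h(1)] ic[OF h(2)]] by simp
  also have "\<dots> = (LINT x:{0<..}|lebesgue. complex_of_real ((cmod (k x))\<^sup>2))"
    by (simp add: k_def complex_norm_square algebra_simps del: of_real_power)
  also have "\<dots> = complex_of_real (LINT x:{0<..}|lebesgue. (cmod (k x))\<^sup>2)"
    by (rule set_integral_complex_of_real)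
  finally have 0: "(LINT x:{0<..}|lebesgue. (cmod (k x))\<^sup>2) = 0" by simp
  show "h x = h' x"
  proof (cases "x > 0")
    case True
    have c: "continuous_on {x..x+1} (\<lambda>y. (cmod (k y))\<^sup>2)"
      using True by (intro continuous_intros continuous_on_subset[OF ck]) auto
    have "integral {x..x+1} (\<lambda>y. (cmod (k y))\<^sup>2) \<le> 0"
      using integral_le_pos_integral[of "\<lambda>y. (cmod (k y))\<^sup>2" x "x+1"] L2[OF k] True 0
        continuous_on_power[OF continuous_on_norm[OF ck], of 2]
      by (auto simp: L2_pos_def)
    moreover have "integral {x..x+1} (\<lambda>y. (cmod (k y))\<^sup>2) \<ge> 0"
      by (intro Henstock_Kurzweil_Integration.integral_nonneg integrable_continuous_real c) auto
    ultimately have "((\<lambda>y. (cmod (k y))\<^sup>2) has_integral 0) (cbox x (x + 1))"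
      using integrable_integral[OF integrable_continuous_real[OF c]] by simp
    then have "(cmod (k x))\<^sup>2 = 0"
      by (rule has_integral_0_cbox_imp_0[rotated 2]) (use c in auto)
    then show ?thesis by (simp add: k_def)
  next
    case False
    then show ?thesis using h by (auto simp: Hinf_def)
  qed
qed

section \<open>Integrals over the group\<close>

lemma haar_eq_density:
  "haar = density lborel (\<lambda>g. ennreal (indicator (carrier axb) g * (1 / fst g)))"
  unfolding haar_def by (intro arg_cong[where f="density lborel"] ext) (auto simp: indicator_def)

lemma sets_haar [simp, measurable_cong]: "sets haar = sets borel"
  by (simp add: haar_def)

lemma space_haar [simp]: "space haar = UNIV"
  by (simp add: haar_def)

lemma
  fixes G :: "real \<times> real \<Rightarrow> complex"
  assumes [measurable]: "G \<in> borel_measurable borel"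
  shows integrable_haar_iff: "integrable haar G
      \<longleftrightarrow> integrable lborel (\<lambda>g. (indicator (carrier axb) g * (1 / fst g)) *\<^sub>R G g)"
    and integral_haar: "(LINT g|haar. G g)
      = (LINT g|lborel. (indicator (carrier axb) g * (1 / fst g)) *\<^sub>R G g)"
proof -
  have [measurable]: "carrier axb \<in> sets borel" using open_carrier_axb by simp
  have [measurable]: "(fst :: real \<times> real \<Rightarrow> real) \<in> borel_measurable borel"
    by (intro borel_measurable_continuous_onI continuous_intros)
  have nn: "0 \<le> indicator (carrier axb) g * (1 / fst g)" for g :: "real \<times> real"
    by (auto simp: carrier_axb indicator_def)
  have m: "(\<lambda>g::real \<times> real. indicator (carrier axb) g * (1 / fst g)) \<in> borel_measurable lborel"
    by (intro borel_measurable_times borel_measurable_indicator borel_measurable_divide) auto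
  show "integrable haar G
      \<longleftrightarrow> integrable lborel (\<lambda>g. (indicator (carrier axb) g * (1 / fst g)) *\<^sub>R G g)"
    unfolding haar_eq_density by (rule integrable_density) (use m nn in auto)
  show "(LINT g|haar. G g)
      = (LINT g|lborel. (indicator (carrier axb) g * (1 / fst g)) *\<^sub>R G g)"
    unfolding haar_eq_density by (rule integral_density) (use m nn in auto)
qed

lemma borel_measurable_tchar [measurable]: "tchar n \<in> borel_measurable borel"
  by (intro borel_measurable_continuous_onI continuous_on_tchar continuous_on_id)

lemma box_test_measurable: "box_test \<alpha> \<beta> T \<phi> \<Longrightarrow> \<phi> \<in> borel_measurable borel"
  by (intro borel_measurable_continuous_onI box_test_continuous)

text \<open>Up to the factor \<open>d\<^sub>n\<close>, the \<open>n\<close>-th term of the series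
  \<open>\<Sum> d\<^sub>n a\<^sup>1\<^sup>/\<^sup>2 g(an) e\<^sup>-\<^sup>2\<^sup>\<pi>\<^sup>i\<^sup>n\<^sup>t\<close> of the matrix coefficient \<open>\<mu>\<^bsub>d,g\<^esub>(a b\<^sub>t)\<close>.\<close>

definition orbit_term :: "(real \<Rightarrow> complex) \<Rightarrow> nat \<Rightarrow> real \<times> real \<Rightarrow> complex" where
  "orbit_term g n = (\<lambda>(a, t). of_real (a powr (1 / 2)) * tchar n t * g (a * real n))"

lemma orbit_term_measurable:
  assumes [measurable]: "g \<in> borel_measurable borel"
  shows "orbit_term g n \<in> borel_measurable borel"
  unfolding orbit_term_def borel_prod[symmetric] by measurable

text \<open>Integrating over \<open>t\<close> first produces the \<open>n\<close>-th Fourier coefficient of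
  \<open>a\<^sup>-\<^sup>1\<^sup>/\<^sup>2 \<phi>\<close>, where the power of \<open>a\<close> is the product of the normalisation
  \<open>a\<^sup>1\<^sup>/\<^sup>2\<close> of the representation and the density \<open>1/a\<close> of the Haar measure. The substitution
  \<open>x = an\<close> then moves the integral to the half-line. The lemma is applied to smooth vectors and to
  the given locally integrable function alike, hence the weak hypothesis on \<open>g\<close>.\<close>

lemma
  assumes \<phi>: "box_test \<alpha> \<beta> T \<phi>" and \<alpha>: "0 < \<alpha>" and T: "0 < T" and n: "0 < n"
    and g [measurable]: "g \<in> borel_measurable borel"
    and gi: "set_integrable lborel {\<alpha> * n..\<beta> * n} g"
  shows integrable_orbit_term: "integrable haar (\<lambda>x. \<phi> x * orbit_term g n x)" (is ?I)
    and integral_orbit_term: "(LINT x|haar. \<phi> x * orbit_term g n x)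
      = (LINT x|lborel. g x * (fourier T (\<lambda>x. of_real (fst x powr (- 1 / 2)) * \<phi> x) n (x / n) / n))"
      (is ?E)
proof -
  define \<rho> where "\<rho> = (\<lambda>x. complex_of_real (fst x powr (- 1 / 2)) * \<phi> x)"
  have \<rho>: "box_test \<alpha> \<beta> T \<rho>" unfolding \<rho>_def by (rule box_test_powr_mult[OF \<phi> \<alpha>])
  note [measurable] = box_test_measurable[OF \<rho>] box_test_measurable[OF \<phi>] orbit_term_measurable[OF g]
  define K where "K = (\<lambda>(a :: real, t). g (a * n) * (\<rho> (a, t) * tchar n t))"
  have K_eq: "(indicator (carrier axb) x * (1 / fst x)) *\<^sub>R (\<phi> x * orbit_term g n x) = K x" for x
  proof (cases x)
    case (Pair a t)
    show ?thesis
    proof (cases "\<phi> x = 0")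
      case False
      then have a: "a > 0" using \<phi> \<alpha> Pair by (force simp: box_test_def)
      have "(1 / a) * a powr (1 / 2) = a powr (- 1 / 2)"
        using a powr_diff[of a "1/2" 1] by simp
      then have *: "complex_of_real (1 / a) * complex_of_real (a powr (1 / 2)) = complex_of_real (a powr (- 1 / 2))"
        by (metis of_real_mult)
      have "(indicator (carrier axb) x * (1 / fst x)) *\<^sub>R (\<phi> x * orbit_term g n x)
          = (complex_of_real (1 / a) * complex_of_real (a powr (1 / 2))) * (\<phi> (a, t) * tchar n t * g (a * n))"
        using a Pair by (simp add: orbit_term_def carrier_axb scaleR_conv_of_real)
      also have "\<dots> = K x" unfolding * by (simp add: K_def \<rho>_def Pair)
      finally show ?thesis .
    qed (simp add: Pair K_def \<rho>_def)
  qed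
  have K [measurable]: "K \<in> borel_measurable borel"
    unfolding K_def using box_test_measurable[OF \<rho>] unfolding borel_prod[symmetric] by measurable
  obtain B where B: "B > 0" "\<And>x. cmod (\<rho> x) \<le> B" using box_test_bounded[OF \<rho>] by metis
  have Kt0: "K (a, t) = 0" if "\<not> (\<alpha> \<le> a \<and> a \<le> \<beta> \<and> t \<in> {-T..T})" for a t
  proof -
    have "\<rho> (a, t) = 0" using \<rho> that unfolding box_test_def by force
    then show ?thesis by (simp add: K_def)
  qed
  have Kb: "cmod (K (a, t)) \<le> (indicator {\<alpha>..\<beta>} a * cmod (g (a * n))) * (B * indicator {-T..T} t)" for a t
  proof (cases "\<alpha> \<le> a \<and> a \<le> \<beta> \<and> t \<in> {-T..T}")
    case True
    then show ?thesis using B(2)[of "(a, t)"]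
      by (auto simp: K_def norm_mult intro!: mult_left_mono)
  next
    case False
    then show ?thesis using B(1) by (simp add: Kt0)
  qed
  have it: "integrable lborel (\<lambda>t. B * indicator {-T..T} t)"
    by (intro integrable_mult_right integrable_real_indicator) (use T in auto)
  have Kt: "integrable lborel (\<lambda>t. K (a, t))" for a
    by (rule Bochner_Integration.integrable_bound[OF integrable_mult_right[OF it,
            of "indicator {\<alpha>..\<beta>} a * cmod (g (a * n))"]])
       (use Kb[of a] B(1) in \<open>auto simp: abs_mult intro!: AE_I2\<close>)
  have ga: "integrable lborel (\<lambda>a. indicator {\<alpha>..\<beta>} a * cmod (g (a * n)))"
  proof -
    have "integrable lborel (\<lambda>x. indicator {\<alpha> * n..\<beta> * n} x *\<^sub>R g x)"
      using gi by (simp add: set_integrable_def)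
    from integrable_norm[OF lborel_integrable_real_affine[OF this, of n 0]]
    have "integrable lborel (\<lambda>a. cmod (indicator {\<alpha> * n..\<beta> * n} (n * a) *\<^sub>R g (n * a)))" using n by simp
    also have "(\<lambda>a::real. cmod (indicator {\<alpha> * n..\<beta> * n} (n * a) *\<^sub>R g (n * a)))
        = (\<lambda>a::real. indicator {\<alpha>..\<beta>} a * cmod (g (a * n)))"
      using n by (auto simp: fun_eq_iff indicator_def mult.commute)
    finally show ?thesis .
  qed
  have Kn: "integrable lborel (\<lambda>a. \<integral>t. cmod (K (a, t)) \<partial>lborel)"
  proof (rule Bochner_Integration.integrable_bound)
    show "integrable lborel (\<lambda>a. indicator {\<alpha>..\<beta>} a * cmod (g (a * n)) * (\<integral>t. B * indicator {-T..T} t \<partial>lborel))"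
      by (intro integrable_mult_left ga)
    show "(\<lambda>a. \<integral>t. cmod (K (a, t)) \<partial>lborel) \<in> borel_measurable lborel"
      using K unfolding borel_prod[symmetric]
      by (intro lborel.borel_measurable_lebesgue_integral) (simp add: case_prod_unfold)
    have "cmod (\<integral>t. cmod (K (a, t)) \<partial>lborel)
        \<le> indicator {\<alpha>..\<beta>} a * cmod (g (a * n)) * (\<integral>t. B * indicator {-T..T} t \<partial>lborel)" for a
    proof -
      have "(\<integral>t. cmod (K (a, t)) \<partial>lborel)
          \<le> (\<integral>t. (indicator {\<alpha>..\<beta>} a * cmod (g (a * n))) * (B * indicator {-T..T} t) \<partial>lborel)"
        by (rule integral_mono[OF integrable_norm[OF Kt] integrable_mult_right[OF it] Kb])
      then show ?thesis by simp
    qed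
    then show "AE a in lborel. norm (\<integral>t. cmod (K (a, t)) \<partial>lborel)
        \<le> norm (indicator {\<alpha>..\<beta>} a * cmod (g (a * n)) * (\<integral>t. B * indicator {-T..T} t \<partial>lborel))"
      by (intro AE_I2) (auto intro: order_trans[OF _ abs_ge_self])
  qed
  have KI: "integrable (lborel \<Otimes>\<^sub>M lborel) K"
    by (rule lborel_pair.Fubini_integrable[OF _ Kn]) (use Kt K in \<open>auto simp: lborel_prod\<close>)
  have m: "(\<lambda>x. \<phi> x * orbit_term g n x) \<in> borel_measurable borel" by measurable
  show ?I
    unfolding integrable_haar_iff[OF m] K_eq using KI by (simp add: lborel_prod)
  have inner: "(\<integral>t. K (a, t) \<partial>lborel) = g (a * n) * fourier T \<rho> n a" for a
  proof -
    have si: "set_integrable lborel {-T..T} (\<lambda>t. \<rho> (a, t) * tchar n t)"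
      by (intro borel_integrable_atLeastAtMost' box_test_continuous_tchar[OF \<rho>])
    have "(\<integral>t. K (a, t) \<partial>lborel) = g (a * n) * (LINT t|lborel. \<rho> (a, t) * tchar n t)"
      by (simp add: K_def)
    also have "(LINT t|lborel. \<rho> (a, t) * tchar n t) = (LINT t:{-T..T}|lborel. \<rho> (a, t) * tchar n t)"
      unfolding set_lebesgue_integral_def
    proof (intro Bochner_Integration.integral_cong refl)
      fix t
      have "t \<notin> {-T..T} \<Longrightarrow> \<rho> (a, t) = 0" using \<rho> unfolding box_test_def by force
      then show "\<rho> (a, t) * tchar n t = indicator {-T..T} t *\<^sub>R (\<rho> (a, t) * tchar n t)"
        by (cases "t \<in> {-T..T}") auto
    qed
    also have "\<dots> = fourier T \<rho> n a"
      unfolding fourier_def by (rule set_borel_integral_eq_integral(2)[OF si])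
    finally show ?thesis .
  qed
  have "(LINT x|haar. \<phi> x * orbit_term g n x) = (LINT x|lborel. K x)"
    unfolding integral_haar[OF m] K_eq ..
  also have "\<dots> = (LINT a|lborel. g (a * n) * fourier T \<rho> n a)"
    using lborel_pair.integral_fst'[OF KI] by (simp add: inner lborel_prod)
  also have "\<dots> = (LINT x|lborel. g x * (fourier T \<rho> n (x / n) / n))"
  proof -
    let ?f = "\<lambda>x. g x * (fourier T \<rho> n (x / n) / n)"
    have "(LINT x|lborel. ?f x) = \<bar>real n\<bar> *\<^sub>R (LINT a|lborel. ?f (0 + real n * a))"
      using n by (intro lborel_integral_real_affine) simp
    also have "\<dots> = (LINT a|lborel. \<bar>real n\<bar> *\<^sub>R ?f (0 + real n * a))"
      by (rule integral_scaleR_right[symmetric])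
    also have "\<dots> = (LINT a|lborel. g (a * n) * fourier T \<rho> n a)"
      using n by (intro Bochner_Integration.integral_cong) (simp_all add: scaleR_conv_of_real mult.commute)
    finally show ?thesis by simp
  qed
  finally show ?E by (simp add: \<rho>_def)
qed

section \<open>The smeared functional\<close>

text \<open>Successive derivatives in \<open>a\<close> of the function \<open>a\<^sup>-\<^sup>1\<^sup>/\<^sup>2 \<phi>(a, t)\<close> whose Fourier coefficients occur in
  the smeared functional.\<close>

primrec test_derivs :: "(real \<times> real \<Rightarrow> complex) \<Rightarrow> nat \<Rightarrow> real \<times> real \<Rightarrow> complex" where
  "test_derivs \<phi> 0 = (\<lambda>x. of_real (fst x powr (- 1 / 2)) * \<phi> x)"
| "test_derivs \<phi> (Suc j) = (\<lambda>x. frechet_derivative (test_derivs \<phi> j) (at x) (1, 0))"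

lemma integrable_inverse_square:
  fixes \<alpha> :: real
  assumes "0 < \<alpha>" shows "set_integrable lebesgue {\<alpha>..} (\<lambda>x. 1 / x ^ 2)"
  using has_integral_inverse_power_to_inf[of 2 \<alpha>] assms
  by (intro nonnegative_absolutely_integrable_1) (auto intro: has_integral_integrable)

lemma L2_pos_bound:
  fixes w :: "real \<Rightarrow> complex" and \<alpha> c :: real
  assumes "continuous_on {0<..} w" "0 < \<alpha>" "0 \<le> c" "\<And>x. x < \<alpha> \<Longrightarrow> w x = 0"
    "\<And>x. x > 0 \<Longrightarrow> x * cmod (w x) \<le> c"
  shows "L2_pos w" "L2_pos_norm w \<le> c * sqrt (LINT x:{\<alpha>..}|lebesgue. 1 / x ^ 2)"
proof -
  have b: "indicator {0<..} x *\<^sub>R (cmod (w x))\<^sup>2 \<le> indicator {\<alpha>..} x *\<^sub>R (c\<^sup>2 * (1 / x ^ 2))" for x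
  proof (cases "x \<ge> \<alpha>")
    case True
    then have x: "x > 0" using assms(2) by simp
    then have "(x * cmod (w x))\<^sup>2 \<le> c\<^sup>2" using assms(5)[OF x] by (intro power_mono) auto
    then show ?thesis using True x by (simp add: field_simps power_mult_distrib)
  next
    case False
    then show ?thesis using assms(4)[of x] by simp
  qed
  have i: "integrable lebesgue (\<lambda>x. indicator {\<alpha>..} x *\<^sub>R (c\<^sup>2 * (1 / x ^ 2)))"
    using set_integrable_mult_right[of "c\<^sup>2", OF integrable_inverse_square[OF assms(2)]]
    by (simp add: set_integrable_def)
  have j: "set_integrable lebesgue {0<..} (\<lambda>x. (cmod (w x))\<^sup>2)"
    unfolding set_integrable_def
  proof (rule Bochner_Integration.integrable_bound[OF i])
    show "(\<lambda>x. indicat_real {0<..} x *\<^sub>R (cmod (w x))\<^sup>2) \<in> borel_measurable lebesgue"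
      using continuous_on_pos_measurable(2)[of "\<lambda>x. (cmod (w x))\<^sup>2",
          OF continuous_on_power[OF continuous_on_norm[OF assms(1)]]]
      by (simp add: set_borel_measurable_def)
    show "AE x in lebesgue. norm (indicat_real {0<..} x *\<^sub>R (cmod (w x))\<^sup>2)
            \<le> norm (indicator {\<alpha>..} x *\<^sub>R (c\<^sup>2 * (1 / x ^ 2)))"
      using b by (intro AE_I2) (auto simp: abs_mult)
  qed
  then show "L2_pos w" using continuous_on_pos_measurable(2)[OF assms(1)] by (simp add: L2_pos_def)
  have "(LINT x:{0<..}|lebesgue. (cmod (w x))\<^sup>2) \<le> (LINT x:{\<alpha>..}|lebesgue. c\<^sup>2 * (1 / x ^ 2))"
    unfolding set_lebesgue_integral_def
    by (rule integral_mono[OF j[unfolded set_integrable_def] i b])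
  also have "\<dots> = c\<^sup>2 * (LINT x:{\<alpha>..}|lebesgue. 1 / x ^ 2)" by (rule set_integral_mult_right)
  finally have "L2_pos_norm w \<le> sqrt (c\<^sup>2 * (LINT x:{\<alpha>..}|lebesgue. 1 / x ^ 2))"
    unfolding L2_pos_norm_def by simp
  then show "L2_pos_norm w \<le> c * sqrt (LINT x:{\<alpha>..}|lebesgue. 1 / x ^ 2)"
    using assms(3) by (simp add: real_sqrt_mult)
qed

text \<open>Dominated convergence for series whose majorant is a product.\<close>

lemma
  fixes F :: "nat \<Rightarrow> 'a \<Rightarrow> complex" and q :: "'a \<Rightarrow> real"
  assumes F: "\<And>n. integrable M (F n)" and q: "integrable M q" and z: "summable z"
    and le: "\<And>n x. cmod (F n x) \<le> q x * z n"
  shows summable_majorized: "summable (\<lambda>n. F n x)"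
    and integrable_majorized: "integrable M (\<lambda>x. \<Sum>n. F n x)"
    and sums_majorized: "(\<lambda>n. integral\<^sup>L M (F n)) sums (\<integral>x. (\<Sum>n. F n x) \<partial>M)"
proof -
  have s: "summable (\<lambda>n. cmod (F n x))" for x
    by (rule summable_comparison_test'[OF summable_mult[OF z, of "q x"], of 0]) (simp add: le)
  then show "summable (\<lambda>n. F n x)" by (rule summable_norm_cancel)
  have si: "summable (\<lambda>n. \<integral>x. cmod (F n x) \<partial>M)"
  proof (rule summable_comparison_test'[OF summable_mult[OF z, of "integral\<^sup>L M q"], of 0])
    fix n
    have "(\<integral>x. cmod (F n x) \<partial>M) \<le> (\<integral>x. q x * z n \<partial>M)"
      by (rule integral_mono[OF integrable_norm[OF F] integrable_mult_left[OF q] le])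
    then show "norm (\<integral>x. cmod (F n x) \<partial>M) \<le> integral\<^sup>L M q * z n" by simp
  qed
  show "integrable M (\<lambda>x. \<Sum>n. F n x)"
    and "(\<lambda>n. integral\<^sup>L M (F n)) sums (\<integral>x. (\<Sum>n. F n x) \<partial>M)"
    using integrable_suminf[OF F AE_I2[OF s] si] sums_integral[OF F AE_I2[OF s] si] .
qed

text \<open>The computation of \<open>\<mu>(\<phi>)d\<close> for a fixed test function. Linear growth of \<open>d\<close> stands for polynomial
  growth; the rapid decay of the Fourier coefficients absorbs any power.\<close>

locale smearing =
  fixes d :: "nat \<Rightarrow> complex" and \<phi> :: "real \<times> real \<Rightarrow> complex" and \<alpha> \<beta> T C :: real
  assumes growth: "n \<ge> 1 \<Longrightarrow> cmod (d n) \<le> C * real n"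
    and C_pos: "0 < C" and \<alpha>_pos: "0 < \<alpha>" and T_pos: "0 < T" and box: "box_test \<alpha> \<beta> T \<phi>"
begin

lemma box_test_derivs: "box_test \<alpha> \<beta> T (test_derivs \<phi> j)"
  by (induction j) (auto intro: box_test_deriv box_test_powr_mult[OF box \<alpha>_pos])

text \<open>The \<open>j\<close>-th derivative of the contribution of \<open>d\<^sub>n \<delta>\<^sub>n\<close> to the smeared functional. For \<open>n = 0\<close> it
  vanishes because division by zero yields zero, so sums may start at \<open>0\<close>.\<close>

definition piece :: "nat \<Rightarrow> nat \<Rightarrow> real \<Rightarrow> complex" where
  "piece n j x = d n * fourier T (test_derivs \<phi> j) n (x / n) / of_nat n ^ (j + 1)"

lemma piece_0 [simp]: "piece 0 j x = 0"
  by (simp add: piece_def)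

lemma piece_support: "piece n j x \<noteq> 0 \<Longrightarrow> 0 < n \<and> \<alpha> * n \<le> x \<and> x \<le> \<beta> * n"
  using fourier_eq_0[OF box_test_derivs, of "x / n" j n]
  by (cases "n = 0") (auto simp: piece_def field_simps)

lemma piece_eq_0: "x < \<alpha> * N \<Longrightarrow> N \<le> n \<Longrightarrow> piece n j x = 0"
proof (rule ccontr)
  assume "x < \<alpha> * N" "N \<le> n" "piece n j x \<noteq> 0"
  moreover have "\<alpha> * N \<le> \<alpha> * n" using \<open>N \<le> n\<close> \<alpha>_pos by simp
  ultimately show False using piece_support[of n j x] by simp
qed

lemma piece_eq_0_left: "x < \<alpha> \<Longrightarrow> piece n j x = 0"
  using piece_eq_0[of x 1 n j] by (cases n) auto

lemma piece_derivative: "(piece n j has_vector_derivative piece n (Suc j) x) (at x)"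
proof (cases "n = 0")
  case True
  then show ?thesis by (simp add: piece_def[abs_def])
next
  case False
  have "((\<lambda>x. x / n) has_vector_derivative 1 / n) (at x)"
    unfolding has_real_derivative_iff_has_vector_derivative[symmetric]
    using False by (auto intro!: derivative_eq_intros)
  then have "((fourier T (test_derivs \<phi> j) n \<circ> (\<lambda>x. x / n)) has_vector_derivative
      (1 / n) *\<^sub>R fourier T (test_derivs \<phi> (Suc j)) n (x / n)) (at x)"
    using fourier_has_vector_derivative[OF box_test_derivs, of j n "x / n"]
    by (intro vector_diff_chain_at) simp_all
  from has_vector_derivative_mult_right[OF this, of "d n / of_nat n ^ (j + 1)"]
  show ?thesis using False
    by (simp add: piece_def[abs_def] o_def scaleR_conv_of_real field_simps)
qed

lemma piece_continuous: "continuous_on A (piece n j)"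
  using piece_derivative has_vector_derivative_continuous
  by (blast intro: continuous_at_imp_continuous_on)

text \<open>On the support of the \<open>n\<close>-th piece \<open>x\<close> is at most \<open>\<beta>n\<close>, so a power of \<open>x\<close> costs the same power
  of \<open>n\<close>, which the decay of the Fourier coefficients pays for.\<close>

lemma piece_bound:
  "\<exists>B\<ge>0. \<forall>n x. 0 < x \<longrightarrow> x ^ m * cmod (piece n j x) \<le> B * inverse (real n ^ 2)"
proof -
  \<comment> \<open>Of these \<open>m + 3\<close> powers, \<open>m\<close> pay for \<open>x ^ m\<close>, one for \<open>d n\<close>, and two remain.\<close>
  obtain B where B: "B > 0" "\<And>n a. real n ^ (m + 3) * cmod (fourier T (test_derivs \<phi> j) n a) \<le> B"
    using fourier_decay[OF box_test_derivs T_pos, of "m + 3" j] by auto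
  have "x ^ m * cmod (piece n j x) \<le> (\<bar>\<beta>\<bar> ^ m * C * B) * inverse (real n ^ 2)" if x: "0 < x" for n x
  proof (cases "piece n j x = 0")
    case True
    then show ?thesis using B(1) C_pos by simp
  next
    case False
    then have n: "0 < n" "x \<le> \<beta> * n" using piece_support by auto
    let ?F = "cmod (fourier T (test_derivs \<phi> j) n (x / n))"
    have "cmod (piece n j x) \<le> C * n * ?F"
    proof -
      have "cmod (piece n j x) = cmod (d n) * ?F / real n ^ (j + 1)"
        by (simp add: piece_def norm_mult norm_divide norm_power)
      also have "\<dots> \<le> cmod (d n) * ?F / 1"
        using n by (intro divide_left_mono one_le_power) auto
      also have "\<dots> = cmod (d n) * ?F" by simp
      also have "\<dots> \<le> C * n * ?F" using growth[of n] n by (intro mult_right_mono) auto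
      finally show ?thesis .
    qed
    then have "x ^ m * cmod (piece n j x) \<le> (\<bar>\<beta>\<bar> * n) ^ m * (C * n * ?F)"
      using x n C_pos by (intro mult_mono power_mono) (auto intro: order_trans[OF n(2)])
    also have "\<dots> = \<bar>\<beta>\<bar> ^ m * C * (real n ^ (m + 3) * ?F) * inverse (real n ^ 2)"
      using n by (simp add: power_mult_distrib power_add power2_eq_square power3_eq_cube field_simps)
    also have "\<dots> \<le> \<bar>\<beta>\<bar> ^ m * C * B * inverse (real n ^ 2)"
      using B C_pos by (intro mult_right_mono mult_left_mono) auto
    finally show ?thesis .
  qed
  then show ?thesis using B C_pos by (intro exI[of _ "\<bar>\<beta>\<bar> ^ m * C * B"]) auto
qed

definition partial :: "nat \<Rightarrow> nat \<Rightarrow> real \<Rightarrow> complex" where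
  "partial N j x = (\<Sum>n<N. piece n j x)"

definition smeared :: "nat \<Rightarrow> real \<Rightarrow> complex" where
  "smeared j x = (\<Sum>n. piece n j x)"

text \<open>The supports move off to the right, so on every bounded interval the series is a finite sum and
  may be differentiated term by term.\<close>

lemma smeared_eq_partial: "x < \<alpha> * N \<Longrightarrow> smeared j x = partial N j x"
  unfolding smeared_def partial_def by (rule suminf_finite) (auto intro: piece_eq_0)

lemma summable_piece: "summable (\<lambda>n. piece n j x)"
proof -
  obtain N :: nat where "x / \<alpha> < N" using reals_Archimedean2 by blast
  then have "x < \<alpha> * N" using \<alpha>_pos by (simp add: field_simps)
  then show ?thesis by (intro summable_finite[of "{..<N}"]) (auto intro: piece_eq_0)
qed

lemma partial_chain: "deriv_chain A (partial N)"
  unfolding deriv_chain_def partial_def[abs_def]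
  by (auto intro!: has_vector_derivative_sum piece_derivative)

lemma smeared_chain: "deriv_chain A smeared"
  unfolding deriv_chain_def
proof (intro allI ballI)
  fix j x
  obtain N :: nat where "x / \<alpha> < N" using reals_Archimedean2 by blast
  then have N: "x < \<alpha> * N" using \<alpha>_pos by (simp add: field_simps)
  show "(smeared j has_vector_derivative smeared (Suc j) x) (at x)"
  proof (rule has_vector_derivative_transform_within_open[of "partial N j"])
    show "(partial N j has_vector_derivative smeared (Suc j) x) (at x)"
      unfolding smeared_eq_partial[OF N] using partial_chain by (auto simp: deriv_chain_def)
    show "x \<in> {..<\<alpha> * N}" "open {..<\<alpha> * N}" using N by auto
  qed (simp add: smeared_eq_partial)
qed

lemma partial_left: "x < \<alpha> \<Longrightarrow> partial N j x = 0"
  by (simp add: partial_def piece_eq_0_left)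

lemma smeared_left: "x < \<alpha> \<Longrightarrow> smeared j x = 0"
  by (simp add: smeared_def piece_eq_0_left)

lemma partial_tail_bound:
  "\<exists>r. (\<forall>N. 0 \<le> r N) \<and> r \<longlonglongrightarrow> 0 \<and>
     (\<forall>N x. 0 < x \<longrightarrow> x ^ m * cmod (partial N j x - smeared j x) \<le> r N)"
proof -
  obtain B where B: "B \<ge> 0" "\<And>n x. 0 < x \<Longrightarrow> x ^ m * cmod (piece n j x) \<le> B * inverse (real n ^ 2)"
    using piece_bound[of m j] by blast
  define z where "z = (\<lambda>n. inverse (real n ^ 2))"
  have z: "summable z" unfolding z_def by (rule inverse_power_summable) simp
  define r where "r N = B * (suminf z - (\<Sum>n<N. z n))" for N
  have "r \<longlonglongrightarrow> B * (suminf z - suminf z)"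
    unfolding r_def by (intro tendsto_intros summable_LIMSEQ z)
  moreover have "0 \<le> r N" for N
    unfolding r_def using B(1) z by (auto intro!: mult_nonneg_nonneg sum_le_suminf simp: z_def)
  moreover have "x ^ m * cmod (partial N j x - smeared j x) \<le> r N" if x: "0 < x" for N x
  proof -
    have t: "cmod (piece n j x) \<le> B / x ^ m * z n" for n
      using B(2)[OF x, of n] x
      by (subst times_divide_eq_left, subst pos_le_divide_eq) (auto simp: z_def mult.commute)
    have zN: "summable (\<lambda>n. z (n + N))" using z by (simp add: summable_iff_shift)
    have sz: "summable (\<lambda>n. B / x ^ m * z (n + N))" by (rule summable_mult[OF zN])
    have "cmod (partial N j x - smeared j x) = cmod (\<Sum>n. piece (n + N) j x)"
      unfolding suminf_minus_initial_segment[OF summable_piece] partial_def smeared_def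
      by (simp add: norm_minus_commute)
    also have "\<dots> \<le> (\<Sum>n. B / x ^ m * z (n + N))"
      using t by (intro norm_suminf_le sz)
    also have "\<dots> = B / x ^ m * (suminf z - (\<Sum>n<N. z n))"
      by (simp only: suminf_mult[OF zN] suminf_minus_initial_segment[OF z])
    finally show ?thesis using x by (simp add: r_def field_simps)
  qed
  ultimately show ?thesis by (intro exI[of _ r]) simp
qed

text \<open>One more power of \<open>x\<close> in the uniform bound of the tail gives a square integrable majorant
  \<open>r\<^sub>N / x\<close> on \<open>{\<alpha>..}\<close>.\<close>

lemma tail_L2:
  "\<exists>r. r \<longlonglongrightarrow> 0 \<and> (\<forall>N. L2_pos (\<lambda>x. of_real (x ^ m) * (partial N j x - smeared j x)) \<and>
     L2_pos_norm (\<lambda>x. of_real (x ^ m) * (partial N j x - smeared j x)) \<le> r N)"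
proof -
  obtain r where r: "\<And>N. 0 \<le> r N" "r \<longlonglongrightarrow> 0"
    "\<And>N x. 0 < x \<Longrightarrow> x ^ Suc m * cmod (partial N j x - smeared j x) \<le> r N"
    using partial_tail_bound[of "Suc m" j] by blast
  let ?k = "sqrt (LINT x:{\<alpha>..}|lebesgue. 1 / x ^ 2)"
  have c: "continuous_on {0<..} (\<lambda>x. of_real (x ^ m) * (partial N j x - smeared j x))" for N
    by (intro continuous_intros deriv_chain_continuous_on[OF partial_chain] deriv_chain_continuous_on[OF smeared_chain])
  have "x * cmod (of_real (x ^ m) * (partial N j x - smeared j x)) \<le> r N" if "x > 0" for x N
    using r(3)[OF that, of N] that by (simp add: norm_mult norm_power mult.assoc)
  note * = L2_pos_bound[OF c \<alpha>_pos r(1) _ this]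
  have "(\<lambda>N. r N * ?k) \<longlonglongrightarrow> 0 * ?k" by (intro tendsto_intros r(2))
  then show ?thesis using * by (intro exI[of _ "\<lambda>N. r N * ?k"]) (simp add: partial_left smeared_left)
qed

lemma smeared_Hinf: "smeared 0 \<in> Hinf"
proof (rule HinfI[OF smeared_chain refl])
  show "smeared 0 x = 0" if "x \<le> 0" for x using smeared_left[of x] that \<alpha>_pos by simp
  show "L2_pos (\<lambda>x. of_real (x ^ m) * smeared n x)" for m n
  proof -
    have "L2_pos (\<lambda>x. of_real (x ^ m) * (partial 0 n x - smeared n x))"
      using tail_L2[of m n] by blast
    from L2_pos_cmult[OF this, of "-1"] show ?thesis by (simp add: partial_def)
  qed
qed

lemma partial_Hinf: "partial N 0 \<in> Hinf"
proof (rule HinfI[OF partial_chain refl])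
  show "partial N 0 x = 0" if "x \<le> 0" for x using partial_left[of x] that \<alpha>_pos by simp
  show "L2_pos (\<lambda>x. of_real (x ^ m) * partial N n x)" for m n
  proof -
    have "L2_pos (\<lambda>x. of_real (x ^ m) * (partial N n x - smeared n x))"
      "L2_pos (\<lambda>x. of_real (x ^ m) * (partial 0 n x - smeared n x))"
      using tail_L2[of m n] by blast+
    from L2_pos_add(1)[OF this(1) L2_pos_cmult[OF this(2), of "-1"]]
    show ?thesis by (simp add: partial_def algebra_simps)
  qed
qed

lemma partial_tendsto:
  "(\<lambda>N. Hinf_seminorm m j (\<lambda>x. partial N 0 x - smeared 0 x)) \<longlonglongrightarrow> 0"
proof -
  obtain r where r: "r \<longlonglongrightarrow> 0"
    "\<And>N. L2_pos_norm (\<lambda>x. of_real (x ^ m) * (partial N j x - smeared j x)) \<le> r N"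
    using tail_L2[of m j] by blast
  have "deriv_chain {0<..} (\<lambda>j x. partial N j x - smeared j x)" for N
    using partial_chain[of "{0<..}" N] smeared_chain[of "{0<..}"]
    unfolding deriv_chain_def by (auto intro!: has_vector_derivative_diff)
  from nth_deriv_chain[OF _ this]
  have "Hinf_seminorm m j (\<lambda>x. partial N 0 x - smeared 0 x)
     = L2_pos_norm (\<lambda>x. of_real (x ^ m) * (partial N j x - smeared j x))" for N
    unfolding Hinf_seminorm_def by (intro L2_pos_cong(2)) simp
  then have "Hinf_seminorm m j (\<lambda>x. partial N 0 x - smeared 0 x) \<le> r N" for N using r(2) by simp
  then show ?thesis
    by (intro tendsto_sandwich[OF _ _ tendsto_const r(1)]) auto
qed

lemma partial_test_function: "partial N 0 \<in> test_functions {0<..}"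
proof -
  have "smooth_on {0<..} (partial N 0)" by (rule smooth_on_chain[OF _ partial_chain]) simp
  moreover have "partial N 0 x = 0" if "x \<notin> {\<alpha>..\<bar>\<beta>\<bar> * N}" for x
  proof -
    have "piece n 0 x = 0" if "n < N" for n
    proof (rule ccontr)
      assume nz: "piece n 0 x \<noteq> 0"
      then have "\<alpha> \<le> x" using piece_eq_0_left by force
      moreover have "\<beta> * n \<le> \<bar>\<beta>\<bar> * N" using \<open>n < N\<close> by (intro mult_mono) auto
      ultimately show False using piece_support[OF nz] \<open>x \<notin> _\<close> by auto
    qed
    then show ?thesis by (simp add: partial_def)
  qed
  moreover have "{\<alpha>..\<bar>\<beta>\<bar> * N} \<subseteq> {0<..}" using \<alpha>_pos by auto
  ultimately show ?thesis unfolding test_functions_def by blast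
qed

text \<open>The partial sums are test functions on the half-line converging in \<^const>\<open>Hinf\<close>. Hence the value
  at the smeared functional of an extension of \<open>f\<close> is a limit of integrals against \<open>f\<close>. This
  yields at once the value and its independence of the extension.\<close>

lemma extension_at_smeared:
  assumes "extends_to f F"
  shows "(\<lambda>N. LINT x:{0<..}|lebesgue. f x * partial N 0 x) \<longlonglongrightarrow> F (smeared 0)"
proof -
  have "(\<lambda>N. F (partial N 0)) \<longlonglongrightarrow> F (smeared 0)"
    using assms partial_Hinf smeared_Hinf partial_tendsto
    by (intro Hminf_tendsto[of F "\<lambda>N. partial N 0"]) (auto simp: extends_to_def)
  then show ?thesis using assms partial_test_function by (simp add: extends_to_def)
qed

lemma integral_orbit_term_piece:
  assumes "g \<in> borel_measurable borel" "0 < n \<Longrightarrow> set_integrable lborel {\<alpha> * n..\<beta> * n} g" "g 0 = 0"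
  shows "integrable haar (\<lambda>x. \<phi> x * (d n * orbit_term g n x))"
    and "(LINT x|haar. \<phi> x * (d n * orbit_term g n x)) = (LINT x|lborel. g x * piece n 0 x)"
proof -
  have eq: "(\<lambda>x. \<phi> x * (d n * orbit_term g n x)) = (\<lambda>x. d n * (\<phi> x * orbit_term g n x))"
    by (auto simp: fun_eq_iff)
  show "integrable haar (\<lambda>x. \<phi> x * (d n * orbit_term g n x))"
    and "(LINT x|haar. \<phi> x * (d n * orbit_term g n x)) = (LINT x|lborel. g x * piece n 0 x)"
  proof (induction "n = 0")
    case True
    { case 1 show ?case using True assms(3) by (simp add: orbit_term_def case_prod_unfold) }
    { case 2 show ?case using True assms(3) by (simp add: orbit_term_def case_prod_unfold) }
  next
    case False
    { case 1 show ?case unfolding eq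
        using integrable_orbit_term[OF box \<alpha>_pos T_pos _ assms(1,2)] False by simp }
    { case 2
      have "(LINT x|lborel. g x * piece n 0 x) = (LINT x|lborel. d n * (g x *
          (fourier T (\<lambda>x. of_real (fst x powr (- 1 / 2)) * \<phi> x) n (x / n) / n)))"
        by (simp add: piece_def ac_simps)
      then show ?case unfolding eq
        using integral_orbit_term[OF box \<alpha>_pos T_pos _ assms(1,2)] False by simp }
  qed
qed

lemma mu_dual_dirac_comb:
  assumes "0 < a"
  shows "mu_dual (a, t) (dirac_comb d) \<psi> = (\<Sum>n. d (Suc n) * orbit_term \<psi> (Suc n) (a, t))"
proof -
  have pw: "(1 / a) powr (- 1 / 2) = a powr (1 / 2)"
    using assms by (simp add: powr_divide powr_minus field_simps)
  have "mu_star (1 / a, - t / a) \<psi> (real (Suc n)) = orbit_term \<psi> (Suc n) (a, t)" for n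
  proof -
    have "exp (2 * complex_of_real pi * \<i> * complex_of_real (- t / a) * complex_of_real (inverse (1 / a) * real (Suc n)))
        = tchar (Suc n) t"
      unfolding tchar_def cis_conv_exp using assms
      by (intro arg_cong[where f=exp]) (simp add: field_simps)
    then show ?thesis
      unfolding mu_star_def dilation_def modulation_def orbit_term_def
      using pw by (simp add: mult.assoc)
  qed
  then show ?thesis by (simp add: mu_dual_def inv_axb[OF assms] dirac_comb_def)
qed

lemma Hinf_borel_measurable:
  assumes "\<psi> \<in> Hinf" shows "\<psi> \<in> borel_measurable borel"
proof -
  have "continuous_on {0<..} \<psi>" using deriv_chain_continuous_on[OF Hinf_chain[OF assms], of 0] by simp
  then have "(\<lambda>x. indicator {0<..} x *\<^sub>R \<psi> x) \<in> borel_measurable borel"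
    using continuous_on_pos_measurable(1) by (simp add: set_borel_measurable_def)
  also have "(\<lambda>x. indicator {0<..} x *\<^sub>R \<psi> x) = \<psi>"
    using assms by (auto simp: fun_eq_iff indicator_def Hinf_def)
  finally show ?thesis .
qed

text \<open>Both sides are expanded in \<open>n\<close>. On the group the decay of \<open>\<psi>\<close> at the points \<open>an\<close>, and on the
  half-line the decay of the pieces, provides a summable majorant; the terms correspond by
  \<open>integral_orbit_term_piece\<close>.\<close>

theorem is_mu_smeared: "is_mu_smeared \<phi> (dirac_comb d) (smeared 0)"
  unfolding is_mu_smeared_def
proof (intro conjI ballI smeared_Hinf)
  fix \<psi> assume \<psi>: "\<psi> \<in> Hinf"
  have \<psi>0: "\<psi> 0 = 0" using \<psi> by (simp add: Hinf_def)
  have \<psi>c: "continuous_on {0<..} \<psi>" using deriv_chain_continuous_on[OF Hinf_chain[OF \<psi>], of 0] by simp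
  have \<psi>i: "set_integrable lborel {\<alpha> * n..\<beta> * n} \<psi>" if "0 < n" for n :: nat
  proof (intro borel_integrable_atLeastAtMost' continuous_on_subset[OF \<psi>c] subsetI)
    fix x assume "x \<in> {\<alpha> * n..\<beta> * n}"
    then show "x \<in> {0<..}"
      using less_le_trans[OF mult_pos_pos[OF \<alpha>_pos, of "real n"], of x] that by simp
  qed
  note \<psi>m [measurable] = Hinf_borel_measurable[OF \<psi>]
  note [measurable] = box_test_measurable[OF box]
  define z where "z = (\<lambda>n. inverse (real n ^ 2))"
  have z: "summable z" unfolding z_def by (rule inverse_power_summable) simp
  define Fn where "Fn n x = \<phi> x * (d n * orbit_term \<psi> n x)" for n x
  define E where "E x = \<phi> x * orbit_term (\<lambda>_. 1) 1 x" for x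
  have Fi: "integrable haar (Fn n)" for n
    using integral_orbit_term_piece(1)[OF \<psi>m \<psi>i \<psi>0] unfolding Fn_def .
  have Ei: "integrable haar E" unfolding E_def
    by (rule integrable_orbit_term[OF box \<alpha>_pos T_pos]) (auto intro!: borel_integrable_atLeastAtMost')
  obtain B where B: "B > 0" "\<And>x. x > 0 \<Longrightarrow> cmod (\<psi> x) \<le> B / x ^ 3"
    using Hinf_decay[OF \<psi>, of 3] by auto
  have Fb: "cmod (Fn n x) \<le> C * B / \<alpha> ^ 3 * cmod (E x) * z n" for n x
  proof (cases "n = 0 \<or> \<phi> x = 0")
    case True
    then show ?thesis using \<psi>0 by (auto simp: Fn_def E_def z_def orbit_term_def case_prod_unfold)
  next
    case False
    obtain a t where x: "x = (a, t)" by (cases x)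
    have a: "\<alpha> \<le> a" using box False x by (auto simp: box_test_def)
    have "cmod (\<psi> (a * n)) \<le> B / (a * n) ^ 3" using a \<alpha>_pos False by (intro B(2)) auto
    also have "\<dots> \<le> B / (\<alpha> * n) ^ 3"
      using a \<alpha>_pos False B(1) by (intro divide_left_mono power_mono mult_right_mono) auto
    finally have 1: "cmod (\<psi> (a * n)) \<le> B / (\<alpha> * n) ^ 3" .
    have "cmod (Fn n x) = cmod (E x) * (cmod (d n) * cmod (\<psi> (a * n)))"
      by (simp add: Fn_def E_def x orbit_term_def norm_mult)
    also have "\<dots> \<le> cmod (E x) * ((C * n) * (B / (\<alpha> * n) ^ 3))"
      using 1 growth[of n] False C_pos by (intro mult_left_mono mult_mono) auto
    also have "\<dots> = C * B / \<alpha> ^ 3 * cmod (E x) * z n"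
      using False by (simp add: z_def power_mult_distrib power2_eq_square power3_eq_cube field_simps)
    finally show ?thesis .
  qed
  have Mi: "integrable haar (\<lambda>x. C * B / \<alpha> ^ 3 * cmod (E x))"
    by (intro integrable_mult_right integrable_norm Ei)
  have eq: "\<phi> x * mu_dual x (dirac_comb d) \<psi> = (\<Sum>n. Fn n x)" for x
  proof (cases "\<phi> x = 0")
    case True
    then show ?thesis by (simp add: Fn_def)
  next
    case False
    obtain a t where x: "x = (a, t)" by (cases x)
    have a: "0 < a" using box False x \<alpha>_pos by (force simp: box_test_def)
    have s: "summable (\<lambda>n. Fn n x)" by (rule summable_majorized[OF Fi Mi z Fb])
    have "(\<Sum>n. Fn n x) = (\<Sum>n. Fn (Suc n) x)"
      using suminf_split_head[OF s] by (simp add: Fn_def orbit_term_def x \<psi>0)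
    also have "\<dots> = \<phi> x * (\<Sum>n. d (Suc n) * orbit_term \<psi> (Suc n) x)"
    proof -
      have "summable (\<lambda>n. \<phi> x * (d (Suc n) * orbit_term \<psi> (Suc n) x))"
        using s summable_Suc_iff[of "\<lambda>n. Fn n x"] by (simp add: Fn_def)
      then show ?thesis unfolding Fn_def using False by (intro suminf_mult) (simp add: summable_cmult_iff)
    qed
    also have "\<dots> = \<phi> x * mu_dual x (dirac_comb d) \<psi>"
      unfolding x mu_dual_dirac_comb[OF a] ..
    finally show ?thesis by simp
  qed
  \<comment> \<open>The terms on the half-line, with majorant \<open>q\<close> up to constants.\<close>
  define G where "G n x = \<psi> x * piece n 0 x" for n x
  obtain B1 where B1: "B1 > 0" "\<And>x. x > 0 \<Longrightarrow> cmod (\<psi> x) \<le> B1 / x ^ 1"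
    using Hinf_decay[OF \<psi>, of 1] by auto
  obtain B2 where B2: "B2 \<ge> 0" "\<And>n x. 0 < x \<Longrightarrow> x ^ 1 * cmod (piece n 0 x) \<le> B2 * inverse (real n ^ 2)"
    using piece_bound[of 1 0] by blast
  define q where "q x = indicator {\<alpha>..} x * (1 / x ^ 2)" for x :: real
  have qi: "integrable lborel q"
  proof -
    have "integrable lebesgue q" using integrable_inverse_square[OF \<alpha>_pos] by (simp add: set_integrable_def q_def[abs_def])
    moreover have "q \<in> borel_measurable lborel" unfolding q_def[abs_def] by measurable
    ultimately show ?thesis by (simp add: integrable_completion)
  qed
  have Gb: "cmod (G n x) \<le> B1 * B2 * q x * z n" for n x
  proof (cases "x \<ge> \<alpha>")
    case True
    then have x: "x > 0" using \<alpha>_pos by simp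
    have "cmod (piece n 0 x) \<le> B2 * z n / x"
      using B2(2)[OF x, of n] x by (simp add: z_def pos_le_divide_eq mult.commute)
    then have "cmod (\<psi> x) * cmod (piece n 0 x) \<le> (B1 / x) * (B2 * z n / x)"
      using B1(2)[OF x] B1(1) x by (intro mult_mono) auto
    then show ?thesis using True by (simp add: G_def norm_mult q_def power2_eq_square mult_ac)
  qed (use \<psi>0 in \<open>simp add: G_def q_def piece_eq_0_left\<close>)
  have Gm: "G n \<in> borel_measurable borel" for n
    unfolding G_def[abs_def] by (intro borel_measurable_times \<psi>m borel_measurable_continuous_onI piece_continuous)
  have q_nn: "q x \<ge> 0" for x by (simp add: q_def)
  have z_nn: "z n \<ge> 0" for n by (simp add: z_def)
  have Gi: "integrable lborel (G n)" for n
    by (rule Bochner_Integration.integrable_bound[OF integrable_mult_left[OF integrable_mult_right[OF qi, of "B1 * B2"], of "z n"]])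
       (use Gm Gb B1 B2 q_nn z_nn in \<open>auto simp: abs_mult intro!: AE_I2\<close>)
  have "(\<Sum>n. G n x) = \<psi> x * smeared 0 x" for x
    unfolding G_def smeared_def by (rule suminf_mult[OF summable_piece])
  with sums_majorized[OF Gi integrable_mult_right[OF qi] z Gb]
  have "(\<lambda>n. integral\<^sup>L lborel (G n)) sums (\<integral>x. \<psi> x * smeared 0 x \<partial>lborel)" by simp
  moreover have "integral\<^sup>L haar (Fn n) = integral\<^sup>L lborel (G n)" for n
    using integral_orbit_term_piece(2)[OF \<psi>m \<psi>i \<psi>0] unfolding Fn_def G_def .
  ultimately have "(\<integral>x. (\<Sum>n. Fn n x) \<partial>haar) = (\<integral>x. \<psi> x * smeared 0 x \<partial>lborel)"
    using sums_majorized[OF Fi Mi z Fb] sums_unique2 by simp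
  also have "\<dots> = (LINT x:{0<..}|lebesgue. smeared 0 x * \<psi> x)"
  proof -
    have "smeared 0 \<in> borel_measurable borel"
      by (intro borel_measurable_continuous_onI deriv_chain_continuous_on[OF smeared_chain])
    then have m: "(\<lambda>x. \<psi> x * smeared 0 x) \<in> borel_measurable lborel" by simp
    have "(\<lambda>x. indicator {0<..} x *\<^sub>R (smeared 0 x * \<psi> x)) = (\<lambda>x. \<psi> x * smeared 0 x)"
      using \<psi> by (auto simp: fun_eq_iff indicator_def Hinf_def)
    then show ?thesis unfolding set_lebesgue_integral_def using integral_completion[OF m] by simp
  qed
  finally show "has_bochner_integral haar (\<lambda>x. \<phi> x * mu_dual x (dirac_comb d) \<psi>)
      (LINT x:{0<..}|lebesgue. smeared 0 x * \<psi> x)"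
    unfolding eq using integrable_majorized[OF Fi Mi z Fb] by (simp add: has_bochner_integral_iff)
qed

lemma smeared_unique: "is_mu_smeared \<phi> (dirac_comb d) h \<Longrightarrow> h = smeared 0"
proof (rule Hinf_eqI)
  assume h: "is_mu_smeared \<phi> (dirac_comb d) h"
  show "(LINT x:{0<..}|lebesgue. h x * \<psi> x) = (LINT x:{0<..}|lebesgue. smeared 0 x * \<psi> x)"
    if "\<psi> \<in> Hinf" for \<psi>
    using h is_mu_smeared that has_bochner_integral_eq unfolding is_mu_smeared_def by blast
qed (use smeared_Hinf in \<open>auto simp: is_mu_smeared_def\<close>)

lemma is_matrix_coeff_value_iff:
  assumes "extends_to f F"
  shows "is_matrix_coeff_value (dirac_comb d) f \<phi> c \<longleftrightarrow> c = F (smeared 0)"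
proof
  assume "is_matrix_coeff_value (dirac_comb d) f \<phi> c"
  then obtain F' where "extends_to f F'" "c = F' (smeared 0)"
    unfolding is_matrix_coeff_value_def using smeared_unique by blast
  then show "c = F (smeared 0)"
    using LIMSEQ_unique[OF extension_at_smeared[OF assms] extension_at_smeared[of f F']] by simp
next
  assume "c = F (smeared 0)"
  then show "is_matrix_coeff_value (dirac_comb d) f \<phi> c"
    unfolding is_matrix_coeff_value_def using is_mu_smeared assms by blast
qed

end

section \<open>Trigonometric polynomials\<close>

lemma tchar_mult_cnj: "tchar n t * cnj (tchar m t) = cis (2 * pi * (real m - real n) * t)"
  by (simp add: tchar_def cis_cnj cis_mult algebra_simps)

lemma tchar_orthogonal:
  "(LINT t:{p..p + real L}|lborel. tchar n t * cnj (tchar m t)) = (if n = m then of_nat L else 0)"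
proof -
  have c: "continuous_on A (\<lambda>t. tchar n t * cnj (tchar m t))" for A
    by (intro continuous_intros)
  have eq: "(LINT t:{p..p + real L}|lborel. tchar n t * cnj (tchar m t))
      = integral {p..p + real L} (\<lambda>t. tchar n t * cnj (tchar m t))"
    by (intro set_borel_integral_eq_integral(2) borel_integrable_atLeastAtMost' c)
  show ?thesis
  proof (cases "n = m")
    case True
    then show ?thesis unfolding eq unfolding tchar_mult_cnj by (simp add: scaleR_conv_of_real)
  next
    case False
    define w where "w = 2 * pi * (real m - real n)"
    have w: "w \<noteq> 0" using False by (simp add: w_def)
    have D0: "((\<lambda>t. cis (w * t)) has_vector_derivative w *\<^sub>R (\<i> * cis (w * t))) (at t within A)" for t A
      unfolding has_vector_derivative_def by (auto intro!: derivative_eq_intros)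
    have D: "((\<lambda>t. cis (w * t) / (\<i> * w)) has_vector_derivative cis (w * t)) (at t within A)" for t A
      using has_vector_derivative_mult_right[OF D0[of t A], of "1 / (\<i> * w)"] w
      by (simp add: scaleR_conv_of_real)
    have "((\<lambda>t. cis (w * t)) has_integral
        (cis (w * (p + real L)) / (\<i> * w) - cis (w * p) / (\<i> * w))) {p..p + real L}"
      by (intro fundamental_theorem_of_calculus D) simp
    moreover have "cis (w * (p + real L)) = cis (w * p)"
    proof -
      have "w * real L = 2 * pi * real_of_int ((int m - int n) * int L)" by (simp add: w_def)
      then have "cis (w * real L) = 1" by (metis cis_multiple_2pi Ints_of_int)
      then show ?thesis by (simp add: distrib_left flip: cis_mult)
    qed
    ultimately have "integral {p..p + real L} (\<lambda>t. cis (w * t)) = 0" by (simp add: integral_unique)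
    then show ?thesis unfolding eq unfolding tchar_mult_cnj using False by (simp add: w_def)
  qed
qed

lemma tchar_coefficient:
  assumes "finite A"
  shows "(LINT t:{p..p + real L}|lborel. (\<Sum>n\<in>A. c n * tchar n t) * cnj (tchar m t))
    = (if m \<in> A then c m * of_nat L else 0)"
proof -
  have "(LINT t:{p..p + real L}|lborel. (\<Sum>n\<in>A. c n * tchar n t) * cnj (tchar m t))
      = (LINT t:{p..p + real L}|lborel. (\<Sum>n\<in>A. c n * (tchar n t * cnj (tchar m t))))"
    by (simp add: sum_distrib_right mult.assoc)
  also have "\<dots> = (\<Sum>n\<in>A. LINT t:{p..p + real L}|lborel. c n * (tchar n t * cnj (tchar m t)))"
    using assms unfolding set_lebesgue_integral_def scaleR_sum_right
    by (intro Bochner_Integration.integral_sum)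
       (auto intro!: borel_integrable_atLeastAtMost'[unfolded set_integrable_def] continuous_intros)
  also have "\<dots> = (\<Sum>n\<in>A. if n = m then c m * of_nat L else 0)"
    by (intro sum.cong refl) (simp add: tchar_orthogonal)
  finally show ?thesis using assms by simp
qed

text \<open>Intervals of integer length \<open>L\<close> are needed twice: \<open>L = 1\<close> in the norm inequality and \<open>L = 2N\<close> in
  the estimates over a box.\<close>

lemma tchar_parseval:
  assumes "finite A"
  shows "(\<integral>\<^sup>+t\<in>{p..p + real L}. ennreal ((cmod (\<Sum>n\<in>A. c n * tchar n t))\<^sup>2) \<partial>lborel)
    = ennreal (real L * (\<Sum>n\<in>A. (cmod (c n))\<^sup>2))"
proof -
  let ?S = "\<lambda>t. \<Sum>n\<in>A. c n * tchar n t" and ?I = "{p..p + real L}"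
  have c: "continuous_on B ?S" for B by (intro continuous_intros)
  have i: "set_integrable lborel ?I (\<lambda>t. (cmod (?S t))\<^sup>2)"
    by (intro borel_integrable_atLeastAtMost' continuous_intros)
  have "complex_of_real (LINT t:?I|lborel. (cmod (?S t))\<^sup>2) = (LINT t:?I|lborel. complex_of_real ((cmod (?S t))\<^sup>2))"
    by (rule set_integral_complex_of_real[symmetric])
  also have "\<dots> = (LINT t:?I|lborel. (\<Sum>m\<in>A. cnj (c m) * (?S t * cnj (tchar m t))))"
    by (simp add: complex_norm_square cnj_sum sum_distrib_left mult_ac del: of_real_power)
  also have "\<dots> = (\<Sum>m\<in>A. LINT t:?I|lborel. cnj (c m) * (?S t * cnj (tchar m t)))"
    using assms unfolding set_lebesgue_integral_def scaleR_sum_right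
    by (intro Bochner_Integration.integral_sum)
       (auto intro!: borel_integrable_atLeastAtMost'[unfolded set_integrable_def] continuous_intros)
  also have "\<dots> = (\<Sum>m\<in>A. cnj (c m) * (c m * of_nat L))"
    by (intro sum.cong refl) (simp add: tchar_coefficient[OF assms])
  also have "\<dots> = complex_of_real (real L * (\<Sum>n\<in>A. (cmod (c n))\<^sup>2))"
    by (simp add: sum_distrib_left complex_norm_square mult_ac del: of_real_power)
  finally have 1: "(LINT t:?I|lborel. (cmod (?S t))\<^sup>2) = real L * (\<Sum>n\<in>A. (cmod (c n))\<^sup>2)"
    using of_real_eq_iff by blast
  have "(\<integral>\<^sup>+t\<in>?I. ennreal ((cmod (?S t))\<^sup>2) \<partial>lborel) = (\<integral>\<^sup>+t. ennreal (indicator ?I t *\<^sub>R (cmod (?S t))\<^sup>2) \<partial>lborel)"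
    by (intro nn_integral_cong) (auto simp: indicator_def)
  also have "\<dots> = ennreal (LINT t:?I|lborel. (cmod (?S t))\<^sup>2)"
    unfolding set_lebesgue_integral_def
    using i by (intro nn_integral_eq_integral) (auto simp: set_integrable_def)
  finally show ?thesis unfolding 1 .
qed

lemma powr_minus_one_minus:
  fixes x :: real
  assumes "0 < x" shows "x powr (- 1 - s) = x powr (- s) * (1 / x)"
proof -
  have "x powr (- 1 - s) = x powr (- s + - 1)" by (simp add: algebra_simps)
  also have "\<dots> = x powr (- s) * (1 / x)"
    using assms unfolding powr_add by (simp add: powr_minus divide_inverse)
  finally show ?thesis .
qed

section \<open>Dyadic blocks\<close>

lemma ennreal_set_integral_norm:
  fixes w :: "'a \<Rightarrow> complex"
  assumes "set_integrable M S w"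
  shows "ennreal (LINT x:S|M. cmod (w x)) = (\<integral>\<^sup>+x\<in>S. ennreal (cmod (w x)) \<partial>M)"
proof -
  have "ennreal (LINT x:S|M. cmod (w x)) = (\<integral>\<^sup>+x. ennreal (indicator S x *\<^sub>R cmod (w x)) \<partial>M)"
    unfolding set_lebesgue_integral_def using set_integrable_norm[OF assms]
    by (intro nn_integral_eq_integral[symmetric]) (auto simp: set_integrable_def)
  also have "\<dots> = (\<integral>\<^sup>+x\<in>S. ennreal (cmod (w x)) \<partial>M)"
    by (intro nn_integral_cong) (auto simp: indicator_def)
  finally show ?thesis .
qed

lemma nn_integral_scale:
  assumes [measurable]: "h \<in> borel_measurable borel" and n: "0 < (n::nat)"
  shows "(\<integral>\<^sup>+a. h (a * real n) \<partial>lborel) = ennreal (1 / n) * (\<integral>\<^sup>+x. h x \<partial>lborel)"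
proof -
  have "ennreal (1 / n) * (\<integral>\<^sup>+x. h x \<partial>lborel)
      = ennreal (1 / n) * (ennreal \<bar>real n\<bar> * (\<integral>\<^sup>+x. h (0 + real n * x) \<partial>lborel))"
    using n by (subst nn_integral_real_affine[of h "real n" 0]) auto
  also have "\<dots> = (\<integral>\<^sup>+a. h (a * real n) \<partial>lborel)"
    using n by (simp add: mult.assoc[symmetric] ennreal_mult[symmetric] mult.commute[of "real n"])
  finally show ?thesis by simp
qed

lemma nn_integral_box:
  fixes w :: "real \<times> real \<Rightarrow> ennreal"
  assumes [measurable]: "w \<in> borel_measurable borel"
  shows "(\<integral>\<^sup>+x\<in>{\<alpha>..\<beta>} \<times> {p..q}. w x \<partial>lborel)
    = (\<integral>\<^sup>+a\<in>{\<alpha>..\<beta>}. (\<integral>\<^sup>+t\<in>{p..q}. w (a, t) \<partial>lborel) \<partial>lborel)"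
proof -
  have m: "(\<lambda>x. w x * indicator ({\<alpha>..\<beta>} \<times> {p..q}) x) \<in> borel_measurable (lborel \<Otimes>\<^sub>M lborel)"
  proof -
    have "{\<alpha>..\<beta>} \<times> {p..q} \<in> sets borel" by (intro borel_closed closed_Times) auto
    then have "(\<lambda>x. w x * indicator ({\<alpha>..\<beta>} \<times> {p..q}) x) \<in> borel_measurable borel"
      by (intro borel_measurable_times_ennreal borel_measurable_indicator assms)
    then show ?thesis unfolding lborel_prod by simp
  qed
  have w1: "(\<lambda>t. w (a, t)) \<in> borel_measurable borel" for a
    by (rule measurable_compose[OF _ assms]) (simp add: borel_prod[symmetric])
  have "(\<integral>\<^sup>+x\<in>{\<alpha>..\<beta>} \<times> {p..q}. w x \<partial>lborel)
      = (\<integral>\<^sup>+a. \<integral>\<^sup>+t. w (a, t) * indicator ({\<alpha>..\<beta>} \<times> {p..q}) (a, t) \<partial>lborel \<partial>lborel)"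
    unfolding lborel.nn_integral_fst[OF m] lborel_prod ..
  also have "\<dots> = (\<integral>\<^sup>+a. (\<integral>\<^sup>+t. (w (a, t) * indicator {p..q} t) * indicator {\<alpha>..\<beta>} a \<partial>lborel) \<partial>lborel)"
    by (intro nn_integral_cong) (auto simp: indicator_def)
  also have "\<dots> = (\<integral>\<^sup>+a\<in>{\<alpha>..\<beta>}. (\<integral>\<^sup>+t\<in>{p..q}. w (a, t) \<partial>lborel) \<partial>lborel)"
    using w1 by (intro nn_integral_cong nn_integral_multc) auto
  finally show ?thesis .
qed

locale subpolynomial =
  fixes d :: "nat \<Rightarrow> complex" and \<epsilon> :: real
  assumes growth: "\<And>\<tau>::real. \<tau> > 0 \<Longrightarrow> \<exists>C>0. \<forall>n\<ge>1. cmod (d n) \<le> C * real n powr \<tau>"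
    and eps: "\<epsilon> > 0"
begin

lemma d_square_bound: "\<exists>C>0. \<forall>n\<ge>1. (cmod (d n))\<^sup>2 \<le> C * real n powr (\<epsilon> / 2)"
proof -
  obtain C where C: "C > 0" "\<And>n. n \<ge> 1 \<Longrightarrow> cmod (d n) \<le> C * real n powr (\<epsilon> / 4)"
    using growth[of "\<epsilon> / 4"] eps by auto
  have "(cmod (d n))\<^sup>2 \<le> C\<^sup>2 * real n powr (\<epsilon> / 2)" if "n \<ge> 1" for n
  proof -
    have "(cmod (d n))\<^sup>2 \<le> (C * real n powr (\<epsilon> / 4))\<^sup>2" using C(2)[OF that] by (intro power_mono) auto
    also have "\<dots> = C\<^sup>2 * real n powr (\<epsilon> / 2)"
      by (simp add: power_mult_distrib power2_eq_square powr_add[symmetric])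
    finally show ?thesis .
  qed
  then show ?thesis using C(1) by (intro exI[of _ "C\<^sup>2"]) auto
qed

lemma summable_weight: "summable (\<lambda>n. (cmod (d n))\<^sup>2 * real n powr (- 1 - \<epsilon>))"
proof -
  obtain C where C: "C > 0" "\<And>n. n \<ge> 1 \<Longrightarrow> (cmod (d n))\<^sup>2 \<le> C * real n powr (\<epsilon> / 2)"
    using d_square_bound by blast
  show ?thesis
  proof (rule summable_comparison_test'[of "\<lambda>n. C * real n powr (- 1 - \<epsilon> / 2)" 1])
    show "summable (\<lambda>n. C * real n powr (- 1 - \<epsilon> / 2))"
      using eps by (intro summable_mult) (simp add: summable_real_powr_iff)
    fix n :: nat assume n: "n \<ge> 1"
    have "(cmod (d n))\<^sup>2 * real n powr (- 1 - \<epsilon>) \<le> C * real n powr (\<epsilon> / 2) * real n powr (- 1 - \<epsilon>)"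
      using C(2)[OF n] by (intro mult_right_mono) auto
    also have "\<dots> = C * real n powr (- 1 - \<epsilon> / 2)"
    proof -
      have "\<epsilon> / 2 + (- 1 - \<epsilon>) = - 1 - \<epsilon> / 2" by simp
      then show ?thesis unfolding mult.assoc powr_add[symmetric] by (rule arg_cong)
    qed
    finally show "norm ((cmod (d n))\<^sup>2 * real n powr (- 1 - \<epsilon>)) \<le> C * real n powr (- 1 - \<epsilon> / 2)" by simp
  qed
qed

end

text \<open>Borel measurability of \<open>f\<close> is required because \<open>f\<close> is composed with \<open>(a, t) \<mapsto> an\<close>
  on the plane, whose measure is a Borel measure.\<close>

locale coefficient_data = subpolynomial d \<epsilon>
  for d :: "nat \<Rightarrow> complex" and \<epsilon> :: real +
  fixes f :: "real \<Rightarrow> complex" and K :: real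
  assumes K: "K > 0"
    and f_meas [measurable]: "f \<in> borel_measurable borel"
    and f_0: "\<And>x. x \<le> 0 \<Longrightarrow> f x = 0"
    and f_int: "\<And>\<alpha> \<beta>. 0 < \<alpha> \<Longrightarrow> set_integrable lborel {\<alpha>..\<beta>} f"
    and f_L2: "(\<integral>\<^sup>+a\<in>{K<..}. ennreal (a powr \<epsilon> * (cmod (f a))\<^sup>2) \<partial>lborel) < \<infinity>"
begin

definition mass :: ennreal where
  "mass = (\<integral>\<^sup>+a\<in>{K<..}. ennreal (a powr \<epsilon> * (cmod (f a))\<^sup>2) \<partial>lborel)"

text \<open>Substitute \<open>x = an\<close>: the measure contributes \<open>1/n\<close>, the weight \<open>n\<^sup>-\<^sup>\<epsilon>\<close>, and \<open>a > K\<close> implies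
  \<open>an > K\<close>. Summed against \<open>|d\<^sub>n|\<^sup>2\<close> this produces the constant of the theorem.\<close>

lemma dilated_mass:
  assumes "n \<ge> 1"
  shows "(\<integral>\<^sup>+a\<in>{K<..}. ennreal (a powr \<epsilon> * (cmod (f (a * real n)))\<^sup>2) \<partial>lborel)
    \<le> ennreal (real n powr (- 1 - \<epsilon>)) * mass"
proof -
  let ?w = "\<lambda>x. ennreal (x powr \<epsilon> * (cmod (f x))\<^sup>2) * indicator {K<..} x"
  have "(\<integral>\<^sup>+a\<in>{K<..}. ennreal (a powr \<epsilon> * (cmod (f (a * real n)))\<^sup>2) \<partial>lborel)
      \<le> (\<integral>\<^sup>+a. ennreal (real n powr (- \<epsilon>)) * ?w (a * real n) \<partial>lborel)"
  proof (intro nn_integral_mono)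
    fix a
    show "ennreal (a powr \<epsilon> * (cmod (f (a * real n)))\<^sup>2) * indicator {K<..} a
        \<le> ennreal (real n powr (- \<epsilon>)) * ?w (a * real n)"
    proof (cases "a > K")
      case True
      have "a * 1 \<le> a * real n" using True assms K by (intro mult_left_mono) auto
      then have "K < a * real n" using True by simp
      moreover have "a powr \<epsilon> = real n powr (- \<epsilon>) * (a * real n) powr \<epsilon>"
        using True K assms by (simp add: powr_mult powr_minus)
      ultimately show ?thesis using True by (simp add: ennreal_mult[symmetric] mult.assoc)
    qed simp
  qed
  also have "\<dots> = ennreal (real n powr (- \<epsilon>)) * (\<integral>\<^sup>+a. ?w (a * real n) \<partial>lborel)"
    by (rule nn_integral_cmult) measurable
  also have "\<dots> = ennreal (real n powr (- \<epsilon>)) * (ennreal (1 / n) * mass)"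
    using assms unfolding mass_def by (subst nn_integral_scale) auto
  also have "\<dots> = ennreal (real n powr (- 1 - \<epsilon>)) * mass"
  proof -
    have "ennreal (real n powr (- \<epsilon>) * (1 / n)) = ennreal (real n powr (- \<epsilon>)) * ennreal (1 / n)"
      by (rule ennreal_mult) auto
    moreover have "real n powr (- 1 - \<epsilon>) = real n powr (- \<epsilon>) * (1 / n)"
      using assms by (simp add: powr_minus_one_minus)
    ultimately show ?thesis by (simp only: mult.assoc)
  qed
  finally show ?thesis .
qed

lemma dilated_L2:
  assumes "0 < \<alpha>" "K < \<alpha> * real n"
  shows "(\<integral>\<^sup>+a\<in>{\<alpha>..\<beta>}. ennreal ((cmod (f (a * real n)))\<^sup>2) \<partial>lborel)
    \<le> ennreal (\<alpha> powr (- \<epsilon>) * real n powr (- 1 - \<epsilon>)) * mass"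
proof -
  let ?w = "\<lambda>x. ennreal (x powr \<epsilon> * (cmod (f x))\<^sup>2) * indicator {K<..} x"
  have n: "n \<ge> 1" using assms K by (cases n) auto
  have "(\<integral>\<^sup>+a\<in>{\<alpha>..\<beta>}. ennreal ((cmod (f (a * real n)))\<^sup>2) \<partial>lborel)
      \<le> (\<integral>\<^sup>+a. ennreal ((\<alpha> * real n) powr (- \<epsilon>)) * ?w (a * real n) \<partial>lborel)"
  proof (intro nn_integral_mono)
    fix a
    show "ennreal ((cmod (f (a * real n)))\<^sup>2) * indicator {\<alpha>..\<beta>} a
        \<le> ennreal ((\<alpha> * real n) powr (- \<epsilon>)) * ?w (a * real n)"
    proof (cases "a \<ge> \<alpha>")
      case True
      have le: "\<alpha> * real n \<le> a * real n" using True by (intro mult_right_mono) auto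
      have "1 * (cmod (f (a * real n)))\<^sup>2
          \<le> ((\<alpha> * real n) powr (- \<epsilon>) * (a * real n) powr \<epsilon>) * (cmod (f (a * real n)))\<^sup>2"
      proof (intro mult_right_mono)
        have "(\<alpha> * real n) powr \<epsilon> \<le> (a * real n) powr \<epsilon>" using le assms eps by (intro powr_mono2) auto
        moreover have "0 < (\<alpha> * real n) powr \<epsilon>" using assms n by simp
        ultimately show "1 \<le> (\<alpha> * real n) powr (- \<epsilon>) * (a * real n) powr \<epsilon>"
          using mult_left_mono[of "(\<alpha> * real n) powr \<epsilon>" "(a * real n) powr \<epsilon>" "inverse ((\<alpha> * real n) powr \<epsilon>)"]
          unfolding powr_minus by simp
      qed auto
      then have "ennreal ((cmod (f (a * real n)))\<^sup>2)
          \<le> ennreal ((\<alpha> * real n) powr (- \<epsilon>) * ((a * real n) powr \<epsilon> * (cmod (f (a * real n)))\<^sup>2))"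
        by (intro ennreal_leI) (simp only: mult_1 mult.assoc)
      also have "\<dots> = ennreal ((\<alpha> * real n) powr (- \<epsilon>)) * ?w (a * real n)"
        using le assms(2) by (subst ennreal_mult) (auto simp: indicator_def)
      finally show ?thesis by (auto simp: indicator_def)
    qed simp
  qed
  also have "\<dots> = ennreal ((\<alpha> * real n) powr (- \<epsilon>)) * (\<integral>\<^sup>+a. ?w (a * real n) \<partial>lborel)"
    by (rule nn_integral_cmult) measurable
  also have "\<dots> = ennreal ((\<alpha> * real n) powr (- \<epsilon>)) * (ennreal (1 / n) * mass)"
    using n unfolding mass_def by (subst nn_integral_scale) auto
  also have "\<dots> = ennreal (\<alpha> powr (- \<epsilon>) * real n powr (- 1 - \<epsilon>)) * mass"
  proof -
    have "\<alpha> powr (- \<epsilon>) * real n powr (- 1 - \<epsilon>) = (\<alpha> * real n) powr (- \<epsilon>) * (1 / n)"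
      using n assms by (simp add: powr_minus_one_minus powr_mult)
    moreover have "ennreal ((\<alpha> * real n) powr (- \<epsilon>) * (1 / n)) = ennreal ((\<alpha> * real n) powr (- \<epsilon>)) * ennreal (1 / n)"
      by (rule ennreal_mult) auto
    ultimately show ?thesis by (simp only: mult.assoc)
  qed
  finally show ?thesis .
qed

text \<open>The series of the matrix coefficient need not converge absolutely, and pointwise convergence of
  all its partial sums is a delicate question. It is therefore summed in dyadic blocks, whose \<open>L\<^sup>2\<close>
  norms decay geometrically.\<close>

definition block :: "nat \<Rightarrow> real \<times> real \<Rightarrow> complex" where
  "block k x = (\<Sum>n\<in>{2 ^ k..<2 ^ Suc k}. d n * orbit_term f n x)"

definition coefficient :: "real \<times> real \<Rightarrow> complex" where
  "coefficient x = (\<Sum>k. block k x)"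

lemma block_measurable [measurable]: "block k \<in> borel_measurable borel"
  unfolding block_def[abs_def]
  by (intro borel_measurable_sum borel_measurable_times borel_measurable_const orbit_term_measurable f_meas)

lemma coefficient_measurable [measurable]: "coefficient \<in> borel_measurable borel"
  unfolding coefficient_def[abs_def] by measurable

lemma block_section: "block k (a, t) =
    (\<Sum>n\<in>{2 ^ k..<2 ^ Suc k}. (d n * of_real (a powr (1 / 2)) * f (a * real n)) * tchar n t)"
  by (simp add: block_def orbit_term_def mult_ac)

lemma sum_block: "(\<Sum>k<M. block k x) = (\<Sum>n<2 ^ M. d n * orbit_term f n x)"
proof (induction M)
  case 0
  then show ?case by (simp add: orbit_term_def case_prod_unfold f_0)
next
  case (Suc M)
  have "(\<Sum>n<2 ^ Suc M. d n * orbit_term f n x)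
      = (\<Sum>n<2 ^ M. d n * orbit_term f n x) + block M x"
    unfolding block_def lessThan_atLeast0
    by (rule sum.atLeastLessThan_concat[symmetric]) auto
  then show ?case using Suc by simp
qed

lemma orbit_term_integrable_on_box:
  assumes "0 < \<alpha>" "0 < n"
  shows "(\<integral>\<^sup>+x\<in>{\<alpha>..\<beta>} \<times> {p..q}. ennreal (cmod (orbit_term f n x)) \<partial>lborel) < \<infinity>"
proof -
  have [measurable]: "orbit_term f n \<in> borel_measurable borel" by (rule orbit_term_measurable[OF f_meas])
  let ?h = "\<lambda>x. ennreal (indicator {\<alpha> * n..\<beta> * n} x * cmod (f x))"
  have "(\<integral>\<^sup>+x\<in>{\<alpha>..\<beta>} \<times> {p..q}. ennreal (cmod (orbit_term f n x)) \<partial>lborel)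
      = (\<integral>\<^sup>+a\<in>{\<alpha>..\<beta>}. (\<integral>\<^sup>+t\<in>{p..q}. ennreal (cmod (orbit_term f n (a, t))) \<partial>lborel) \<partial>lborel)"
    by (rule nn_integral_box) measurable
  also have "\<dots> \<le> (\<integral>\<^sup>+a. ennreal (\<bar>\<beta>\<bar> powr (1 / 2)) * emeasure lborel {p..q} * ?h (a * n) \<partial>lborel)"
  proof (intro nn_integral_mono)
    fix a
    have "(\<integral>\<^sup>+t\<in>{p..q}. ennreal (cmod (orbit_term f n (a, t))) \<partial>lborel)
        = ennreal (a powr (1 / 2) * cmod (f (a * n))) * emeasure lborel {p..q}"
      by (simp add: orbit_term_def norm_mult nn_integral_cmult_indicator)
    moreover have "ennreal (a powr (1 / 2) * cmod (f (a * n))) \<le> ennreal (\<bar>\<beta>\<bar> powr (1 / 2)) * ?h (a * n)"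
      if "a \<in> {\<alpha>..\<beta>}"
      using that assms by (auto simp: ennreal_mult[symmetric] indicator_def intro!: ennreal_leI mult_right_mono powr_mono2)
    ultimately show "(\<integral>\<^sup>+t\<in>{p..q}. ennreal (cmod (orbit_term f n (a, t))) \<partial>lborel) * indicator {\<alpha>..\<beta>} a
        \<le> ennreal (\<bar>\<beta>\<bar> powr (1 / 2)) * emeasure lborel {p..q} * ?h (a * n)"
      by (auto simp: indicator_def mult_ac intro: mult_left_mono)
  qed
  also have "\<dots> = ennreal (\<bar>\<beta>\<bar> powr (1 / 2)) * emeasure lborel {p..q} * (ennreal (1 / n) * (\<integral>\<^sup>+x. ?h x \<partial>lborel))"
    using assms(2) nn_integral_scale[of ?h n] by (subst nn_integral_cmult) auto
  also have "\<dots> < \<infinity>"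
  proof -
    have "0 < \<alpha> * n" using assms by simp
    from f_int[OF this, of "\<beta> * n"]
    have "(\<integral>\<^sup>+x. ?h x \<partial>lborel) < \<infinity>"
      unfolding set_integrable_def integrable_iff_bounded by simp
    moreover have "emeasure lborel {p..q} < \<infinity>" by (simp add: emeasure_lborel_Icc_eq)
    ultimately show ?thesis by (auto simp: ennreal_mult_less_top)
  qed
  finally show ?thesis .
qed

lemma block_integrable_on_box:
  assumes "0 < \<alpha>"
  shows "set_integrable lborel ({\<alpha>..\<beta>} \<times> {p..q}) (block k)"
  unfolding block_def[abs_def] set_integrable_def scaleR_sum_right
proof (rule Bochner_Integration.integrable_sum)
  fix n :: nat assume "n \<in> {2 ^ k..<2 ^ Suc k}"
  moreover have "(0::nat) < 2 ^ k" by simp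
  ultimately have n: "0 < n" by (auto simp only: atLeastLessThan_iff)
  have [measurable]: "orbit_term f n \<in> borel_measurable borel" by (rule orbit_term_measurable[OF f_meas])
  let ?Q = "{\<alpha>..\<beta>} \<times> {p..q}"
  have Q [measurable]: "?Q \<in> sets borel" by (intro borel_closed closed_Times) auto
  have "integrable lborel (\<lambda>x. indicator ?Q x *\<^sub>R orbit_term f n x)"
    unfolding integrable_iff_bounded
  proof
    have "(\<integral>\<^sup>+x. ennreal (norm (indicator ?Q x *\<^sub>R orbit_term f n x)) \<partial>lborel)
        = (\<integral>\<^sup>+x\<in>?Q. ennreal (cmod (orbit_term f n x)) \<partial>lborel)"
      by (intro nn_integral_cong) (auto simp: indicator_def)
    then show "(\<integral>\<^sup>+x. ennreal (norm (indicator ?Q x *\<^sub>R orbit_term f n x)) \<partial>lborel) < \<infinity>"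
      using orbit_term_integrable_on_box[OF assms n, of \<beta> p q] by simp
  qed (use Q in measurable)
  then have "set_integrable lborel ?Q (\<lambda>x. d n * orbit_term f n x)"
    by (intro set_integrable_mult_right) (simp add: set_integrable_def)
  then show "integrable lborel (\<lambda>x. indicator ?Q x *\<^sub>R (d n * orbit_term f n x))"
    by (simp add: set_integrable_def)
qed

text \<open>The decay rate of the dyadic blocks: with half of the exponent \<open>\<epsilon>\<close> given away to the growth
  of \<open>|d\<^sub>n|\<^sup>2\<close>, the square of the \<open>L\<^sup>2\<close> norm of block \<open>k\<close> is at most a constant times
  \<open>ratio\<^sup>2\<^sup>k = 2\<^sup>-\<^sup>k\<^sup>\<epsilon>\<^sup>/\<^sup>2\<close>.\<close>

definition ratio :: real where "ratio = 2 powr (- \<epsilon> / 4)"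

lemma ratio: "0 < ratio" "ratio < 1"
  using eps by (auto simp: ratio_def intro: powr_less_one)

lemma sum_block_weights:
  "(\<Sum>n\<in>{2 ^ k..<2 ^ Suc k}. real n powr (- 1 - \<epsilon> / 2)) \<le> ratio ^ k * ratio ^ k"
proof -
  have "(\<Sum>n\<in>{2 ^ k..<2 ^ Suc k}. real n powr (- 1 - \<epsilon> / 2))
      \<le> (\<Sum>n\<in>{2 ^ k..<2 ^ Suc k :: nat}. (2 ^ k) powr (- 1 - \<epsilon> / 2))"
  proof (rule sum_mono)
    fix n :: nat assume "n \<in> {2 ^ k..<2 ^ Suc k}"
    then have "(2::real) ^ k \<le> real n" by (metis atLeastLessThan_iff numeral_power_le_of_nat_cancel_iff)
    then show "real n powr (- 1 - \<epsilon> / 2) \<le> (2 ^ k) powr (- 1 - \<epsilon> / 2)"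
      using eps by (intro powr_mono2') auto
  qed
  also have "\<dots> = (2 powr k) * (2 powr k) powr (- 1 - \<epsilon> / 2)"
    by (simp add: powr_realpow)
  also have "\<dots> = ratio ^ k * ratio ^ k"
  proof -
    have "ratio ^ k = 2 powr (real k * (- \<epsilon> / 4))" unfolding ratio_def by (rule powr_power) simp
    then show ?thesis
      by (simp only: powr_powr powr_add[symmetric]) (intro arg_cong[where f="\<lambda>x. 2 powr x"], simp add: field_simps)
  qed
  finally show ?thesis .
qed

text \<open>Parseval in \<open>t\<close> removes the cross terms, and \<open>\<alpha> 2\<^sup>k > K\<close> puts all points \<open>an\<close> of the block into
  the range where \<open>f\<close> is square integrable.\<close>

lemma block_L2_on_box:
  assumes "0 < \<alpha>" "0 < \<beta>" "0 < N"
  shows "\<exists>W\<ge>0. \<forall>k. K < \<alpha> * 2 ^ k \<longrightarrow>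
    (\<integral>\<^sup>+x\<in>{\<alpha>..\<beta>} \<times> {- real N..real N}. ennreal ((cmod (block k x))\<^sup>2) \<partial>lborel)
      \<le> ennreal (W * (ratio ^ k * ratio ^ k))"
proof -
  obtain C where C: "C > 0" "\<And>n. n \<ge> 1 \<Longrightarrow> (cmod (d n))\<^sup>2 \<le> C * real n powr (\<epsilon> / 2)"
    using d_square_bound by blast
  obtain J where J: "mass = ennreal J" "J \<ge> 0"
    using f_L2 unfolding mass_def[symmetric] by (cases mass) auto
  define c where "c = real (2 * N) * \<beta> * C"
  have c0: "c \<ge> 0" using assms C by (simp add: c_def)
  let ?W = "c * (\<alpha> powr (- \<epsilon>) * J)"
  have "(\<integral>\<^sup>+x\<in>{\<alpha>..\<beta>} \<times> {- real N..real N}. ennreal ((cmod (block k x))\<^sup>2) \<partial>lborel)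
      \<le> ennreal (?W * (ratio ^ k * ratio ^ k))" if k: "K < \<alpha> * 2 ^ k" for k
  proof -
    let ?B = "{2 ^ k..<2 ^ Suc k} :: nat set"
    have nB: "1 \<le> n" "K < \<alpha> * real n" if "n \<in> ?B" for n
    proof -
      have "(2::real) ^ k \<le> real n" using that by (metis atLeastLessThan_iff numeral_power_le_of_nat_cancel_iff)
      then have "\<alpha> * 2 ^ k \<le> \<alpha> * real n" using assms(1) by simp
      then show "K < \<alpha> * real n" using k by simp
      then show "1 \<le> n" using K assms(1) by (cases n) auto
    qed
    have int_eq: "- real N + real (2 * N) = real N" by simp
    have sec: "(\<integral>\<^sup>+t\<in>{- real N..real N}. ennreal ((cmod (block k (a, t)))\<^sup>2) \<partial>lborel)
        \<le> (\<Sum>n\<in>?B. ennreal (c * real n powr (\<epsilon> / 2)) * ennreal ((cmod (f (a * real n)))\<^sup>2))"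
      if a: "a \<in> {\<alpha>..\<beta>}" for a
    proof -
      have "(\<integral>\<^sup>+t\<in>{- real N..real N}. ennreal ((cmod (block k (a, t)))\<^sup>2) \<partial>lborel)
          = ennreal (real (2 * N) * (\<Sum>n\<in>?B. (cmod (d n * of_real (a powr (1 / 2)) * f (a * real n)))\<^sup>2))"
        unfolding block_section using tchar_parseval[where A="?B" and p="- real N" and L="2 * N"] unfolding int_eq by simp
      also have "\<dots> = ennreal (\<Sum>n\<in>?B. real (2 * N) * ((cmod (d n))\<^sup>2 * a) * (cmod (f (a * real n)))\<^sup>2)"
        using a assms by (simp add: norm_mult power_mult_distrib sum_distrib_left mult_ac
            power2_eq_square[of "a powr (1 / 2)"] flip: powr_add)
      also have "\<dots> \<le> ennreal (\<Sum>n\<in>?B. (c * real n powr (\<epsilon> / 2)) * (cmod (f (a * real n)))\<^sup>2)"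
      proof (intro ennreal_leI sum_mono mult_right_mono)
        fix n assume "n \<in> ?B"
        then have "(cmod (d n))\<^sup>2 * a \<le> (C * real n powr (\<epsilon> / 2)) * \<beta>"
          using a assms C nB by (intro mult_mono) auto
        then have "real (2 * N) * ((cmod (d n))\<^sup>2 * a) \<le> real (2 * N) * ((C * real n powr (\<epsilon> / 2)) * \<beta>)"
          by (intro mult_left_mono) auto
        then show "real (2 * N) * ((cmod (d n))\<^sup>2 * a) \<le> c * real n powr (\<epsilon> / 2)"
          by (simp add: c_def mult_ac)
      qed auto
      also have "\<dots> = (\<Sum>n\<in>?B. ennreal (c * real n powr (\<epsilon> / 2)) * ennreal ((cmod (f (a * real n)))\<^sup>2))"
        using c0 by (subst sum_ennreal[symmetric]) (auto simp: ennreal_mult)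
      finally show ?thesis .
    qed
    have "(\<integral>\<^sup>+x\<in>{\<alpha>..\<beta>} \<times> {- real N..real N}. ennreal ((cmod (block k x))\<^sup>2) \<partial>lborel)
        = (\<integral>\<^sup>+a\<in>{\<alpha>..\<beta>}. (\<integral>\<^sup>+t\<in>{- real N..real N}. ennreal ((cmod (block k (a, t)))\<^sup>2) \<partial>lborel) \<partial>lborel)"
      by (rule nn_integral_box) measurable
    also have "\<dots> \<le> (\<integral>\<^sup>+a. (\<Sum>n\<in>?B. ennreal (c * real n powr (\<epsilon> / 2)) *
        (ennreal ((cmod (f (a * real n)))\<^sup>2) * indicator {\<alpha>..\<beta>} a)) \<partial>lborel)"
      using sec by (intro nn_integral_mono) (auto simp: indicator_def)
    also have "\<dots> = (\<Sum>n\<in>?B. \<integral>\<^sup>+a. ennreal (c * real n powr (\<epsilon> / 2)) *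
        (ennreal ((cmod (f (a * real n)))\<^sup>2) * indicator {\<alpha>..\<beta>} a) \<partial>lborel)"
      by (rule nn_integral_sum) measurable
    also have "\<dots> = (\<Sum>n\<in>?B. ennreal (c * real n powr (\<epsilon> / 2)) *
        (\<integral>\<^sup>+a\<in>{\<alpha>..\<beta>}. ennreal ((cmod (f (a * real n)))\<^sup>2) \<partial>lborel))"
      by (intro sum.cong refl nn_integral_cmult) measurable
    also have "\<dots> \<le> (\<Sum>n\<in>?B. ennreal (c * real n powr (\<epsilon> / 2)) *
        (ennreal (\<alpha> powr (- \<epsilon>) * real n powr (- 1 - \<epsilon>)) * ennreal J))"
      unfolding J(1)[symmetric] by (intro sum_mono mult_left_mono dilated_L2 assms nB) auto
    also have "\<dots> = ennreal (\<Sum>n\<in>?B. ?W * real n powr (- 1 - \<epsilon> / 2))"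
    proof (subst sum_ennreal[symmetric])
      show "(\<Sum>n\<in>?B. ennreal (c * real n powr (\<epsilon> / 2)) *
        (ennreal (\<alpha> powr (- \<epsilon>) * real n powr (- 1 - \<epsilon>)) * ennreal J))
        = (\<Sum>n\<in>?B. ennreal (?W * real n powr (- 1 - \<epsilon> / 2)))"
      proof (rule sum.cong[OF refl])
        fix n
        have "real n powr (- 1 - \<epsilon> / 2) = real n powr (\<epsilon> / 2) * real n powr (- 1 - \<epsilon>)"
        proof -
          have "\<epsilon> / 2 + (- 1 - \<epsilon>) = - 1 - \<epsilon> / 2" by simp
          then show ?thesis unfolding powr_add[symmetric] by (simp only:)
        qed
        then show "ennreal (c * real n powr (\<epsilon> / 2)) *
            (ennreal (\<alpha> powr (- \<epsilon>) * real n powr (- 1 - \<epsilon>)) * ennreal J)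
            = ennreal (?W * real n powr (- 1 - \<epsilon> / 2))"
          using c0 J(2) by (simp add: ennreal_mult[symmetric] mult_ac)
      qed
    qed (use c0 J(2) in auto)
    also have "\<dots> \<le> ennreal (?W * (ratio ^ k * ratio ^ k))"
      unfolding sum_distrib_left[symmetric] using c0 J(2)
      by (intro ennreal_leI mult_left_mono sum_block_weights) auto
    finally show ?thesis .
  qed
  then show ?thesis using c0 J(2) by (intro exI[of _ ?W]) auto
qed

lemma le_add_square_divide:
  fixes c l :: real
  assumes "l > 0" shows "c \<le> l + 1 / l * c\<^sup>2"
proof -
  have "0 \<le> (l - c / 2)\<^sup>2 + 3 / 4 * c\<^sup>2" by simp
  then have "c * l \<le> l * l + c\<^sup>2" by (simp add: power2_eq_square algebra_simps)
  also have "\<dots> = (l + 1 / l * c\<^sup>2) * l" using assms by (simp add: distrib_right)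
  finally have "c * l \<le> (l + 1 / l * c\<^sup>2) * l" .
  then show ?thesis using assms by (simp only: mult_le_cancel_right_pos)
qed

text \<open>The inequality \<open>c \<le> l + c\<^sup>2 / l\<close> with \<open>l\<close> the expected size \<open>ratio\<^sup>k\<close> of the block passes from
  square means to means. The finitely many blocks with \<open>\<alpha> 2\<^sup>k \<le> K\<close>, in which \<open>f\<close> may fail to be
  square integrable, contribute finite means since \<open>f\<close> is locally integrable.\<close>

lemma block_L1_on_box:
  assumes "0 < \<alpha>" "\<alpha> < \<beta>" "0 < N"
  shows "summable (\<lambda>k. LINT x:{\<alpha>..\<beta>} \<times> {- real N..real N}|lborel. cmod (block k x))"
proof -
  let ?Q = "{\<alpha>..\<beta>} \<times> {- real N..real N}"
  have Q: "?Q \<in> sets borel" by (intro borel_closed closed_Times) auto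
  obtain V where V: "emeasure lborel ?Q = ennreal V" "V \<ge> 0"
  proof -
    have "emeasure lborel ?Q = emeasure lborel {\<alpha>..\<beta>} * emeasure lborel {- real N..real N}"
      unfolding lborel_prod[symmetric] by (rule lborel.emeasure_pair_measure_Times) auto
    also have "\<dots> = ennreal ((\<beta> - \<alpha>) * (2 * real N))"
      using assms by (subst ennreal_mult) auto
    finally show ?thesis using that assms by simp
  qed
  obtain W where W: "W \<ge> 0" "\<And>k. K < \<alpha> * 2 ^ k \<Longrightarrow>
      (\<integral>\<^sup>+x\<in>?Q. ennreal ((cmod (block k x))\<^sup>2) \<partial>lborel) \<le> ennreal (W * (ratio ^ k * ratio ^ k))"
    using block_L2_on_box[of \<alpha> \<beta> N] assms by auto
  obtain k0 where "K / \<alpha> < 2 ^ k0" using real_arch_pow[of 2 "K / \<alpha>"] by auto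
  then have k0: "K < \<alpha> * 2 ^ k" if "k \<ge> k0" for k
  proof -
    have "K < \<alpha> * 2 ^ k0" using \<open>K / \<alpha> < _\<close> assms(1) by (simp add: field_simps)
    also have "\<dots> \<le> \<alpha> * 2 ^ k" using that assms(1) by (intro mult_left_mono power_increasing) auto
    finally show ?thesis .
  qed
  have bound: "(LINT x:?Q|lborel. cmod (block k x)) \<le> (V + W) * ratio ^ k" if "k \<ge> k0" for k
  proof -
    let ?l = "ratio ^ k"
    have l: "?l > 0" using ratio by simp
    have "ennreal (LINT x:?Q|lborel. cmod (block k x)) = (\<integral>\<^sup>+x\<in>?Q. ennreal (cmod (block k x)) \<partial>lborel)"
      by (rule ennreal_set_integral_norm[OF block_integrable_on_box[OF assms(1)]])
    also have "\<dots> \<le> (\<integral>\<^sup>+x. ennreal ?l * indicator ?Q x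
        + ennreal (1 / ?l) * (ennreal ((cmod (block k x))\<^sup>2) * indicator ?Q x) \<partial>lborel)"
    proof (intro nn_integral_mono)
      fix x
      have "ennreal (cmod (block k x)) \<le> ennreal (?l + 1 / ?l * (cmod (block k x))\<^sup>2)"
        by (intro ennreal_leI le_add_square_divide l)
      also have "\<dots> = ennreal ?l + ennreal (1 / ?l) * ennreal ((cmod (block k x))\<^sup>2)"
      proof -
        have "ennreal (1 / ?l * (cmod (block k x))\<^sup>2) = ennreal (1 / ?l) * ennreal ((cmod (block k x))\<^sup>2)"
          by (rule ennreal_mult) (use l in auto)
        then show ?thesis using l by (subst ennreal_plus) auto
      qed
      finally show "ennreal (cmod (block k x)) * indicator ?Q x \<le> ennreal ?l * indicator ?Q x
        + ennreal (1 / ?l) * (ennreal ((cmod (block k x))\<^sup>2) * indicator ?Q x)"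
        by (auto simp: indicator_def)
    qed
    also have "\<dots> = ennreal ?l * ennreal V
        + ennreal (1 / ?l) * (\<integral>\<^sup>+x\<in>?Q. ennreal ((cmod (block k x))\<^sup>2) \<partial>lborel)"
    proof -
      have "(\<lambda>x. ennreal ((cmod (block k x))\<^sup>2) * indicator ?Q x) \<in> borel_measurable lborel"
        using Q by (intro borel_measurable_times_ennreal borel_measurable_indicator) auto
      then show ?thesis using Q V
        by (subst nn_integral_add) (auto simp: nn_integral_cmult nn_integral_cmult_indicator)
    qed
    also have "\<dots> \<le> ennreal ?l * ennreal V + ennreal (1 / ?l) * ennreal (W * (?l * ?l))"
      using W(2)[OF k0[OF that]] by (intro add_mono mult_left_mono) auto
    also have "\<dots> = ennreal ((V + W) * ?l)"
      using V(2) W(1) l by (simp add: ennreal_mult[symmetric] ennreal_plus[symmetric] algebra_simps del: ennreal_plus)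
    finally show ?thesis
      using V(2) W(1) l by (subst (asm) ennreal_le_iff) auto
  qed
  show ?thesis
  proof (rule summable_comparison_test'[of "\<lambda>k. (V + W) * ratio ^ k" k0])
    show "summable (\<lambda>k. (V + W) * ratio ^ k)" using ratio by (intro summable_mult summable_geometric) auto
    show "norm (LINT x:?Q|lborel. cmod (block k x)) \<le> (V + W) * ratio ^ k" if "k \<ge> k0" for k
    proof -
      have "0 \<le> (LINT x:?Q|lborel. cmod (block k x))"
        unfolding set_lebesgue_integral_def by (intro Bochner_Integration.integral_nonneg) auto
      then show ?thesis using bound[OF that] by simp
    qed
  qed
qed

lemma sum_nn_block_on_box:
  assumes "0 < \<alpha>" "\<alpha> < \<beta>" "0 < N"
  shows "(\<integral>\<^sup>+x\<in>{\<alpha>..\<beta>} \<times> {- real N..real N}. (\<Sum>k. ennreal (cmod (block k x))) \<partial>lborel) < \<infinity>"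
proof -
  let ?Q = "{\<alpha>..\<beta>} \<times> {- real N..real N}"
  have Q: "?Q \<in> sets borel" by (intro borel_closed closed_Times) auto
  have "(\<integral>\<^sup>+x\<in>?Q. (\<Sum>k. ennreal (cmod (block k x))) \<partial>lborel)
      = (\<integral>\<^sup>+x. (\<Sum>k. ennreal (cmod (block k x)) * indicator ?Q x) \<partial>lborel)"
    by simp
  also have "\<dots> = (\<Sum>k. \<integral>\<^sup>+x\<in>?Q. ennreal (cmod (block k x)) \<partial>lborel)"
    using Q by (intro nn_integral_suminf borel_measurable_times_ennreal borel_measurable_indicator) auto
  also have "\<dots> = (\<Sum>k. ennreal (LINT x:?Q|lborel. cmod (block k x)))"
    by (simp only: ennreal_set_integral_norm[OF block_integrable_on_box[OF assms(1)]])
  also have "\<dots> < \<infinity>"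
  proof -
    have "0 \<le> (LINT x:?Q|lborel. cmod (block k x))" for k
      unfolding set_lebesgue_integral_def by (intro Bochner_Integration.integral_nonneg) auto
    then show ?thesis
      using block_L1_on_box[OF assms] ennreal_suminf_neq_top by (simp add: less_top)
  qed
  finally show ?thesis .
qed

lemma AE_summable_block:
  assumes "0 < \<alpha>" "\<alpha> < \<beta>" "0 < N"
  shows "AE x in lborel. x \<in> {\<alpha>..\<beta>} \<times> {- real N..real N} \<longrightarrow> summable (\<lambda>k. cmod (block k x))"
proof -
  let ?Q = "{\<alpha>..\<beta>} \<times> {- real N..real N}"
  have Q: "?Q \<in> sets borel" by (intro borel_closed closed_Times) auto
  have "AE x in lborel. (\<Sum>k. ennreal (cmod (block k x))) * indicator ?Q x \<noteq> \<infinity>"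
    using sum_nn_block_on_box[OF assms] Q
    by (intro nn_integral_PInf_AE borel_measurable_times_ennreal borel_measurable_indicator) auto
  then show ?thesis
    by eventually_elim (auto intro: summable_suminf_not_top)
qed

text \<open>Convergence of the series of blocks against a bounded multiplier supported in a box. It is used
  twice: with the Haar density on a compact set it gives local integrability, and with the Haar
  density times a test function it gives the values of the matrix coefficient.\<close>

lemma
  assumes box: "0 < \<alpha>" "\<alpha> < \<beta>" "0 < N"
    and w [measurable]: "w \<in> borel_measurable borel" and wb: "\<And>x. cmod (w x) \<le> B"
    and ws: "\<And>x. x \<notin> {\<alpha>..\<beta>} \<times> {- real N..real N} \<Longrightarrow> w x = 0"
  shows integrable_mult_coefficient: "integrable lborel (\<lambda>x. w x * coefficient x)"
    and sums_mult_coefficient: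
      "(\<lambda>k. LINT x|lborel. w x * block k x) sums (LINT x|lborel. w x * coefficient x)"
    and integrable_mult_block: "integrable lborel (\<lambda>x. w x * block k x)"
proof -
  let ?Q = "{\<alpha>..\<beta>} \<times> {- real N..real N}"
  have B: "B \<ge> 0" using wb[of undefined] norm_ge_zero order_trans by blast
  have dom: "cmod (w x * block k x) \<le> B * (indicator ?Q x *\<^sub>R cmod (block k x))" for k x
    using wb[of x] ws[of x] by (cases "x \<in> ?Q") (auto simp: norm_mult intro: mult_right_mono)
  have qi: "integrable lborel (\<lambda>x. B * (indicator ?Q x *\<^sub>R cmod (block k x)))" for k
    using set_integrable_norm[OF block_integrable_on_box[OF box(1)]]
    by (intro integrable_mult_right) (simp add: set_integrable_def)
  have i: "integrable lborel (\<lambda>x. w x * block k x)" for k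
    using dom B by (intro Bochner_Integration.integrable_bound[OF qi[of k]]) (auto simp: abs_mult intro!: AE_I2)
  have ae: "AE x in lborel. summable (\<lambda>k. norm (w x * block k x))"
    using AE_summable_block[OF box]
  proof eventually_elim
    case (elim x)
    then show ?case using ws[of x] by (cases "x \<in> ?Q") (auto simp: norm_mult intro: summable_mult)
  qed
  have s: "summable (\<lambda>k. LINT x|lborel. norm (w x * block k x))"
  proof (rule summable_comparison_test'[OF summable_mult[OF block_L1_on_box[OF box], of B], of 0])
    fix k
    have "(LINT x|lborel. norm (w x * block k x)) \<le> (LINT x|lborel. B * (indicator ?Q x *\<^sub>R cmod (block k x)))"
      by (intro integral_mono dom qi integrable_norm i)
    then show "norm (LINT x|lborel. norm (w x * block k x)) \<le> B * (LINT x:?Q|lborel. cmod (block k x))"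
      by (simp add: set_lebesgue_integral_def)
  qed
  have eq: "AE x in lborel. (\<Sum>k. w x * block k x) = w x * coefficient x"
    using AE_summable_block[OF box]
  proof eventually_elim
    case (elim x)
    then show ?case
    proof (cases "x \<in> ?Q")
      case True
      then show ?thesis using elim unfolding coefficient_def
        by (intro suminf_mult) (auto intro: summable_norm_cancel)
    qed (use ws in auto)
  qed
  show "integrable lborel (\<lambda>x. w x * coefficient x)"
    using integrable_suminf[OF i ae s] eq
    by (subst integrable_cong_AE[where g="\<lambda>x. \<Sum>k. w x * block k x"]) (auto elim: eventually_mono)
  show "(\<lambda>k. LINT x|lborel. w x * block k x) sums (LINT x|lborel. w x * coefficient x)"
  proof -
    have "(LINT x|lborel. (\<Sum>k. w x * block k x)) = (LINT x|lborel. w x * coefficient x)"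
      using eq by (intro integral_cong_AE) auto
    then show ?thesis using sums_integral[OF i ae s] by simp
  qed
  show "integrable lborel (\<lambda>x. w x * block k x)" by (rule i)
qed

end

section \<open>The matrix coefficient as a function\<close>

lemma haar_weight_bound:
  assumes "0 < \<alpha>" "x \<in> {\<alpha>..} \<times> UNIV"
  shows "0 \<le> indicator (carrier axb) x * (1 / fst x)" "indicator (carrier axb) x * (1 / fst x) \<le> 1 / \<alpha>"
  using assms by (auto simp: indicator_def frac_le)

lemma haar_weight_measurable:
  "(\<lambda>x::real \<times> real. indicator (carrier axb) x * (1 / fst x)) \<in> borel_measurable borel"
proof -
  have "(fst :: real \<times> real \<Rightarrow> real) \<in> borel_measurable borel"
    by (intro borel_measurable_continuous_onI continuous_intros)
  then show ?thesis using open_carrier_axb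
    by (intro borel_measurable_times borel_measurable_indicator borel_measurable_divide) auto
qed

context coefficient_data
begin

lemma coefficient_locally_integrable: "locally_integrable haar (carrier axb) coefficient"
  unfolding locally_integrable_def
proof (intro allI impI)
  fix S assume S: "compact S \<and> S \<subseteq> carrier axb"
  then obtain \<alpha> \<beta> and N :: nat where b: "0 < \<alpha>" "\<alpha> < \<beta>" "0 < N"
    "\<And>a t. (a, t) \<in> S \<Longrightarrow> \<alpha> \<le> a \<and> a \<le> \<beta> \<and> \<bar>t\<bar> < real N"
    using compact_carrier_axb_box by metis
  have Sm: "S \<in> sets borel" using S by (simp add: borel_compact)
  define w where "w x = complex_of_real ((indicator (carrier axb) x * (1 / fst x)) * indicator S x)" for x
  have "integrable lborel (\<lambda>x. w x * coefficient x)"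
  proof (rule integrable_mult_coefficient[OF b(1-3)])
    show "w \<in> borel_measurable borel"
      unfolding w_def[abs_def] using Sm
      by (intro measurable_compose[OF borel_measurable_times[OF haar_weight_measurable] borel_measurable_of_real]
          borel_measurable_indicator)
    show "cmod (w x) \<le> 1 / \<alpha>" for x
    proof (cases "x \<in> S")
      case True
      then have "x \<in> {\<alpha>..} \<times> UNIV" using b(4)[of "fst x" "snd x"] by (cases x) auto
      from haar_weight_bound[OF b(1) this] show ?thesis
        using True unfolding w_def norm_of_real by simp
    qed (use b(1) in \<open>simp add: w_def\<close>)
    show "w x = 0" if "x \<notin> {\<alpha>..\<beta>} \<times> {- real N..real N}" for x
    proof -
      have "x \<notin> S" using b(4)[of "fst x" "snd x"] that by (cases x) (auto simp: abs_less_iff)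
      then show ?thesis by (simp add: w_def)
    qed
  qed
  moreover have "(\<lambda>x. indicator S x *\<^sub>R coefficient x) \<in> borel_measurable borel"
    using Sm by (intro borel_measurable_scaleR borel_measurable_indicator) auto
  ultimately show "set_integrable haar S coefficient"
    unfolding set_integrable_def by (subst integrable_haar_iff) (auto simp: w_def scaleR_conv_of_real mult.assoc)
qed

lemma integrable_mult_piece:
  assumes "smearing d \<phi> \<alpha> \<beta> T C"
  shows "integrable lborel (\<lambda>x. f x * smearing.piece d \<phi> T n 0 x)"
proof -
  interpret smearing d \<phi> \<alpha> \<beta> T C by (rule assms)
  show ?thesis
  proof (cases "n = 0")
    case False
    let ?S = "{\<alpha> * n..\<beta> * n}"
    have "0 < \<alpha> * n" using False \<alpha>_pos by simp
    then have fi: "integrable lborel (\<lambda>x. indicator ?S x *\<^sub>R f x)"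
      using f_int by (simp add: set_integrable_def)
    have "compact (piece n 0 ` ?S)" by (intro compact_continuous_image piece_continuous) simp
    then obtain B where B: "\<And>x. x \<in> ?S \<Longrightarrow> cmod (piece n 0 x) \<le> B" "B > 0"
      using compact_imp_bounded bounded_pos by (metis imageI)
    have "cmod (f x * piece n 0 x) \<le> B * cmod (indicator ?S x *\<^sub>R f x)" for x
    proof (cases "x \<in> ?S")
      case True
      then show ?thesis using mult_left_mono[OF B(1)[OF True], of "cmod (f x)"] by (simp add: norm_mult mult.commute)
    next
      case False
      then have "piece n 0 x = 0" using piece_support[of n 0 x] by auto
      then show ?thesis using B(2) by simp
    qed
    moreover have "(\<lambda>x. f x * piece n 0 x) \<in> borel_measurable borel"
      by (intro borel_measurable_times f_meas borel_measurable_continuous_onI piece_continuous)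
    ultimately show ?thesis using B(2)
      by (intro Bochner_Integration.integrable_bound[OF integrable_mult_right[OF integrable_norm[OF fi], of B]])
         (auto simp: abs_mult intro!: AE_I2)
  qed simp
qed

lemma smearing_from_growth:
  assumes "0 < \<alpha>" "0 < T" "box_test \<alpha> \<beta> T \<phi>"
  shows "\<exists>C. smearing d \<phi> \<alpha> \<beta> T C"
proof -
  obtain C where C: "C > 0" "\<And>n. n \<ge> 1 \<Longrightarrow> cmod (d n) \<le> C * real n powr 1"
    using growth[of 1] by auto
  then have "smearing d \<phi> \<alpha> \<beta> T C"
    using assms by unfold_locales auto
  then show ?thesis ..
qed

text \<open>Along \<open>N = 2\<^sup>M\<close> the partial sums of the smeared functional pair with \<open>f\<close> to the integral of \<open>\<phi>\<close>
  against the first \<open>M\<close> blocks.\<close>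

lemma partial_integrals_tendsto:
  assumes bx: "0 < \<alpha>" "\<alpha> < \<beta>" "0 < N" and \<phi>: "box_test \<alpha> \<beta> (real N) \<phi>"
    and sm: "smearing d \<phi> \<alpha> \<beta> (real N) C"
  shows "(\<lambda>M. LINT x|lborel. f x * smearing.partial d \<phi> (real N) (2 ^ M) 0 x)
    \<longlonglongrightarrow> (LINT x|haar. coefficient x * \<phi> x)"
proof -
  interpret smearing d \<phi> \<alpha> \<beta> "real N" C by (rule sm)
  have \<phi>m: "\<phi> \<in> borel_measurable borel" by (rule box_test_measurable[OF \<phi>])
  let ?h = "\<lambda>x::real \<times> real. indicator (carrier axb) x * (1 / fst x)"
  define w where "w x = complex_of_real (?h x) * \<phi> x" for x
  obtain B where B: "B > 0" "\<And>x. cmod (\<phi> x) \<le> B" using box_test_bounded[OF \<phi>] by metis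
  have wm: "w \<in> borel_measurable borel"
    unfolding w_def[abs_def]
    by (intro borel_measurable_times measurable_compose[OF haar_weight_measurable borel_measurable_of_real] \<phi>m)
  have wb: "cmod (w x) \<le> 1 / \<alpha> * B" for x
  proof (cases "\<phi> x = 0")
    case False
    then have "x \<in> {\<alpha>..} \<times> UNIV" using \<phi> by (cases x) (auto simp: box_test_def)
    from haar_weight_bound[OF bx(1) this] have "\<bar>?h x\<bar> \<le> 1 / \<alpha>" by simp
    then show ?thesis unfolding w_def norm_mult norm_of_real using B bx(1) by (intro mult_mono) auto
  qed (use B bx(1) in \<open>simp add: w_def\<close>)
  have ws: "w x = 0" if "x \<notin> {\<alpha>..\<beta>} \<times> {- real N..real N}" for x
  proof -
    have "\<phi> x = 0"
    proof (rule ccontr)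
      assume "\<phi> x \<noteq> 0"
      then have "\<alpha> \<le> fst x \<and> fst x \<le> \<beta> \<and> \<bar>snd x\<bar> \<le> real N - 1"
        using \<phi> unfolding box_test_def by (metis prod.collapse)
      then show False using that by (auto simp: mem_Times_iff abs_le_iff)
    qed
    then show ?thesis by (simp add: w_def)
  qed
  note S = sums_mult_coefficient[OF bx wm wb ws] and I = integrable_mult_block[OF bx wm wb ws]
  have bm: "(\<lambda>x. \<phi> x * block k x) \<in> borel_measurable borel" for k
    using \<phi>m by (intro borel_measurable_times) auto
  have w_eq: "?h x *\<^sub>R (\<phi> x * y) = w x * y" for x y
    by (simp add: w_def scaleR_conv_of_real)
  have bi: "integrable haar (\<lambda>x. \<phi> x * block k x)" for k
    unfolding integrable_haar_iff[OF bm] w_eq by (rule I)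
  have tot: "(LINT x|lborel. w x * coefficient x) = (LINT x|haar. coefficient x * \<phi> x)"
  proof -
    have "(\<lambda>x. \<phi> x * coefficient x) \<in> borel_measurable borel"
      using \<phi>m by (intro borel_measurable_times) auto
    from integral_haar[OF this] show ?thesis unfolding w_eq by (simp add: mult.commute)
  qed
  have oi: "integrable haar (\<lambda>x. \<phi> x * (d n * orbit_term f n x))"
    "(LINT x|haar. \<phi> x * (d n * orbit_term f n x)) = (LINT x|lborel. f x * piece n 0 x)" for n
  proof -
    have "set_integrable lborel {\<alpha> * n..\<beta> * n} f" if "0 < n" using f_int that \<alpha>_pos by simp
    note * = integral_orbit_term_piece[OF f_meas this f_0]
    show "integrable haar (\<lambda>x. \<phi> x * (d n * orbit_term f n x))"
      "(LINT x|haar. \<phi> x * (d n * orbit_term f n x)) = (LINT x|lborel. f x * piece n 0 x)"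
      using * by auto
  qed
  have part: "(\<Sum>k<M. LINT x|lborel. w x * block k x) = (LINT x|lborel. f x * partial (2 ^ M) 0 x)" for M
  proof -
    have "(\<Sum>k<M. LINT x|lborel. w x * block k x) = (\<Sum>k<M. LINT x|haar. \<phi> x * block k x)"
      unfolding integral_haar[OF bm] w_eq ..
    also have "\<dots> = (LINT x|haar. (\<Sum>k<M. \<phi> x * block k x))"
      by (intro Bochner_Integration.integral_sum[symmetric] bi)
    also have "\<dots> = (LINT x|haar. (\<Sum>n<2 ^ M. \<phi> x * (d n * orbit_term f n x)))"
      unfolding sum_distrib_left[symmetric] sum_block ..
    also have "\<dots> = (\<Sum>n<2 ^ M. LINT x|haar. \<phi> x * (d n * orbit_term f n x))"
      by (intro Bochner_Integration.integral_sum oi)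
    also have "\<dots> = (\<Sum>n<2 ^ M. LINT x|lborel. f x * piece n 0 x)" by (simp only: oi(2))
    also have "\<dots> = (LINT x|lborel. (\<Sum>n<2 ^ M. f x * piece n 0 x))"
      by (intro Bochner_Integration.integral_sum[symmetric] integrable_mult_piece[OF sm])
    also have "\<dots> = (LINT x|lborel. f x * partial (2 ^ M) 0 x)"
      by (simp add: partial_def sum_distrib_left)
    finally show ?thesis .
  qed
  show ?thesis using S unfolding sums_def part tot .
qed

lemma extension_at_smeared_eq:
  assumes F: "extends_to f' F"
    and meas: "set_borel_measurable lebesgue {0<..} f'" and ae: "AE x in lebesgue. 0 < x \<longrightarrow> f' x = f x"
    and bx: "0 < \<alpha>" "\<alpha> < \<beta>" "0 < N" and \<phi>: "box_test \<alpha> \<beta> (real N) \<phi>"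
    and sm: "smearing d \<phi> \<alpha> \<beta> (real N) C"
  shows "F (smearing.smeared d \<phi> (real N) 0) = (LINT x|haar. coefficient x * \<phi> x)"
proof -
  interpret smearing d \<phi> \<alpha> \<beta> "real N" C by (rule sm)
  have eq: "(LINT x:{0<..}|lebesgue. f' x * partial M 0 x) = (LINT x|lborel. f x * partial M 0 x)" for M
  proof -
    have pm: "partial M 0 \<in> borel_measurable borel"
      by (intro borel_measurable_continuous_onI deriv_chain_continuous_on[OF partial_chain])
    have m: "(\<lambda>x. f x * partial M 0 x) \<in> borel_measurable lborel" using pm by simp
    have "(LINT x:{0<..}|lebesgue. f' x * partial M 0 x) = (LINT x|lebesgue. f x * partial M 0 x)"
      unfolding set_lebesgue_integral_def
    proof (rule integral_cong_AE)
      have "(\<lambda>x. (indicator {0<..} x *\<^sub>R f' x) * partial M 0 x) \<in> borel_measurable lebesgue"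
        using meas measurable_completion[of "partial M 0" lborel borel] pm
        by (intro borel_measurable_times) (auto simp: set_borel_measurable_def)
      then show "(\<lambda>x. indicator {0<..} x *\<^sub>R (f' x * partial M 0 x)) \<in> borel_measurable lebesgue" by simp
      show "(\<lambda>x. f x * partial M 0 x) \<in> borel_measurable lebesgue" by (rule measurable_completion[OF m])
      show "AE x in lebesgue. indicator {0<..} x *\<^sub>R (f' x * partial M 0 x) = f x * partial M 0 x"
        using ae by eventually_elim (auto simp: indicator_def f_0)
    qed
    then show ?thesis using integral_completion[OF m] by simp
  qed
  have "(\<lambda>M. LINT x|lborel. f x * partial (2 ^ M) 0 x) \<longlonglongrightarrow> F (smeared 0)"
    using LIMSEQ_subseq_LIMSEQ[OF extension_at_smeared[OF F], of "\<lambda>M. 2 ^ M"]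
    unfolding eq by (simp add: o_def strict_mono_def)
  then show ?thesis
    using LIMSEQ_unique partial_integrals_tendsto[OF bx \<phi> sm] by blast
qed

section \<open>Fourier analysis in the variable \<open>t\<close>\<close>

lemma nn_section_measurable:
  fixes w :: "real \<times> real \<Rightarrow> ennreal"
  assumes "w \<in> borel_measurable borel"
  shows "(\<lambda>a. \<integral>\<^sup>+t\<in>{p..q}. w (a, t) \<partial>lborel) \<in> borel_measurable lborel"
proof -
  have "(\<lambda>x. w x * indicator {p..q} (snd x)) \<in> borel_measurable borel"
    using assms unfolding borel_prod[symmetric] by measurable
  then have "(\<lambda>x. w x * indicator {p..q} (snd x)) \<in> borel_measurable (lborel \<Otimes>\<^sub>M lborel)"
    unfolding lborel_prod by simp
  from lborel.borel_measurable_nn_integral_fst[OF this] show ?thesis by simp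
qed

text \<open>Tonelli's theorem applied to the boxes \<open>{K..K + 1 + m} \<times> {-1..1}\<close>, which exhaust the
  strip over \<open>a > K\<close>.\<close>

lemma AE_section_summable:
  "AE a in lborel. K < a \<longrightarrow> (\<integral>\<^sup>+t\<in>{0..1}. (\<Sum>k. ennreal (cmod (block k (a, t)))) \<partial>lborel) < \<infinity>"
proof -
  let ?w = "\<lambda>x. \<Sum>k. ennreal (cmod (block k x))"
  have wm: "?w \<in> borel_measurable borel" by measurable
  have "AE a in lborel. a \<in> {K..K + 1 + real m} \<longrightarrow> (\<integral>\<^sup>+t\<in>{0..1}. ?w (a, t) \<partial>lborel) < \<infinity>" for m
  proof -
    have "(\<integral>\<^sup>+a\<in>{K..K + 1 + real m}. (\<integral>\<^sup>+t\<in>{- real 1..real 1}. ?w (a, t) \<partial>lborel) \<partial>lborel) < \<infinity>"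
      unfolding nn_integral_box[OF wm, symmetric] using K by (intro sum_nn_block_on_box) auto
    then have "AE a in lborel. (\<integral>\<^sup>+t\<in>{- real 1..real 1}. ?w (a, t) \<partial>lborel) * indicator {K..K + 1 + real m} a \<noteq> \<infinity>"
      by (intro nn_integral_PInf_AE borel_measurable_times_ennreal nn_section_measurable[OF wm]) auto
    then show ?thesis
    proof eventually_elim
      case (elim a)
      show ?case
      proof
        assume "a \<in> {K..K + 1 + real m}"
        then have "(\<integral>\<^sup>+t\<in>{- real 1..real 1}. ?w (a, t) \<partial>lborel) < \<infinity>" using elim by (simp add: less_top)
        moreover have "(\<integral>\<^sup>+t\<in>{0..1}. ?w (a, t) \<partial>lborel) \<le> (\<integral>\<^sup>+t\<in>{- real 1..real 1}. ?w (a, t) \<partial>lborel)"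
          by (rule nn_set_integral_set_mono) auto
        ultimately show "(\<integral>\<^sup>+t\<in>{0..1}. ?w (a, t) \<partial>lborel) < \<infinity>" by simp
      qed
    qed
  qed
  then have "AE a in lborel. \<forall>m. a \<in> {K..K + 1 + real m} \<longrightarrow> (\<integral>\<^sup>+t\<in>{0..1}. ?w (a, t) \<partial>lborel) < \<infinity>"
    unfolding AE_all_countable ..
  then show ?thesis
  proof eventually_elim
    case (elim a)
    obtain m :: nat where "a - K \<le> real m" using real_arch_simple by blast
    then have "K < a \<Longrightarrow> a \<in> {K..K + 1 + real m}" by simp
    then show ?case using elim by blast
  qed
qed

lemma block_section_continuous: "continuous_on A (\<lambda>t. block k (a, t))"
  unfolding block_section by (intro continuous_intros)

lemma block_section_coefficient:
  "(LINT t:{0..1}|lborel. block k (a, t) * cnj (tchar 1 t))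
    = (if k = 0 then d 1 * of_real (a powr (1 / 2)) * f a else 0)"
proof -
  have "1 \<in> {2 ^ k..<2 ^ Suc k :: nat} \<longleftrightarrow> k = 0" 
  proof (cases k)
    case (Suc j)
    then have "(1::nat) < 2 ^ k" by (intro one_less_power) auto
    then show ?thesis using Suc by simp
  qed simp
  then show ?thesis
    using tchar_coefficient[where A="{2 ^ k..<2 ^ Suc k}" and p=0 and L=1 and m=1 and
        c="\<lambda>n. d n * of_real (a powr (1 / 2)) * f (a * real n)"]
    unfolding block_section by simp
qed

text \<open>The section is the sum of its blocks in \<open>L\<^sup>1\<close>, so its first Fourier coefficient is the one of
  the series, and it is at most the \<open>L\<^sup>2\<close> norm by the Cauchy--Schwarz inequality. In the other
  direction the blocks also converge almost everywhere, and Fatou's lemma bounds the \<open>L\<^sup>2\<close> norm of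
  the limit by those of the partial sums, which Parseval computes.\<close>

lemma section_bounds:
  assumes a: "0 < a" and fin: "(\<integral>\<^sup>+t\<in>{0..1}. (\<Sum>k. ennreal (cmod (block k (a, t)))) \<partial>lborel) < \<infinity>"
  shows section_lower: "ennreal ((cmod (d 1))\<^sup>2 * (a * (cmod (f a))\<^sup>2))
      \<le> (\<integral>\<^sup>+t\<in>{0..1}. ennreal ((cmod (coefficient (a, t)))\<^sup>2) \<partial>lborel)" (is ?lower)
    and section_upper: "(\<integral>\<^sup>+t\<in>{0..1}. ennreal ((cmod (coefficient (a, t)))\<^sup>2) \<partial>lborel)
      \<le> (\<Sum>n. ennreal ((cmod (d n))\<^sup>2 * (a * (cmod (f (a * real n)))\<^sup>2)))" (is ?upper)
proof -
  let ?I = "{0..1::real}"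
  have sm [measurable]: "(\<lambda>t. w (a, t)) \<in> borel_measurable borel" if "w \<in> borel_measurable borel"
    for w :: "real \<times> real \<Rightarrow> complex"
    by (rule measurable_compose[OF _ that]) (simp add: borel_prod[symmetric])
  have bm [measurable]: "(\<lambda>t. block k (a, t)) \<in> borel_measurable borel" for k
    by (rule sm) measurable
  have cm [measurable]: "(\<lambda>t. coefficient (a, t)) \<in> borel_measurable borel"
    by (rule sm) measurable
  have bi: "set_integrable lborel ?I (\<lambda>t. block k (a, t))" for k
    by (intro borel_integrable_atLeastAtMost' block_section_continuous)
  note nn_eq = ennreal_set_integral_norm[OF bi]
  have sumint: "summable (\<lambda>k. LINT t:?I|lborel. cmod (block k (a, t)))"
  proof (rule summable_suminf_not_top)
    show "0 \<le> (LINT t:?I|lborel. cmod (block k (a, t)))" for k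
      unfolding set_lebesgue_integral_def by (intro Bochner_Integration.integral_nonneg) auto
    have "(\<Sum>k. ennreal (LINT t:?I|lborel. cmod (block k (a, t))))
        = (\<integral>\<^sup>+t. (\<Sum>k. ennreal (cmod (block k (a, t))) * indicator ?I t) \<partial>lborel)"
      unfolding nn_eq by (intro nn_integral_suminf[symmetric]) measurable
    also have "\<dots> < \<infinity>" using fin by simp
    finally show "(\<Sum>k. ennreal (LINT t:?I|lborel. cmod (block k (a, t)))) \<noteq> Orderings.top" by simp
  qed
  have "AE t in lborel. (\<Sum>k. ennreal (cmod (block k (a, t)))) * indicator ?I t \<noteq> \<infinity>"
    using fin by (intro nn_integral_PInf_AE) auto
  then have ae: "AE t in lborel. t \<in> ?I \<longrightarrow> summable (\<lambda>k. cmod (block k (a, t)))"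
    by eventually_elim (auto intro: summable_suminf_not_top)
  show ?lower
  proof -
    \<comment> \<open>Only block \<open>0\<close> contains the frequency \<open>1\<close>.\<close>
    define g where "g k t = indicator ?I t *\<^sub>R (block k (a, t) * cnj (tchar 1 t))" for k t
    have gi: "integrable lborel (g k)" for k
      unfolding g_def[abs_def]
      by (rule borel_integrable_atLeastAtMost'[unfolded set_integrable_def])
         (intro continuous_intros block_section_continuous)
    have gn: "norm (g k t) = indicator ?I t *\<^sub>R cmod (block k (a, t))" for k t
      by (simp add: g_def norm_mult)
    have gs: "AE t in lborel. summable (\<lambda>k. norm (g k t))"
      using ae by eventually_elim (auto simp: gn indicator_def)
    have gsi: "summable (\<lambda>k. LINT t|lborel. norm (g k t))"
      using sumint by (simp add: gn set_lebesgue_integral_def)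
    have "(\<lambda>k. integral\<^sup>L lborel (g k)) = (\<lambda>k. if k = 0 then d 1 * of_real (a powr (1 / 2)) * f a else 0)"
      using block_section_coefficient unfolding set_lebesgue_integral_def g_def by blast
    then have "(\<lambda>k. integral\<^sup>L lborel (g k)) sums (d 1 * of_real (a powr (1 / 2)) * f a)"
      using sums_single[of 0 "\<lambda>_. d 1 * of_real (a powr (1 / 2)) * f a"] by simp
    then have c1: "d 1 * of_real (a powr (1 / 2)) * f a = (LINT t|lborel. (\<Sum>k. g k t))"
      using sums_integral[OF gi gs gsi] sums_unique2 by blast
    have "ennreal (cmod (d 1 * of_real (a powr (1 / 2)) * f a)) \<le> (\<integral>\<^sup>+t. ennreal (cmod (\<Sum>k. g k t)) \<partial>lborel)"
      unfolding c1 by (rule integral_norm_bound_ennreal[OF integrable_suminf[OF gi gs gsi]])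
    also have "\<dots> = (\<integral>\<^sup>+t. ennreal (cmod (coefficient (a, t))) * indicator ?I t * indicator ?I t \<partial>lborel)"
    proof (rule nn_integral_cong_AE)
      show "AE t in lborel. ennreal (cmod (\<Sum>k. g k t))
          = ennreal (cmod (coefficient (a, t))) * indicator ?I t * indicator ?I t"
        using ae
      proof eventually_elim
        case (elim t)
        show ?case
        proof (cases "t \<in> ?I")
          case True
          then have "(\<Sum>k. g k t) = (\<Sum>k. block k (a, t)) * cnj (tchar 1 t)"
            using elim unfolding g_def
            by (simp add: suminf_mult2[OF summable_norm_cancel, symmetric])
          then show ?thesis using True by (simp add: coefficient_def norm_mult)
        qed (simp add: g_def)
      qed
    qed
    finally have le: "ennreal (cmod (d 1 * of_real (a powr (1 / 2)) * f a))
        \<le> (\<integral>\<^sup>+t. (ennreal (cmod (coefficient (a, t))) * indicator ?I t) * indicator ?I t \<partial>lborel)" .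
    have "ennreal ((cmod (d 1))\<^sup>2 * (a * (cmod (f a))\<^sup>2)) = (ennreal (cmod (d 1 * of_real (a powr (1 / 2)) * f a)))\<^sup>2"
    proof -
      have "(a powr (1 / 2))\<^sup>2 = a" using a by (simp add: power2_eq_square flip: powr_add)
      then show ?thesis by (simp add: ennreal_power norm_mult power_mult_distrib mult.assoc)
    qed
    also have "\<dots> \<le> (\<integral>\<^sup>+t. (ennreal (cmod (coefficient (a, t))) * indicator ?I t) * indicator ?I t \<partial>lborel)\<^sup>2"
      by (intro power_mono le) simp
    also have "\<dots> \<le> (\<integral>\<^sup>+t. (ennreal (cmod (coefficient (a, t))) * indicator ?I t)\<^sup>2 \<partial>lborel)
        * (\<integral>\<^sup>+t. (indicator ?I t)\<^sup>2 \<partial>lborel)"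
      by (rule Cauchy_Schwarz_nn_integral) measurable
    also have "(\<lambda>t. (indicator ?I t :: ennreal)\<^sup>2) = indicator ?I" by (auto simp: indicator_def)
    also have "(\<lambda>t. (ennreal (cmod (coefficient (a, t))) * indicator ?I t)\<^sup>2)
        = (\<lambda>t. ennreal ((cmod (coefficient (a, t)))\<^sup>2) * indicator ?I t)"
      by (auto simp: indicator_def ennreal_power)
    finally show ?thesis by simp
  qed
  show ?upper
  proof -
    let ?S = "\<lambda>M t. \<Sum>k<M. block k (a, t)"
    let ?R = "\<Sum>n. ennreal ((cmod (d n))\<^sup>2 * (a * (cmod (f (a * real n)))\<^sup>2))"
    have part: "(\<integral>\<^sup>+t\<in>?I. ennreal ((cmod (?S M t))\<^sup>2) \<partial>lborel) \<le> ?R" for M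
    proof -
      have "?S M t = (\<Sum>n<2 ^ M. (d n * of_real (a powr (1 / 2)) * f (a * real n)) * tchar n t)" for t
        unfolding sum_block by (simp add: orbit_term_def mult_ac)
      then have "(\<integral>\<^sup>+t\<in>?I. ennreal ((cmod (?S M t))\<^sup>2) \<partial>lborel)
          = ennreal (\<Sum>n<2 ^ M. (cmod (d n * of_real (a powr (1 / 2)) * f (a * real n)))\<^sup>2)"
        using tchar_parseval[where A="{..<2 ^ M}" and p=0 and L=1] by simp
      also have "\<dots> = (\<Sum>n<2 ^ M. ennreal ((cmod (d n))\<^sup>2 * (a * (cmod (f (a * real n)))\<^sup>2)))"
      proof -
        have "(a powr (1 / 2))\<^sup>2 = a" using a by (simp add: power2_eq_square flip: powr_add)
        then show ?thesis using a
          by (subst sum_ennreal) (auto simp: norm_mult power_mult_distrib mult.assoc)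
      qed
      also have "\<dots> \<le> ?R" by (rule sum_le_suminf) auto
      finally show ?thesis .
    qed
    have "(\<integral>\<^sup>+t\<in>?I. ennreal ((cmod (coefficient (a, t)))\<^sup>2) \<partial>lborel)
        = (\<integral>\<^sup>+t. liminf (\<lambda>M. ennreal ((cmod (?S M t))\<^sup>2) * indicator ?I t) \<partial>lborel)"
    proof (rule nn_integral_cong_AE)
      show "AE t in lborel. ennreal ((cmod (coefficient (a, t)))\<^sup>2) * indicator ?I t
          = liminf (\<lambda>M. ennreal ((cmod (?S M t))\<^sup>2) * indicator ?I t)"
        using ae
      proof eventually_elim
        case (elim t)
        show ?case
        proof (cases "t \<in> ?I")
          case True
          then have "(\<lambda>M. ?S M t) \<longlonglongrightarrow> coefficient (a, t)"
            using elim unfolding coefficient_def by (intro summable_LIMSEQ) (auto intro: summable_norm_cancel)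
          then have lim: "(\<lambda>M. ennreal ((cmod (?S M t))\<^sup>2)) \<longlonglongrightarrow> ennreal ((cmod (coefficient (a, t)))\<^sup>2)"
            by (intro tendsto_intros)
          then show ?thesis using True lim_imp_Liminf[OF sequentially_bot lim] by simp
        qed (simp add: Liminf_const)
      qed
    qed
    also have "\<dots> \<le> liminf (\<lambda>M. \<integral>\<^sup>+t\<in>?I. ennreal ((cmod (?S M t))\<^sup>2) \<partial>lborel)"
      by (rule nn_integral_liminf) measurable
    also have "\<dots> \<le> liminf (\<lambda>M. ?R)" using part by (intro Liminf_mono always_eventually) auto
    also have "\<dots> = ?R" by (simp add: Liminf_const)
    finally show ?thesis .
  qed
qed

definition section_mass :: "real \<Rightarrow> ennreal" where
  "section_mass a = (\<integral>\<^sup>+t\<in>{0..1}. ennreal ((cmod (coefficient (a, t)))\<^sup>2) \<partial>lborel)"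

lemma weight_split:
  assumes "0 < a" "0 \<le> c" "0 \<le> y"
  shows "ennreal (c * (a * y)) * ennreal (a powr \<epsilon> / a) = ennreal c * ennreal (a powr \<epsilon> * y)"
  using assms by (simp add: ennreal_mult[symmetric] mult_ac)

theorem coefficient_lower_bound:
  "ennreal ((cmod (d 1))\<^sup>2) * mass
    \<le> (\<integral>\<^sup>+a\<in>{K<..}. section_mass a
          * ennreal (a powr \<epsilon> / a) \<partial>lborel)"
proof -
  have "ennreal ((cmod (d 1))\<^sup>2) * mass
      = (\<integral>\<^sup>+a. ennreal ((cmod (d 1))\<^sup>2) * (ennreal (a powr \<epsilon> * (cmod (f a))\<^sup>2) * indicator {K<..} a) \<partial>lborel)"
    unfolding mass_def by (rule nn_integral_cmult[symmetric]) measurable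
  also have "\<dots> \<le> (\<integral>\<^sup>+a\<in>{K<..}. section_mass a
          * ennreal (a powr \<epsilon> / a) \<partial>lborel)"
  proof (rule nn_integral_mono_AE)
    show "AE a in lborel. ennreal ((cmod (d 1))\<^sup>2) * (ennreal (a powr \<epsilon> * (cmod (f a))\<^sup>2) * indicator {K<..} a)
        \<le> section_mass a * ennreal (a powr \<epsilon> / a) * indicator {K<..} a"
      using AE_section_summable
    proof eventually_elim
      case (elim a)
      show ?case
      proof (cases "K < a")
        case True
        then have a: "0 < a" using K by simp
        have "ennreal ((cmod (d 1))\<^sup>2) * ennreal (a powr \<epsilon> * (cmod (f a))\<^sup>2)
            = ennreal ((cmod (d 1))\<^sup>2 * (a * (cmod (f a))\<^sup>2)) * ennreal (a powr \<epsilon> / a)"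
          by (rule weight_split[OF a, symmetric]) auto
        also have "\<dots> \<le> section_mass a * ennreal (a powr \<epsilon> / a)"
          by (rule mult_right_mono[OF section_lower[folded section_mass_def, OF a mp[OF elim True]]]) simp
        finally show ?thesis using True by simp
      qed simp
    qed
  qed
  finally show ?thesis .
qed

theorem coefficient_upper_bound:
  "(\<integral>\<^sup>+a\<in>{K<..}. section_mass a
          * ennreal (a powr \<epsilon> / a) \<partial>lborel)
    \<le> ennreal (\<Sum>n. (cmod (d n))\<^sup>2 * real n powr (- 1 - \<epsilon>)) * mass"
proof -
  let ?v = "\<lambda>n a. ennreal (a powr \<epsilon> * (cmod (f (a * real n)))\<^sup>2) * indicator {K<..} a"
  have "(\<integral>\<^sup>+a\<in>{K<..}. section_mass a
          * ennreal (a powr \<epsilon> / a) \<partial>lborel)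
      \<le> (\<integral>\<^sup>+a. (\<Sum>n. ennreal ((cmod (d n))\<^sup>2) * ?v n a) \<partial>lborel)"
  proof (rule nn_integral_mono_AE)
    show "AE a in lborel. section_mass a
        * ennreal (a powr \<epsilon> / a) * indicator {K<..} a \<le> (\<Sum>n. ennreal ((cmod (d n))\<^sup>2) * ?v n a)"
      using AE_section_summable
    proof eventually_elim
      case (elim a)
      show ?case
      proof (cases "K < a")
        case True
        then have a: "0 < a" using K by simp
        have "section_mass a * ennreal (a powr \<epsilon> / a)
            \<le> (\<Sum>n. ennreal ((cmod (d n))\<^sup>2 * (a * (cmod (f (a * real n)))\<^sup>2))) * ennreal (a powr \<epsilon> / a)"
          by (rule mult_right_mono[OF section_upper[folded section_mass_def, OF a mp[OF elim True]]]) simp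
        also have "\<dots> = (\<Sum>n. ennreal ((cmod (d n))\<^sup>2 * (a * (cmod (f (a * real n)))\<^sup>2)) * ennreal (a powr \<epsilon> / a))"
          by simp
        also have "\<dots> = (\<Sum>n. ennreal ((cmod (d n))\<^sup>2) * ennreal (a powr \<epsilon> * (cmod (f (a * real n)))\<^sup>2))"
          by (intro suminf_cong weight_split[OF a]) auto
        finally show ?thesis using True by simp
      qed simp
    qed
  qed
  also have "\<dots> = (\<Sum>n. \<integral>\<^sup>+a. ennreal ((cmod (d n))\<^sup>2) * ?v n a \<partial>lborel)"
    by (rule nn_integral_suminf) measurable
  also have "\<dots> \<le> (\<Sum>n. ennreal ((cmod (d n))\<^sup>2 * real n powr (- 1 - \<epsilon>)) * mass)"
  proof (intro suminf_le)
    fix n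
    have "(\<integral>\<^sup>+a. ennreal ((cmod (d n))\<^sup>2) * ?v n a \<partial>lborel) = ennreal ((cmod (d n))\<^sup>2) * (\<integral>\<^sup>+a. ?v n a \<partial>lborel)"
      by (rule nn_integral_cmult) measurable
    also have "\<dots> \<le> ennreal ((cmod (d n))\<^sup>2) * (ennreal (real n powr (- 1 - \<epsilon>)) * mass)"
      by (cases "n = 0") (auto simp: f_0 intro!: mult_left_mono dilated_mass)
    also have "\<dots> = ennreal ((cmod (d n))\<^sup>2 * real n powr (- 1 - \<epsilon>)) * mass"
      by (simp add: ennreal_mult mult.assoc)
    finally show "(\<integral>\<^sup>+a. ennreal ((cmod (d n))\<^sup>2) * ?v n a \<partial>lborel)
        \<le> ennreal ((cmod (d n))\<^sup>2 * real n powr (- 1 - \<epsilon>)) * mass" .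
  qed auto
  also have "\<dots> = ennreal (\<Sum>n. (cmod (d n))\<^sup>2 * real n powr (- 1 - \<epsilon>)) * mass"
    by (simp add: suminf_ennreal2 summable_weight)
  finally show ?thesis .
qed

end

section \<open>Borel representatives and the norm inequality\<close>

text \<open>On compact subintervals of the half-line \<open>g\<close> is Lebesgue measurable, hence so is its extension
  by zero, as a limit of truncations; real and imaginary part then have Borel versions.\<close>

lemma borel_representative:
  fixes g :: "real \<Rightarrow> complex"
  assumes "locally_integrable lebesgue {0<..} g"
  obtains f where "f \<in> borel_measurable borel" "\<And>x. x \<le> 0 \<Longrightarrow> f x = 0"
    "AE x in lebesgue. 0 < x \<longrightarrow> g x = f x" "set_borel_measurable lebesgue {0<..} g"
    "\<And>\<alpha> \<beta>. 0 < \<alpha> \<Longrightarrow> set_integrable lborel {\<alpha>..\<beta>} f"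
proof -
  define G where "G x = indicator {0<..} x *\<^sub>R g x" for x
  have loc: "set_integrable lebesgue {\<alpha>..\<beta>} g" if "0 < \<alpha>" for \<alpha> \<beta>
  proof -
    have "{\<alpha>..\<beta>} \<subseteq> {0<..}" using that by auto
    then show ?thesis using assms unfolding locally_integrable_def by blast
  qed
  have Gm: "G \<in> borel_measurable lebesgue"
  proof (rule borel_measurable_LIMSEQ_metric)
    show "(\<lambda>x. indicator {inverse (real (Suc m))..real m} x *\<^sub>R g x) \<in> borel_measurable lebesgue" for m
      using loc[of "inverse (real (Suc m))" "real m"] unfolding set_integrable_def by (intro borel_measurable_integrable) simp
    fix x :: real
    show "(\<lambda>m. indicator {inverse (real (Suc m))..real m} x *\<^sub>R g x) \<longlonglongrightarrow> G x"
    proof (cases "0 < x")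
      case True
      have "\<forall>\<^sub>F m in sequentially. inverse (real (Suc m)) < x"
        by (rule order_tendstoD(2)[OF LIMSEQ_inverse_real_of_nat True])
      moreover have "\<forall>\<^sub>F m in sequentially. x \<le> real m"
        using filterlim_real_sequentially by (simp add: filterlim_at_top)
      ultimately have "\<forall>\<^sub>F m in sequentially. indicator {inverse (real (Suc m))..real m} x *\<^sub>R g x = G x"
        by eventually_elim (use True in \<open>simp add: G_def\<close>)
      then show ?thesis by (rule tendsto_eventually)
    next
      case False
      have "indicator {inverse (real (Suc m))..real m} x = (0 :: real)" for m
        using False order_less_le_trans[of 0 "inverse (real (Suc m))" x] by (auto simp: indicator_def)
      then show ?thesis using False by (simp add: G_def)
    qed
  qed
  have "(\<lambda>x. Re (G x)) \<in> borel_measurable lebesgue" "(\<lambda>x. Im (G x)) \<in> borel_measurable lebesgue"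
    using Gm by (auto intro: measurable_compose[OF Gm] borel_measurable_continuous_onI continuous_intros)
  then obtain r s where rs: "r \<in> borel_measurable lborel" "AE x in lborel. Re (G x) = r x"
    "s \<in> borel_measurable lborel" "AE x in lborel. Im (G x) = s x"
    using completion_ex_borel_measurable_real by metis
  define f where "f x = indicator {0<..} x *\<^sub>R (complex_of_real (r x) + \<i> * complex_of_real (s x))" for x
  have fm: "f \<in> borel_measurable borel"
    unfolding f_def[abs_def] using rs(1,3) by measurable
  have "AE x in lborel. 0 < x \<longrightarrow> g x = f x"
    using rs(2,4)
  proof eventually_elim
    case (elim x)
    then show ?case by (auto simp: f_def G_def complex_eq_iff)
  qed
  then have ae: "AE x in lebesgue. 0 < x \<longrightarrow> g x = f x" by (rule AE_completion)
  have fi: "set_integrable lborel {\<alpha>..\<beta>} f" if "0 < \<alpha>" for \<alpha> \<beta>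
  proof -
    have m: "(\<lambda>x. indicator {\<alpha>..\<beta>} x *\<^sub>R f x) \<in> borel_measurable lborel"
      using fm by measurable
    have "integrable lebesgue (\<lambda>x. indicator {\<alpha>..\<beta>} x *\<^sub>R f x)"
    proof (subst integrable_cong_AE)
      show "integrable lebesgue (\<lambda>x. indicator {\<alpha>..\<beta>} x *\<^sub>R g x)"
        using loc[OF that] by (simp add: set_integrable_def)
      show "AE x in lebesgue. indicator {\<alpha>..\<beta>} x *\<^sub>R f x = indicator {\<alpha>..\<beta>} x *\<^sub>R g x"
        using ae by eventually_elim (use that in \<open>auto simp: indicator_def\<close>)
      show "(\<lambda>x. indicator {\<alpha>..\<beta>} x *\<^sub>R f x) \<in> borel_measurable lebesgue" by (rule measurable_completion[OF m])
      show "(\<lambda>x. indicator {\<alpha>..\<beta>} x *\<^sub>R g x) \<in> borel_measurable lebesgue"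
        using loc[OF that] unfolding set_integrable_def by (rule borel_measurable_integrable)
    qed
    then show ?thesis using integrable_completion[OF m] by (simp add: set_integrable_def)
  qed
  show ?thesis
  proof (rule that[OF fm _ ae _ fi])
    show "f x = 0" if "x \<le> 0" for x using that by (simp add: f_def)
    show "set_borel_measurable lebesgue {0<..} g"
      using Gm by (simp add: set_borel_measurable_def G_def[abs_def])
  qed
qed

theorem theorem1p2:
  fixes d :: "nat \<Rightarrow> complex" and \<epsilon> :: real
  assumes d: "\<And>\<tau>::real. \<tau> > 0 \<Longrightarrow> \<exists>C>0. \<forall>n\<ge>1. cmod (d n) \<le> C * real n powr \<tau>"
    and \<epsilon>: "\<epsilon> > 0"
  shows "\<exists>C::real. C > 0 \<and>
    (\<forall>(f :: real \<Rightarrow> complex) (K :: real).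
       locally_integrable lebesgue {0<..} f \<and> in_Hminf f \<and> K > 0 \<and>
       (\<integral>\<^sup>+a\<in>{K<..}. ennreal (a powr \<epsilon> * (cmod (f a))\<^sup>2) \<partial>lebesgue) < \<infinity> \<longrightarrow>
       matrix_coeff_well_defined (dirac_comb d) f \<and>
       (\<exists>u. matrix_coeff_is_function (dirac_comb d) f u \<and>
          ennreal ((cmod (d 1))\<^sup>2) *
              (\<integral>\<^sup>+a\<in>{K<..}. ennreal (a powr \<epsilon> * (cmod (f a))\<^sup>2) \<partial>lebesgue)
            \<le> (\<integral>\<^sup>+a\<in>{K<..}. (\<integral>\<^sup>+t\<in>{0..1}. ennreal ((cmod (u (a, t)))\<^sup>2) \<partial>lebesgue)
                  * ennreal (a powr \<epsilon> / a) \<partial>lebesgue) \<and>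
          (\<integral>\<^sup>+a\<in>{K<..}. (\<integral>\<^sup>+t\<in>{0..1}. ennreal ((cmod (u (a, t)))\<^sup>2) \<partial>lebesgue)
                  * ennreal (a powr \<epsilon> / a) \<partial>lebesgue)
            \<le> ennreal C * (\<integral>\<^sup>+a\<in>{K<..}. ennreal (a powr \<epsilon> * (cmod (f a))\<^sup>2) \<partial>lebesgue)))"
proof -
  \<comment> \<open>The summand with \<open>n = 0\<close> vanishes, as \<open>0 powr s = 0\<close>. One is added to the constant to
    keep it positive when \<open>d\<close> vanishes.\<close>
  let ?C = "\<Sum>n. (cmod (d n))\<^sup>2 * real n powr (- 1 - \<epsilon>)"
  interpret subpolynomial d \<epsilon> using d \<epsilon> by unfold_locales
  have "?C \<ge> 0" by (intro suminf_nonneg summable_weight) auto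
  show ?thesis
  proof (rule exI[of _ "?C + 1"], rule conjI, goal_cases)
    case 1
    then show ?case using \<open>?C \<ge> 0\<close> by simp
  next
    case 2
    show ?case
    proof (intro allI impI, goal_cases)
      case (1 g K)
      then have g: "locally_integrable lebesgue {0<..} g" "in_Hminf g" and K: "K > 0"
        and g_L2: "(\<integral>\<^sup>+a\<in>{K<..}. ennreal (a powr \<epsilon> * (cmod (g a))\<^sup>2) \<partial>lebesgue) < \<infinity>"
        by auto
      obtain f where f: "f \<in> borel_measurable borel" "\<And>x. x \<le> 0 \<Longrightarrow> f x = 0"
        "AE x in lebesgue. 0 < x \<longrightarrow> g x = f x" "set_borel_measurable lebesgue {0<..} g"
        "\<And>\<alpha> \<beta>. 0 < \<alpha> \<Longrightarrow> set_integrable lborel {\<alpha>..\<beta>} f"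
        using borel_representative[OF g(1)] by metis
      have mass_eq: "(\<integral>\<^sup>+a\<in>{K<..}. ennreal (a powr \<epsilon> * (cmod (g a))\<^sup>2) \<partial>lebesgue)
          = (\<integral>\<^sup>+a\<in>{K<..}. ennreal (a powr \<epsilon> * (cmod (f a))\<^sup>2) \<partial>lborel)"
      proof -
        have "(\<integral>\<^sup>+a\<in>{K<..}. ennreal (a powr \<epsilon> * (cmod (g a))\<^sup>2) \<partial>lebesgue)
          = (\<integral>\<^sup>+a\<in>{K<..}. ennreal (a powr \<epsilon> * (cmod (f a))\<^sup>2) \<partial>lebesgue)"
        proof (rule nn_integral_cong_AE)
          show "AE a in lebesgue. ennreal (a powr \<epsilon> * (cmod (g a))\<^sup>2) * indicator {K<..} a
              = ennreal (a powr \<epsilon> * (cmod (f a))\<^sup>2) * indicator {K<..} a"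
            using f(3) by eventually_elim (use K in \<open>auto simp: indicator_def\<close>)
        qed
        then show ?thesis by (simp only: nn_integral_completion)
      qed
      interpret coefficient_data d \<epsilon> f K
        using d \<epsilon> K f(1,2,5) g_L2 unfolding mass_eq by unfold_locales auto
      obtain F where F: "extends_to g F" using g(2) unfolding in_Hminf_def by blast
      have value_iff: "is_matrix_coeff_value (dirac_comb d) g \<phi> c
          \<longleftrightarrow> c = (LINT x|haar. coefficient x * \<phi> x)"
        if \<phi>: "\<phi> \<in> test_functions (carrier axb)" for \<phi> c
      proof -
        obtain \<alpha> \<beta> and N :: nat where b: "0 < \<alpha>" "\<alpha> < \<beta>" "0 < N" "box_test \<alpha> \<beta> (real N) \<phi>"
          using test_function_imp_box_test[OF \<phi>] by metis
        then obtain C where sm: "smearing d \<phi> \<alpha> \<beta> (real N) C"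
          using smearing_from_growth[of \<alpha> "real N" \<beta> \<phi>] by auto
        show ?thesis
          using smearing.is_matrix_coeff_value_iff[OF sm F]
            extension_at_smeared_eq[OF F f(4,3) b sm] by simp
      qed
      have D: "dirac_comb d \<in> Hminf"
      proof (rule dirac_comb_in_Hminf)
        obtain C where C: "C > 0" "\<And>n. n \<ge> 1 \<Longrightarrow> cmod (d n) \<le> C * real n powr (1 / 2)"
          using d[of "1 / 2"] by auto
        have "summable (\<lambda>n. cmod (d n) / real n ^ 2)"
        proof (rule summable_comparison_test'[of "\<lambda>n. C * real n powr (- 3 / 2)" 1])
          show "summable (\<lambda>n. C * real n powr (- 3 / 2))"
            by (intro summable_mult) (simp add: summable_real_powr_iff)
          fix n :: nat assume n: "n \<ge> 1"
          have "cmod (d n) / real n ^ 2 \<le> C * real n powr (1 / 2) / real n ^ 2"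
            using C(2)[OF n] by (intro divide_right_mono) auto
          also have "real n ^ 2 = real n powr 2" using n by simp
          also have "C * real n powr (1 / 2) / real n powr 2 = C * real n powr (- 3 / 2)"
            using powr_diff[of "real n" "1 / 2" 2] by simp
          finally show "norm (cmod (d n) / real n ^ 2) \<le> C * real n powr (- 3 / 2)" by simp
        qed
        then show "summable (\<lambda>n. cmod (d (Suc n)) / real (Suc n) ^ 2)"
          by (subst summable_Suc_iff)
      qed
      have wd: "matrix_coeff_well_defined (dirac_comb d) g"
        unfolding matrix_coeff_well_defined_def
      proof (intro conjI ballI D)
        fix \<phi> assume "\<phi> \<in> test_functions (carrier axb)"
        then show "\<exists>!c. is_matrix_coeff_value (dirac_comb d) g \<phi> c"
          using value_iff by (intro ex1I[of _ "LINT x|haar. coefficient x * \<phi> x"]) auto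
      qed
      have "matrix_coeff (dirac_comb d) g \<phi> = (LINT x|haar. coefficient x * \<phi> x)"
        if "\<phi> \<in> test_functions (carrier axb)" for \<phi>
        unfolding matrix_coeff_def using value_iff[OF that] by (intro the_equality) auto
      then have fn: "matrix_coeff_is_function (dirac_comb d) g coefficient"
        unfolding matrix_coeff_is_function_def using coefficient_locally_integrable by blast
      have "ennreal ?C * mass \<le> ennreal (?C + 1) * mass"
        by (intro mult_right_mono ennreal_leI) auto
      then have up: "(\<integral>\<^sup>+a\<in>{K<..}. section_mass a
            * ennreal (a powr \<epsilon> / a) \<partial>lborel) \<le> ennreal (?C + 1) * mass"
        using coefficient_upper_bound by (rule order_trans[rotated])
      have mass_g: "(\<integral>\<^sup>+a\<in>{K<..}. ennreal (a powr \<epsilon> * (cmod (g a))\<^sup>2) \<partial>lebesgue) = mass"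
        unfolding mass_eq mass_def ..
      show ?case
        unfolding mass_g unfolding nn_integral_completion
        by (intro conjI exI[of _ coefficient] wd fn
            coefficient_lower_bound[unfolded section_mass_def] up[unfolded section_mass_def])
    qed
  qed
qed

end
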